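(* Let $\mathcal H$ be a separable complex Hilbert space and let $B\in\mathcal B^1(\mathcal H)$ be a trace-class operator with $\mathrm{Re}(\mathrm{tr}(B))\neq 0$. Then the map $$\Xi_B:\{K\in\mathcal B(\mathcal H):\mathrm{Im}(\mathrm{tr}(B^*K))=0\}\times\mathsf{CP}_B(\mathcal H)\to\mathsf L(\mathsf{CP}(\mathcal H)),\qquad (K,\Phi)\mapsto K(\cdot)+(\cdot)K^*+\Phi$$ is bijective.
   Context: $\mathcal B(\mathcal H)$ denotes the bounded operators on $\mathcal H$; $\mathcal B^1(\mathcal H)$ the trace-class operators with trace norm $\|\cdot\|_1$; $\mathcal B^2(\mathcal H)$ the Hilbert-Schmidt operators, a Hilbert space under $\langle X,Y\rangle_{\mathsf{HS}}=\mathrm{tr}(X^*Y)$. Since $\mathcal B^2(\mathcal H)$ is a Hilbert space, $\mathcal B^1(\mathcal B^2(\mathcal H))$ (trace-class operators on it) and the trace of its elements are defined. $\mathsf{CP}(\mathcal H)$ is the set of completely positive linear maps $\Phi:\mathcal B^1(\mathcal H)\to\mathcal B^1(\mathcal H)$ (i.e. $\mathrm{id}_n\otimes\Phi$, acting entrywise on $n\times n$ block operators in $\mathcal B^1(\mathbb C^n\otimes\mathcal H)$, preserves positive semi-definiteness for every $n\in\mathbb N$); such maps are automatically bounded on $(\mathcal B^1(\mathcal H),\|\cdot\|_1)$. For $B\in\mathcal B^1(\mathcal H)$ and $\Phi$ a bounded linear map on $\mathcal B^1(\mathcal H)$, $\Phi(B^*(\cdot)B)$ denotes the map $X\mapsto\Phi(B^*XB)$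 on $\mathcal B^2(\mathcal H)$, which belongs to $\mathcal B^1(\mathcal B^2(\mathcal H))$. Define $$\mathsf{CP}_B(\mathcal H):=\{\Phi\in\mathsf{CP}(\mathcal H):\mathrm{tr}(\Phi(B^*(\cdot)B))=0\}.$$ $\mathsf L(\mathsf{CP}(\mathcal H)):=\{L\in\mathcal B(\mathcal B^1(\mathcal H)):e^{tL}\in\mathsf{CP}(\mathcal H)\text{ for all }t\ge 0\}$, where $\mathcal B(\mathcal B^1(\mathcal H))$ is the space of bounded linear maps on the Banach space $\mathcal B^1(\mathcal H)$. The notation $K(\cdot)+(\cdot)K^*$ means the map $X\mapsto KX+XK^*$ on $\mathcal B^1(\mathcal H)$. (It is a known theorem that $\mathsf L(\mathsf{CP}(\mathcal H))=\{K(\cdot)+(\cdot)K^*+\Phi: K\in\mathcal B(\mathcal H),\Phi\in\mathsf{CP}(\mathcal H)\}$.) *)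

theory Defs
  imports "HOL-Analysis.Analysis"
begin

section \<open>Complex Hilbert spaces\<close>

text \<open>The inner product is conjugate linear in the first and linear in the second argument.\<close>

class chilbert_space = banach +
  fixes scaleC :: "complex \<Rightarrow> 'a \<Rightarrow> 'a"  (infixr \<open>*\<^sub>C\<close> 75)
    and cinner :: "'a \<Rightarrow> 'a \<Rightarrow> complex"
  assumes scaleC_of_real: "complex_of_real r *\<^sub>C x = r *\<^sub>R x"
    and scaleC_add_right: "a *\<^sub>C (x + y) = a *\<^sub>C x + a *\<^sub>C y"
    and scaleC_add_left: "(a + b) *\<^sub>C x = a *\<^sub>C x + b *\<^sub>C x"
    and scaleC_scaleC: "a *\<^sub>C (b *\<^sub>C x) = (a * b) *\<^sub>C x"
    and cinner_commute: "cinner x y = cnj (cinner y x)"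
    and cinner_add_right: "cinner x (y + z) = cinner x y + cinner x z"
    and cinner_scaleC_right: "cinner x (a *\<^sub>C y) = a * cinner x y"
    and cinner_self: "cinner x x = complex_of_real ((norm x)\<^sup>2)"


section \<open>Operators on a Hilbert space\<close>

definition bounded_clinear :: "('a::chilbert_space \<Rightarrow> 'a) \<Rightarrow> bool" where
  "bounded_clinear A \<longleftrightarrow> bounded_linear A \<and> (\<forall>c x. A (c *\<^sub>C x) = c *\<^sub>C A x)"

definition adj :: "('a::chilbert_space \<Rightarrow> 'a) \<Rightarrow> 'a \<Rightarrow> 'a" where
  "adj A = (THE A'. \<forall>x y. cinner (A' x) y = cinner x (A y))"

definition positive_op :: "('a::chilbert_space \<Rightarrow> 'a) \<Rightarrow> bool" where
  "positive_op A \<longleftrightarrow> bounded_clinear A \<and> (\<forall>x. cinner x (A x) \<in> \<real>\<^sub>\<ge>\<^sub>0)"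

definition abs_op :: "('a::chilbert_space \<Rightarrow> 'a) \<Rightarrow> 'a \<Rightarrow> 'a" where
  "abs_op A = (THE P. positive_op P \<and> P \<circ> P = adj A \<circ> A)"

text \<open>
  Orthonormal bases and traces are needed both for \<open>\<H>\<close> and for the Hilbert space of
  Hilbert-Schmidt operators on \<open>\<H>\<close>, so they are defined for a Hilbert space given by a
  carrier \<open>V\<close> and an inner product \<open>ip\<close> on it. The last conjunct says that only the zero
  vector is orthogonal to \<open>E\<close>.
\<close>

definition orthonormal_basis :: "'v set \<Rightarrow> ('v \<Rightarrow> 'v \<Rightarrow> complex) \<Rightarrow> 'v set \<Rightarrow> bool" where
  "orthonormal_basis V ip E \<longleftrightarrow>
     E \<subseteq> V \<and>
     (\<forall>e\<in>E. \<forall>f\<in>E. ip e f = (if e = f then 1 else 0)) \<and>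
     (\<forall>v\<in>V. (\<forall>e\<in>E. ip e v = 0) \<longrightarrow> ip v v = 0)"

text \<open>
  The trace of a trace-class operator does not depend on the orthonormal basis; one is
  picked by choice. Traces are only ever taken of trace-class operators.
\<close>

definition trace_on :: "'v set \<Rightarrow> ('v \<Rightarrow> 'v \<Rightarrow> complex) \<Rightarrow> ('v \<Rightarrow> 'v) \<Rightarrow> complex" where
  "trace_on V ip T = (\<Sum>\<^sub>\<infinity>e\<in>(SOME E. orthonormal_basis V ip E). ip e (T e))"

abbreviation op_trace :: "('a::chilbert_space \<Rightarrow> 'a) \<Rightarrow> complex" where
  "op_trace \<equiv> trace_on UNIV cinner"

definition trace_class :: "('a::chilbert_space \<Rightarrow> 'a) set" where
  "trace_class = {A. bounded_clinear A \<and>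
     (\<exists>E. orthonormal_basis UNIV cinner E \<and> (\<lambda>e. cinner e (abs_op A e)) summable_on E)}"

definition trace_norm :: "('a::chilbert_space \<Rightarrow> 'a) \<Rightarrow> real" where
  "trace_norm A = Re (op_trace (abs_op A))"

definition hilbert_schmidt :: "('a::chilbert_space \<Rightarrow> 'a) set" where
  "hilbert_schmidt = {A. bounded_clinear A \<and>
     (\<exists>E. orthonormal_basis UNIV cinner E \<and> (\<lambda>e. (norm (A e))\<^sup>2) summable_on E)}"

definition hs_inner :: "('a::chilbert_space \<Rightarrow> 'a) \<Rightarrow> ('a \<Rightarrow> 'a) \<Rightarrow> complex" where
  "hs_inner X Y = op_trace (adj X \<circ> Y)"

abbreviation hs_trace :: "(('a::chilbert_space \<Rightarrow> 'a) \<Rightarrow> ('a \<Rightarrow> 'a)) \<Rightarrow> complex" where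
  "hs_trace \<equiv> trace_on hilbert_schmidt hs_inner"


section \<open>Maps on the trace class\<close>

text \<open>
  Maps on the trace class are total functions that are \<^const>\<open>undefined\<close> outside
  \<^const>\<open>trace_class\<close>, so that two of them are equal iff they agree on the trace class.
\<close>

definition linear_maps :: "(('a::chilbert_space \<Rightarrow> 'a) \<Rightarrow> ('a \<Rightarrow> 'a)) set" where
  "linear_maps = {\<Phi> \<in> trace_class \<rightarrow>\<^sub>E trace_class.
     (\<forall>X\<in>trace_class. \<forall>Y\<in>trace_class. \<Phi> (\<lambda>x. X x + Y x) = (\<lambda>x. \<Phi> X x + \<Phi> Y x)) \<and>
     (\<forall>c. \<forall>X\<in>trace_class. \<Phi> (\<lambda>x. c *\<^sub>C X x) = (\<lambda>x. c *\<^sub>C \<Phi> X x))}"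

definition bounded_maps :: "(('a::chilbert_space \<Rightarrow> 'a) \<Rightarrow> ('a \<Rightarrow> 'a)) set" where
  "bounded_maps = {L \<in> linear_maps. \<exists>C. \<forall>X\<in>trace_class. trace_norm (L X) \<le> C * trace_norm X}"

text \<open>
  An operator on \<open>\<complex>\<^sup>n \<otimes> \<H> = \<H>\<^sup>n\<close> is given by its \<open>n \<times> n\<close> blocks \<open>X i j\<close>, \<open>i, j < n\<close>, which
  are operators on \<open>\<H>\<close>; it maps the vector with components \<open>x j\<close> to the one with components
  \<open>\<Sum>j<n. X i j (x j)\<close>. It is trace class iff all its blocks are.
\<close>

definition block_positive :: "nat \<Rightarrow> (nat \<Rightarrow> nat \<Rightarrow> 'a::chilbert_space \<Rightarrow> 'a) \<Rightarrow> bool" where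
  "block_positive n X \<longleftrightarrow>
     (\<forall>x. (\<Sum>i<n. cinner (x i) (\<Sum>j<n. X i j (x j))) \<in> \<real>\<^sub>\<ge>\<^sub>0)"

definition CP :: "(('a::chilbert_space \<Rightarrow> 'a) \<Rightarrow> ('a \<Rightarrow> 'a)) set" where
  "CP = {\<Phi> \<in> linear_maps. \<forall>n X.
     (\<forall>i<n. \<forall>j<n. X i j \<in> trace_class) \<and> block_positive n X \<longrightarrow>
     block_positive n (\<lambda>i j. \<Phi> (X i j))}"

definition CP_on :: "('a::chilbert_space \<Rightarrow> 'a) \<Rightarrow> (('a \<Rightarrow> 'a) \<Rightarrow> ('a \<Rightarrow> 'a)) set" where
  "CP_on B = {\<Phi> \<in> CP. hs_trace (\<lambda>X. \<Phi> (adj B \<circ> X \<circ> B)) = 0}"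

text \<open>\<open>e\<^bsup>tL\<^esup>\<close>: the value at \<open>X\<close> is the limit of the exponential series in trace norm.\<close>

definition exp_map ::
  "real \<Rightarrow> (('a::chilbert_space \<Rightarrow> 'a) \<Rightarrow> ('a \<Rightarrow> 'a)) \<Rightarrow> ('a \<Rightarrow> 'a) \<Rightarrow> ('a \<Rightarrow> 'a)" where
  "exp_map t L = (\<lambda>X\<in>trace_class. THE Y. Y \<in> trace_class \<and>
     (\<lambda>n. trace_norm (\<lambda>x. Y x - (\<Sum>k<n. (t ^ k / fact k) *\<^sub>R (L ^^ k) X x))) \<longlonglongrightarrow> 0)"

definition LCP :: "(('a::chilbert_space \<Rightarrow> 'a) \<Rightarrow> ('a \<Rightarrow> 'a)) set" where
  "LCP = {L \<in> bounded_maps. \<forall>t\<ge>0. exp_map t L \<in> CP}"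

definition Xi_map ::
  "('a::chilbert_space \<Rightarrow> 'a) \<times> (('a \<Rightarrow> 'a) \<Rightarrow> ('a \<Rightarrow> 'a)) \<Rightarrow> ('a \<Rightarrow> 'a) \<Rightarrow> ('a \<Rightarrow> 'a)" where
  "Xi_map = (\<lambda>(K, \<Phi>). \<lambda>X\<in>trace_class. \<lambda>x. K (X x) + X (adj K x) + \<Phi> X x)"

end

theory Submission
  imports Defs
begin

text \<open>
  Every trace class operator is a sum \<open>\<Sum>i. |u i><v i|\<close> with \<open>\<Sum>i. \<parallel>u i\<parallel> \<parallel>v i\<parallel>\<close> equal to its trace norm.
  Hence a bounded map \<open>L\<close> on the trace class has a bounded sesquilinear form \<open>Q\<^sub>L\<close> on the trace class
  with \<open>Q\<^sub>L(|x><y|, |x'><y'|) = <y, L(|x><x'|) y'>\<close>; it is positive semidefinite iff \<open>L\<close> is completely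
  positive, and for \<open>\<beta> = B\<^sup>*\<close> the trace of \<open>\<Phi>(B\<^sup>*(\<cdot>)B)\<close> is \<open>Q\<^sub>\<Phi>(\<beta>, \<beta>)\<close>. The map \<open>K(\<cdot>) + (\<cdot>)K\<^sup>*\<close> has the form
  \<open>tr(K A) cnj (tr C) + tr A cnj (tr(K C))\<close>.

  Injectivity: if \<open>Q\<^sub>\<Phi>(\<beta>, \<beta>) = 0\<close>, then \<open>Q\<^sub>\<Phi>(A, \<beta>) = 0\<close> for all \<open>A\<close> by Cauchy-Schwarz, so that \<open>Q\<^sub>L(\<cdot>, \<beta>)\<close>
  determines \<open>tr(K A)\<close> for all \<open>A\<close>. Surjectivity: differentiating \<open>e\<^bsup>tL\<^esup>\<close> at \<open>0\<close> gives \<open>Q\<^sub>L(A, A) \<ge> 0\<close>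
  whenever \<open>tr A = 0\<close>. Put \<open>A' = A - (tr A / tr \<beta>) \<beta>\<close>; then \<open>Q\<^sub>L(A', A')\<close> is positive semidefinite, vanishes
  at \<open>A = \<beta>\<close>, and differs from \<open>Q\<^sub>L(A, A)\<close> by the form of some \<open>K(\<cdot>) + (\<cdot>)K\<^sup>*\<close>, where \<open>K\<close> is determined up to
  adding an imaginary multiple of the identity.
\<close>

text \<open>The nonvanishing real part of tr \<beta> serves both halves. Adding \<i> s times the
  identity to K leaves the Lyapunov part unchanged and shifts Im tr(K \<beta>) by s Re tr \<beta>,
  so the normalisation can be reached. Conversely, at A = C = \<beta> the Lyapunov form is 2 tr(K
  \<beta>) Re tr \<beta> once tr(K \<beta>) is real, so L determines the normalised value.
  Completely positive maps are not assumed bounded, so boundedness has to be proved before their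
  forms exist. The form itself is a trace over a basis of Hilbert-Schmidt operators fixed by choice;
  a double sum over that basis and over rank one terms removes the choice and makes the form
  computable. The form tests a map on rank one operators only, whereas complete positivity
  quantifies over arbitrary positive blocks. Compression to finitely many basis vectors and the
  Schur product theorem close this gap. That the map takes values in the generators is a separate
  matter: the exponential is a limit of powers of completely positive maps, into which K enters by
  conjugation.\<close>

lemma has_sum_eqI:
  fixes a b :: "'b::{topological_comm_monoid_add,t2_space}"
  assumes "(f has_sum a) I" "(g has_sum b) I" "\<And>i. i \<in> I \<Longrightarrow> f i = g i"
  shows "a = b"
  by (rule has_sum_unique[OF assms(1)]) (subst has_sum_cong[of I f g b], simp_all add: assms)

section \<open>Hilbert spaces\<close>

lemma scaleC_zero_left [simp]: "0 *\<^sub>C x = (0::'a::chilbert_space)"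
  using scaleC_of_real[of 0 x] by simp

lemma scaleC_one [simp]: "1 *\<^sub>C x = (x::'a::chilbert_space)"
  using scaleC_of_real[of 1 x] by simp

lemma scaleC_minus_left: "(- a) *\<^sub>C x = - (a *\<^sub>C x :: 'a::chilbert_space)"
  using scaleC_add_left[of a "-a" x] by (simp add: eq_neg_iff_add_eq_0 add.commute)

lemma scaleC_zero_right [simp]: "a *\<^sub>C 0 = (0::'a::chilbert_space)"
  using scaleC_add_right[of a 0 "0::'a"] by simp

lemma scaleC_minus_right: "a *\<^sub>C (- x) = - (a *\<^sub>C x :: 'a::chilbert_space)"
  using scaleC_add_right[of a x "-x"] by (simp add: eq_neg_iff_add_eq_0 add.commute)

lemma scaleC_diff_right: "a *\<^sub>C (x - y) = a *\<^sub>C x - (a *\<^sub>C y :: 'a::chilbert_space)"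
  using scaleC_add_right[of a x "-y"] by (simp add: scaleC_minus_right)

lemma cinner_add_left: "cinner (x + y) z = cinner x z + cinner y (z::'a::chilbert_space)"
  by (subst (1 2 3) cinner_commute) (simp add: cinner_add_right)

lemma cinner_scaleC_left: "cinner (a *\<^sub>C x) y = cnj a * cinner x (y::'a::chilbert_space)"
  by (subst (1 2) cinner_commute) (simp add: cinner_scaleC_right)

lemma cinner_zero_right [simp]: "cinner x (0::'a::chilbert_space) = 0"
  using cinner_scaleC_right[of x 0 0] by simp

lemma cinner_zero_left [simp]: "cinner (0::'a::chilbert_space) x = 0"
  using cinner_scaleC_left[of 0 0 x] by simp

lemma cinner_minus_right: "cinner x (- y) = - cinner x (y::'a::chilbert_space)"
  using cinner_scaleC_right[of x "-1" y] by (simp add: scaleC_minus_left)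

lemma cinner_minus_left: "cinner (- x) y = - cinner x (y::'a::chilbert_space)"
  using cinner_scaleC_left[of "-1" x y] by (simp add: scaleC_minus_left)

lemma cinner_diff_right: "cinner x (y - z) = cinner x y - cinner x (z::'a::chilbert_space)"
  using cinner_add_right[of x y "-z"] by (simp add: cinner_minus_right)

lemma cinner_diff_left: "cinner (x - y) z = cinner x z - cinner y (z::'a::chilbert_space)"
  using cinner_add_left[of x "-y" z] by (simp add: cinner_minus_left)

lemma cinner_scaleR_right: "cinner x (r *\<^sub>R y) = of_real r * cinner x (y::'a::chilbert_space)"
  by (metis cinner_scaleC_right scaleC_of_real)

lemma cinner_scaleR_left: "cinner (r *\<^sub>R x) y = of_real r * cinner x (y::'a::chilbert_space)"
  by (metis cinner_scaleC_left complex_cnj_complex_of_real scaleC_of_real)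

lemmas cinner_simps = cinner_add_left cinner_add_right cinner_diff_left cinner_diff_right
  cinner_scaleC_left cinner_scaleC_right cinner_scaleR_left cinner_scaleR_right
  cinner_minus_left cinner_minus_right

lemma cinner_sum_right: "cinner x (\<Sum>i\<in>I. f i) = (\<Sum>i\<in>I. cinner x (f i :: 'a::chilbert_space))"
  by (induction I rule: infinite_finite_induct) (auto simp: cinner_add_right)

lemma cinner_sum_left: "cinner (\<Sum>i\<in>I. f i) x = (\<Sum>i\<in>I. cinner (f i) (x :: 'a::chilbert_space))"
  by (induction I rule: infinite_finite_induct) (auto simp: cinner_add_left)

lemma scaleC_sum_right: "a *\<^sub>C (\<Sum>i\<in>I. f i) = (\<Sum>i\<in>I. a *\<^sub>C (f i :: 'a::chilbert_space))"
  by (induction I rule: infinite_finite_induct) (auto simp: scaleC_add_right)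

lemma norm_scaleC: "norm (a *\<^sub>C x) = cmod a * norm (x::'a::chilbert_space)"
proof -
  have "complex_of_real ((norm (a *\<^sub>C x))\<^sup>2) = complex_of_real ((cmod a * norm x)\<^sup>2)"
  proof -
    have "complex_of_real ((norm (a *\<^sub>C x))\<^sup>2) = (cnj a * a) * cinner x x"
      by (simp only: cinner_self[symmetric] cinner_simps mult.assoc mult.left_commute)
    also have "cnj a * a = complex_of_real ((cmod a)\<^sup>2)"
      by (simp only: complex_norm_square mult.commute)
    finally show ?thesis by (simp add: cinner_self power_mult_distrib)
  qed
  hence "(norm (a *\<^sub>C x))\<^sup>2 = (cmod a * norm x)\<^sup>2"
    using of_real_eq_iff by blast
  thus ?thesis by (simp add: power2_eq_iff_nonneg)
qed

lemma Re_cinner_self: "Re (cinner x x) = (norm (x::'a::chilbert_space))\<^sup>2"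
  by (simp add: cinner_self)

lemma norm_add_sq:
  "(norm (x + y))\<^sup>2 = (norm x)\<^sup>2 + 2 * Re (cinner x y) + (norm (y::'a::chilbert_space))\<^sup>2"
proof -
  have "Re (cinner y x) = Re (cinner x y)" by (subst cinner_commute) simp
  thus ?thesis by (simp add: Re_cinner_self[symmetric] cinner_simps del: of_real_power)
qed

lemma norm_diff_sq:
  "(norm (x - y))\<^sup>2 = (norm x)\<^sup>2 - 2 * Re (cinner x y) + (norm (y::'a::chilbert_space))\<^sup>2"
  using norm_add_sq[of x "-y"] by (simp add: cinner_minus_right)

lemma cinner_Cauchy_Schwarz: "cmod (cinner x y) \<le> norm x * norm (y::'a::chilbert_space)"
proof (cases "norm x = 0")
  case True thus ?thesis by auto
next
  case False
  define c where "c = cinner x y / of_real ((norm x)\<^sup>2)"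
  have nx: "(norm x)\<^sup>2 > 0" using False by simp
  have "0 \<le> (norm (y - c *\<^sub>C x))\<^sup>2" by simp
  also have "\<dots> = (norm y)\<^sup>2 - 2 * Re (cinner y (c *\<^sub>C x)) + (norm (c *\<^sub>C x))\<^sup>2"
    by (rule norm_diff_sq)
  also have "cinner y (c *\<^sub>C x) = of_real ((cmod (cinner x y))\<^sup>2 / (norm x)\<^sup>2)"
    unfolding c_def cinner_scaleC_right
    by (subst (2) cinner_commute) (simp add: complex_norm_square[symmetric] flip: of_real_power of_real_divide)
  also have "(norm (c *\<^sub>C x))\<^sup>2 = (cmod (cinner x y))\<^sup>2 / (norm x)\<^sup>2"
  proof -
    have "cmod c = cmod (cinner x y) / (norm x)\<^sup>2" by (simp add: c_def norm_divide norm_power)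
    thus ?thesis using nx by (simp add: norm_scaleC power_mult_distrib power_divide) (simp add: power2_eq_square power4_eq_xxxx)
  qed
  finally have "(cmod (cinner x y))\<^sup>2 / (norm x)\<^sup>2 \<le> (norm y)\<^sup>2" by simp
  hence "(cmod (cinner x y))\<^sup>2 \<le> (norm x * norm y)\<^sup>2"
    using nx by (simp add: divide_simps power_mult_distrib mult.commute split: if_splits)
  thus ?thesis by (rule power2_le_imp_le) simp
qed

lemma bounded_bilinear_cinner: "bounded_bilinear (cinner :: 'a::chilbert_space \<Rightarrow> 'a \<Rightarrow> complex)"
  by standard
    (auto simp: cinner_simps scaleR_conv_of_real intro!: exI[of _ 1] cinner_Cauchy_Schwarz)

lemma bounded_bilinear_scaleC: "bounded_bilinear (scaleC :: complex \<Rightarrow> 'a::chilbert_space \<Rightarrow> 'a)"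
proof
  show "(r *\<^sub>R a) *\<^sub>C b = r *\<^sub>R (a *\<^sub>C b)" for r a and b :: 'a
    by (simp add: scaleC_of_real[symmetric] scaleC_scaleC scaleR_conv_of_real)
  show "a *\<^sub>C (r *\<^sub>R b) = r *\<^sub>R (a *\<^sub>C b)" for r a and b :: 'a
    by (simp add: scaleC_of_real[symmetric] scaleC_scaleC mult.commute)
  show "\<exists>K. \<forall>a (b::'a). norm (a *\<^sub>C b) \<le> norm a * norm b * K"
    by (rule exI[of _ 1]) (simp add: norm_scaleC)
qed (simp_all add: scaleC_add_left scaleC_add_right)

lemmas bounded_linear_cinner_right = bounded_bilinear.bounded_linear_right[OF bounded_bilinear_cinner]
lemmas bounded_linear_scaleC_right = bounded_bilinear.bounded_linear_right[OF bounded_bilinear_scaleC]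
lemmas bounded_linear_scaleC_left = bounded_bilinear.bounded_linear_left[OF bounded_bilinear_scaleC]
lemmas has_sum_cinner_right = has_sum_bounded_linear[OF bounded_linear_cinner_right]
lemmas has_sum_scaleC_right = has_sum_bounded_linear[OF bounded_linear_scaleC_right]
lemmas has_sum_scaleC_left = has_sum_bounded_linear[OF bounded_linear_scaleC_left]
lemmas tendsto_cinner [tendsto_intros] = bounded_bilinear.tendsto[OF bounded_bilinear_cinner]
lemmas tendsto_scaleC [tendsto_intros] = bounded_bilinear.tendsto[OF bounded_bilinear_scaleC]

lemma cinner_eqI: "x = (y::'a::chilbert_space)" if "\<And>z. cinner z x = cinner z y"
proof -
  have "cinner (x - y) (x - y) = 0" using that[of "x - y"] by (simp add: cinner_diff_right)
  thus ?thesis by (simp add: cinner_self)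
qed

lemma cinner_eq_zero_commute: "cinner x y = 0 \<longleftrightarrow> cinner y (x::'a::chilbert_space) = 0"
  by (metis cinner_commute complex_cnj_zero)

section \<open>Orthonormal families, Bessel's inequality and Parseval's identity\<close>

definition orthonormal :: "'a::chilbert_space set \<Rightarrow> bool" where
  "orthonormal E \<longleftrightarrow> (\<forall>e\<in>E. \<forall>f\<in>E. cinner e f = (if e = f then 1 else 0))"

lemma orthonormal_cinner_sum:
  assumes "orthonormal E" "finite F" "F \<subseteq> E" "e \<in> F"
  shows "cinner e (\<Sum>f\<in>F. c f *\<^sub>C f) = c e"
proof -
  have "cinner e (\<Sum>f\<in>F. c f *\<^sub>C f) = (\<Sum>f\<in>F. c f * (if e = f then 1 else 0))"
    unfolding cinner_sum_right cinner_scaleC_right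
    using assms by (intro sum.cong) (auto simp: orthonormal_def subset_iff)
  also have "\<dots> = (\<Sum>f\<in>F. if e = f then c f else 0)" by (intro sum.cong) auto
  finally show ?thesis using assms by simp
qed

lemma orthonormal_norm_sum:
  assumes "orthonormal E" "finite F" "F \<subseteq> E"
  shows "(norm (\<Sum>f\<in>F. c f *\<^sub>C f))\<^sup>2 = (\<Sum>f\<in>F. (cmod (c f))\<^sup>2)"
proof -
  have "cinner (\<Sum>f\<in>F. c f *\<^sub>C f) (\<Sum>f\<in>F. c f *\<^sub>C f) = (\<Sum>f\<in>F. of_real ((cmod (c f))\<^sup>2))"
    unfolding cinner_sum_left cinner_scaleC_left
    by (rule sum.cong) (auto simp only: orthonormal_cinner_sum[OF assms] complex_norm_square mult.commute)
  thus ?thesis by (simp only: cinner_self of_real_sum[symmetric] of_real_eq_iff)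
qed

lemma Bessel_finite:
  assumes "orthonormal E" "finite F" "F \<subseteq> E"
  shows "(\<Sum>f\<in>F. (cmod (cinner f x))\<^sup>2) \<le> (norm x)\<^sup>2"
proof -
  let ?p = "\<Sum>f\<in>F. cinner f x *\<^sub>C f"
  have "cinner ?p x = of_real (\<Sum>f\<in>F. (cmod (cinner f x))\<^sup>2)"
    unfolding cinner_sum_left cinner_scaleC_left of_real_sum
    by (rule sum.cong) (auto simp only: complex_norm_square mult.commute)
  hence "Re (cinner x ?p) = (\<Sum>f\<in>F. (cmod (cinner f x))\<^sup>2)"
    by (subst cinner_commute) simp
  hence "0 \<le> (norm x)\<^sup>2 - (\<Sum>f\<in>F. (cmod (cinner f x))\<^sup>2)"
    using norm_diff_sq[of x ?p] orthonormal_norm_sum[OF assms, of "\<lambda>f. cinner f x"]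
    by (smt (verit) zero_le_power2)
  thus ?thesis by simp
qed

lemma Bessel_summable:
  assumes "orthonormal E"
  shows "(\<lambda>e. (cmod (cinner e x))\<^sup>2) summable_on E"
    and "(\<Sum>\<^sub>\<infinity>e\<in>E. (cmod (cinner e x))\<^sup>2) \<le> (norm x)\<^sup>2"
proof -
  show *: "(\<lambda>e. (cmod (cinner e x))\<^sup>2) summable_on E"
    using Bessel_finite[OF assms] by (intro nonneg_bdd_above_summable_on bdd_aboveI2) auto
  show "(\<Sum>\<^sub>\<infinity>e\<in>E. (cmod (cinner e x))\<^sup>2) \<le> (norm x)\<^sup>2"
    using Bessel_finite[OF assms] by (intro infsum_le_finite_sums *) auto
qed

text \<open>Orthogonal series need not converge absolutely, so comparison is replaced by the Cauchy
  criterion along finite subsets: the partial sum of \<open>f\<close> over a difference of index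
  sets is controlled by the corresponding difference for \<open>g\<close>.\<close>

lemma summable_on_norm_sq_bound:
  fixes f :: "'i \<Rightarrow> 'b::banach" and g :: "'i \<Rightarrow> real"
  assumes g: "g summable_on A"
    and le: "\<And>F. finite F \<Longrightarrow> F \<subseteq> A \<Longrightarrow> (norm (sum f F))\<^sup>2 \<le> sum g F"
  shows "f summable_on A"
proof -
  obtain L where lim: "(sum g \<longlongrightarrow> L) (finite_subsets_at_top A)"
    using g unfolding has_sum_def summable_on_def by blast
  have "\<exists>P. eventually P (finite_subsets_at_top A) \<and>
              (\<forall>F F'. P F \<and> P F' \<longrightarrow> dist (sum f F) (sum f F') < e)" if "e > 0" for e
  proof -
    \<comment> \<open>Two partial sums of \<open>g\<close> within \<open>d\<close> of
      \<open>L\<close> differ by less than \<open>2 * d = (e/2)^2\<close>, which bounds the squared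
      norm over the difference set. The other half of \<open>e\<close> is spent on the second index
      set.\<close>
    define d where "d = (e/2)\<^sup>2 / 2"
    have "d > 0" using that by (simp add: d_def)
    define P where "P F \<longleftrightarrow> finite F \<and> F \<subseteq> A \<and> dist (sum g F) L < d" for F
    have ev_P: "eventually P (finite_subsets_at_top A)"
      using lim by (auto simp add: P_def[abs_def] \<open>0 < d\<close> eventually_conj_iff
        eventually_finite_subsets_at_top_weakI tendsto_iff)
    obtain F0 where F0: "finite F0" "F0 \<subseteq> A" and PF0: "\<And>F. finite F \<Longrightarrow> F \<supseteq> F0 \<Longrightarrow> F \<subseteq> A \<Longrightarrow> P F"
      using ev_P unfolding eventually_finite_subsets_at_top by metis
    define P' where "P' F \<longleftrightarrow> finite F \<and> F0 \<subseteq> F \<and> F \<subseteq> A" for F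
    have "eventually P' (finite_subsets_at_top A)"
      unfolding P'_def eventually_finite_subsets_at_top using F0 by blast
    moreover have near: "dist (sum f F) (sum f F0) < e/2" if "P' F" for F
    proof -
      have F: "finite F" "F0 \<subseteq> F" "F \<subseteq> A" using that by (auto simp: P'_def)
      have "(norm (sum f (F - F0)))\<^sup>2 \<le> sum g (F - F0)" using F by (intro le) auto
      also have "\<dots> = sum g F - sum g F0" using F F0 by (simp add: sum_diff)
      also have "\<dots> < 2 * d" using PF0[of F] PF0[of F0] F F0 by (auto simp: P_def dist_real_def)
      finally have "(norm (sum f (F - F0)))\<^sup>2 < (e/2)\<^sup>2" by (simp add: d_def)
      hence "norm (sum f (F - F0)) < e/2" using \<open>e > 0\<close> by (intro power2_less_imp_less[of _ "e/2"]) auto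
      thus ?thesis using F F0 by (simp add: sum_diff dist_norm)
    qed
    ultimately show ?thesis
      by (metis dist_triangle_half_l)
  qed
  hence "cauchy_filter (filtermap (sum f) (finite_subsets_at_top A))"
    by (simp add: cauchy_filter_metric_filtermap)
  moreover have "complete (UNIV::'b set)"
    by (meson Cauchy_convergent UNIV_I complete_def convergent_def)
  ultimately obtain L' where "(sum f \<longlongrightarrow> L') (finite_subsets_at_top A)"
    using complete_uniform[where S=UNIV] by (force simp add: filterlim_def)
  thus ?thesis using summable_on_def has_sum_def by blast
qed

lemma orthonormal_summable:
  assumes "orthonormal E" "(\<lambda>e. (cmod (c e))\<^sup>2) summable_on E"
  shows "(\<lambda>e. c e *\<^sub>C e) summable_on E"
  by (rule summable_on_norm_sq_bound[OF assms(2)]) (simp add: orthonormal_norm_sum[OF assms(1)])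

lemma orthonormal_cinner_infsum:
  assumes "orthonormal E" "(\<lambda>e. (cmod (c e))\<^sup>2) summable_on E" "e \<in> E"
  shows "cinner e (\<Sum>\<^sub>\<infinity>f\<in>E. c f *\<^sub>C f) = c e"
proof -
  have "((\<lambda>f. cinner e (c f *\<^sub>C f)) has_sum cinner e (\<Sum>\<^sub>\<infinity>f\<in>E. c f *\<^sub>C f)) E"
    by (rule has_sum_cinner_right) (use orthonormal_summable[OF assms(1,2)] in auto)
  moreover have "((\<lambda>f. cinner e (c f *\<^sub>C f)) has_sum c e) E"
    by (rule has_sum_finite_neutralI[of "{e}"])
      (use assms in \<open>auto simp: cinner_scaleC_right orthonormal_def\<close>)
  ultimately show ?thesis by (rule has_sum_unique)
qed

text \<open>Zorn's lemma. Closure under scalars is all that normalising a missing vector requires.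
  With \<open>V = UNIV\<close> this yields orthonormal bases, with a closed subspace the family
  behind its projection.\<close>

lemma maximal_orthonormal_exists:
  fixes V :: "'a::chilbert_space set"
  assumes V: "\<And>x c. x \<in> V \<Longrightarrow> c *\<^sub>C x \<in> V"
  obtains E where "E \<subseteq> V" "orthonormal E" "\<And>x. x \<in> V \<Longrightarrow> (\<And>e. e \<in> E \<Longrightarrow> cinner e x = 0) \<Longrightarrow> x = 0"
proof -
  let ?S = "{E. E \<subseteq> V \<and> orthonormal E}"
  have "\<exists>M\<in>?S. \<forall>X\<in>?S. M \<subseteq> X \<longrightarrow> X = M"
  proof (rule subset_Zorn')
    fix C assume C: "subset.chain ?S C"
    show "\<Union>C \<in> ?S"
    proof (clarsimp, intro conjI)
      show "\<Union>C \<subseteq> V" using C by (auto simp: subset.chain_def)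
      show "orthonormal (\<Union>C)" unfolding orthonormal_def
      proof (intro ballI)
        fix e f assume "e \<in> \<Union>C" "f \<in> \<Union>C"
        then obtain X Y where XY: "X \<in> C" "e \<in> X" "Y \<in> C" "f \<in> Y" by auto
        moreover have "X \<subseteq> Y \<or> Y \<subseteq> X"
          using C XY unfolding subset.chain_def by blast
        ultimately obtain Z where "Z \<in> C" "e \<in> Z" "f \<in> Z" by blast
        thus "cinner e f = (if e = f then 1 else 0)"
          using C by (auto simp: subset.chain_def orthonormal_def)
      qed
    qed
  qed
  then obtain E where E: "E \<subseteq> V" "orthonormal E"
    and max: "\<And>X. X \<subseteq> V \<Longrightarrow> orthonormal X \<Longrightarrow> E \<subseteq> X \<Longrightarrow> X = E" by auto
  have "x = 0" if x: "x \<in> V" and orth: "\<And>e. e \<in> E \<Longrightarrow> cinner e x = 0" for x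
  proof (rule ccontr)
    assume nz: "x \<noteq> 0"
    define y where "y = complex_of_real (1 / norm x) *\<^sub>C x"
    have "cinner y y = 1"
      unfolding y_def using nz by (simp add: cinner_simps) (simp add: cinner_self power2_eq_square)
    moreover have "cinner e y = 0" if "e \<in> E" for e
      using orth[OF that] by (simp add: y_def cinner_simps)
    moreover have "y \<in> V" using V x by (simp add: y_def)
    ultimately have "insert y E = E" using E
      by (intro max) (auto simp: orthonormal_def cinner_eq_zero_commute[of y])
    hence "cinner y y = 0" using \<open>\<And>e. e \<in> E \<Longrightarrow> cinner e y = 0\<close> by blast
    thus False using \<open>cinner y y = 1\<close> by simp
  qed
  with E show ?thesis by (rule that)
qed

definition onb :: "'a::chilbert_space set \<Rightarrow> bool" where
  "onb E \<longleftrightarrow> orthonormal E \<and> (\<forall>x. (\<forall>e\<in>E. cinner e x = 0) \<longrightarrow> x = 0)"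

lemma orthonormal_basis_UNIV: "orthonormal_basis UNIV cinner E \<longleftrightarrow> onb E"
  by (auto simp: orthonormal_basis_def onb_def orthonormal_def cinner_self)

lemma onb_exists: "\<exists>E::'a::chilbert_space set. onb E"
  by (rule maximal_orthonormal_exists[of UNIV]) (auto simp: onb_def)

lemma onb_orthonormal: "onb E \<Longrightarrow> orthonormal E" by (simp add: onb_def)

text \<open>The Fourier series converges by Bessel, and the remainder is orthogonal to every basis
  vector, hence zero.\<close>

lemma onb_expansion:
  assumes "onb E"
  shows "((\<lambda>e. cinner e x *\<^sub>C e) has_sum x) E"
proof -
  have E: "orthonormal E" using assms by (simp add: onb_def)
  have s: "(\<lambda>e. cinner e x *\<^sub>C e) summable_on E"
    by (intro orthonormal_summable E Bessel_summable)
  have "cinner e (x - (\<Sum>\<^sub>\<infinity>e\<in>E. cinner e x *\<^sub>C e)) = 0" if "e \<in> E" for e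
    using orthonormal_cinner_infsum[OF E Bessel_summable(1)[OF E] that] by (simp add: cinner_diff_right)
  hence "x - (\<Sum>\<^sub>\<infinity>e\<in>E. cinner e x *\<^sub>C e) = 0"
    using assms unfolding onb_def by blast
  thus ?thesis using has_sum_infsum[OF s] by simp
qed

lemma Parseval:
  assumes "onb E"
  shows "((\<lambda>e. cinner x e * cinner e y) has_sum cinner x y) E"
  using has_sum_cinner_right[OF onb_expansion[OF assms, of y], of x]
  by (simp add: cinner_scaleC_right mult.commute)

lemma Parseval_norm:
  assumes "onb E"
  shows "((\<lambda>e. (cmod (cinner e x))\<^sup>2) has_sum (norm x)\<^sup>2) E"
proof -
  have "((\<lambda>e. Re (cinner x e * cinner e x)) has_sum Re (cinner x x)) E"
    by (intro has_sum_Re Parseval assms)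
  moreover have "Re (cinner x e * cinner e x) = (cmod (cinner e x))\<^sup>2" for e
    by (subst cinner_commute[of x]) (simp add: cmod_power2, simp add: power2_eq_square)
  ultimately show ?thesis by (simp add: Re_cinner_self)
qed

lemma Parseval_abs_finite:
  assumes "orthonormal E" "finite F" "F \<subseteq> E"
  shows "(\<Sum>e\<in>F. cmod (cinner x e) * cmod (cinner e y)) \<le> norm x * norm y"
proof -
  have "(\<Sum>e\<in>F. cmod (cinner x e) * cmod (cinner e y))
     \<le> L2_set (\<lambda>e. cmod (cinner x e)) F * L2_set (\<lambda>e. cmod (cinner e y)) F"
    using L2_set_mult_ineq[of "\<lambda>e. cmod (cinner x e)" "\<lambda>e. cmod (cinner e y)" F] by simp
  also have "\<dots> \<le> norm x * norm y"
  proof (rule mult_mono)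
    have "(\<Sum>e\<in>F. (cmod (cinner x e))\<^sup>2) = (\<Sum>e\<in>F. (cmod (cinner e x))\<^sup>2)"
      by (subst cinner_commute) simp
    thus "L2_set (\<lambda>e. cmod (cinner x e)) F \<le> norm x"
      unfolding L2_set_def using Bessel_finite[OF assms, of x] by (intro real_le_lsqrt) auto
    show "L2_set (\<lambda>e. cmod (cinner e y)) F \<le> norm y"
      unfolding L2_set_def using Bessel_finite[OF assms, of y] by (intro real_le_lsqrt) auto
  qed (auto simp: L2_set_nonneg)
  finally show ?thesis .
qed

text \<open>Supplies the Fubini majorant, with a bound that does not mention the family, for
  exchanging a sum over a basis with a sum over rank one terms.\<close>

lemma Parseval_abs:
  assumes "orthonormal E"
  shows "(\<lambda>e. cmod (cinner x e) * cmod (cinner e y)) summable_on E"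
    and "(\<Sum>\<^sub>\<infinity>e\<in>E. cmod (cinner x e) * cmod (cinner e y)) \<le> norm x * norm y"
proof -
  show *: "(\<lambda>e. cmod (cinner x e) * cmod (cinner e y)) summable_on E"
    using Parseval_abs_finite[OF assms] by (intro nonneg_bdd_above_summable_on bdd_aboveI2) auto
  show "(\<Sum>\<^sub>\<infinity>e\<in>E. cmod (cinner x e) * cmod (cinner e y)) \<le> norm x * norm y"
    using Parseval_abs_finite[OF assms] by (intro infsum_le_finite_sums *) auto
qed

section \<open>Bounded operators and adjoints\<close>

lemma bounded_clinear_bounded_linear: "bounded_clinear A \<Longrightarrow> bounded_linear A"
  by (simp add: bounded_clinear_def)

lemma bounded_clinear_scaleC: "bounded_clinear A \<Longrightarrow> A (c *\<^sub>C x) = c *\<^sub>C A x"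
  by (simp add: bounded_clinear_def)

lemma bounded_clinear_add: "bounded_clinear A \<Longrightarrow> A (x + y) = A x + A y"
  by (simp add: bounded_clinear_def linear_add bounded_linear.linear)

lemma bounded_clinear_diff: "bounded_clinear A \<Longrightarrow> A (x - y) = A x - A y"
  by (simp add: bounded_clinear_def linear_diff bounded_linear.linear)

lemma bounded_clinear_zero: "bounded_clinear A \<Longrightarrow> A 0 = 0"
  by (simp add: bounded_clinear_def linear_0 bounded_linear.linear)

lemma bounded_clinear_sum: "bounded_clinear A \<Longrightarrow> A (\<Sum>i\<in>I. f i) = (\<Sum>i\<in>I. A (f i))"
  by (simp add: bounded_clinear_def linear_sum bounded_linear.linear)

lemma bounded_clinear_norm: "bounded_clinear A \<Longrightarrow> norm (A x) \<le> onorm A * norm x"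
  by (simp add: bounded_clinear_def onorm)

lemma bounded_clinear_onorm_nonneg: "bounded_clinear A \<Longrightarrow> 0 \<le> onorm A"
  by (simp add: bounded_clinear_def onorm_pos_le)

lemma bounded_clinearI:
  fixes A :: "'a::chilbert_space \<Rightarrow> 'a"
  assumes "\<And>x y. A (x + y) = A x + A y" "\<And>c x. A (c *\<^sub>C x) = c *\<^sub>C A x"
    and "\<And>x. norm (A x) \<le> K * norm x"
  shows "bounded_clinear A"
  unfolding bounded_clinear_def
proof (intro conjI allI)
  show "bounded_linear A"
    by (rule bounded_linear_intro[of _ K])
      (use assms in \<open>simp_all add: mult.commute flip: scaleC_of_real\<close>)
qed (rule assms)

lemma bounded_clinear_id: "bounded_clinear (\<lambda>x. x)"
  by (simp add: bounded_clinear_def bounded_linear_ident)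

lemma bounded_clinear_compose: "bounded_clinear A \<Longrightarrow> bounded_clinear B \<Longrightarrow> bounded_clinear (A \<circ> B)"
  by (simp add: bounded_clinear_def bounded_linear_compose o_def)

lemma bounded_clinear_plus: "bounded_clinear A \<Longrightarrow> bounded_clinear B \<Longrightarrow> bounded_clinear (\<lambda>x. A x + B x)"
  by (simp add: bounded_clinear_def bounded_linear_add scaleC_add_right)

lemma bounded_clinear_minus: "bounded_clinear A \<Longrightarrow> bounded_clinear B \<Longrightarrow> bounded_clinear (\<lambda>x. A x - B x)"
  by (simp add: bounded_clinear_def bounded_linear_sub scaleC_diff_right)

lemma bounded_clinear_smult: "bounded_clinear A \<Longrightarrow> bounded_clinear (\<lambda>x. c *\<^sub>C A x)"
  by (auto simp: bounded_clinear_def scaleC_scaleC mult.commute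
      intro: bounded_linear_compose[OF bounded_linear_scaleC_right])

text \<open>The candidate has coefficients \<open>cnj (f e)\<close> in an orthonormal basis. The
  value of \<open>f\<close> at a finite partial sum \<open>?z\<close> is \<open>(norm ?z)^2\<close>,
  so boundedness of \<open>f\<close> gives \<open>norm ?z \<le> K\<close> for nonzero
  \<open>?z\<close>, and the coefficients are square summable.\<close>

lemma Riesz_representation:
  fixes f :: "'a::chilbert_space \<Rightarrow> complex"
  assumes f: "bounded_linear f" "\<And>c x. f (c *\<^sub>C x) = c * f x"
  obtains y where "\<And>x. f x = cinner y x"
proof -
  obtain E :: "'a set" where E: "onb E" using onb_exists by blast
  note oE = onb_orthonormal[OF E]
  obtain K where K: "\<And>x. cmod (f x) \<le> K * norm x"
    using bounded_linear.bounded[OF f(1)] by (auto simp: mult.commute)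
  have lin: "linear f" using f(1) by (rule bounded_linear.linear)
  have "(\<Sum>e\<in>F. (cmod (cnj (f e)))\<^sup>2) \<le> K\<^sup>2" if F: "finite F" "F \<subseteq> E" for F
  proof -
    define S where "S = (\<Sum>e\<in>F. (cmod (f e))\<^sup>2)"
    let ?z = "\<Sum>e\<in>F. cnj (f e) *\<^sub>C e"
    have "f ?z = (\<Sum>e\<in>F. of_real ((cmod (f e))\<^sup>2))"
      unfolding linear_sum[OF lin] f(2)
      by (rule sum.cong) (auto simp only: complex_norm_square mult.commute)
    hence "f ?z = of_real S" by (simp add: S_def)
    moreover have nz: "(norm ?z)\<^sup>2 = S"
      using orthonormal_norm_sum[OF oE F, of "\<lambda>e. cnj (f e)"] by (simp add: S_def)
    moreover have "S \<ge> 0" by (simp add: S_def sum_nonneg)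
    ultimately have "S \<le> K * norm ?z" using K[of ?z] by simp
    hence "norm ?z * norm ?z \<le> K * norm ?z" using nz by (simp add: power2_eq_square)
    hence "norm ?z \<le> K \<or> norm ?z = 0" by (cases "norm ?z = 0") auto
    hence "S \<le> K\<^sup>2"
    proof
      assume "norm ?z \<le> K" thus ?thesis using nz power_mono[of "norm ?z" K 2] by simp
    next
      assume "norm ?z = 0" thus ?thesis using nz by simp
    qed
    thus ?thesis by (simp add: S_def)
  qed
  hence "bdd_above (sum (\<lambda>e. (cmod (cnj (f e)))\<^sup>2) ` {F. F \<subseteq> E \<and> finite F})"
    by (intro bdd_aboveI2[where M = "K\<^sup>2"]) blast
  hence s: "(\<lambda>e. (cmod (cnj (f e)))\<^sup>2) summable_on E"
    by (intro nonneg_bdd_above_summable_on) auto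
  define y where "y = (\<Sum>\<^sub>\<infinity>e\<in>E. cnj (f e) *\<^sub>C e)"
  have "cinner y e = f e" if "e \<in> E" for e
    using orthonormal_cinner_infsum[OF oE s that] unfolding y_def
    by (subst cinner_commute) simp
  note ye = this
  have "f x = cinner y x" for x
  proof (rule has_sum_eqI)
    show "((\<lambda>e. f (cinner e x *\<^sub>C e)) has_sum f x) E"
      by (rule has_sum_bounded_linear[OF f(1) onb_expansion[OF E]])
    show "((\<lambda>e. cinner y (cinner e x *\<^sub>C e)) has_sum cinner y x) E"
      by (rule has_sum_cinner_right[OF onb_expansion[OF E]])
    show "f (cinner e x *\<^sub>C e) = cinner y (cinner e x *\<^sub>C e)" if "e \<in> E" for e
      using ye[OF that] by (simp add: f(2) cinner_scaleC_right)
  qed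
  thus ?thesis by (rule that)
qed

lemma adj_exists:
  fixes A :: "'a::chilbert_space \<Rightarrow> 'a"
  assumes A: "bounded_clinear A"
  shows "\<exists>!A'. \<forall>x y. cinner (A' x) y = cinner x (A y)"
proof -
  have "\<exists>z. \<forall>y. cinner z y = cinner x (A y)" for x
  proof -
    have "bounded_linear (\<lambda>y. cinner x (A y))"
      by (rule bounded_linear_compose[OF bounded_linear_cinner_right bounded_clinear_bounded_linear[OF A]])
    then obtain z where "\<And>y. cinner x (A y) = cinner z y"
      by (rule Riesz_representation) (simp_all add: bounded_clinear_scaleC[OF A] cinner_simps)
    thus ?thesis by metis
  qed
  then obtain A' where "\<forall>x y. cinner (A' x) y = cinner x (A y)" by metis
  moreover have "A1 = A2" if "\<forall>x y. cinner (A1 x) y = cinner x (A y)"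
    "\<forall>x y. cinner (A2 x) y = cinner x (A y)" for A1 A2 :: "'a \<Rightarrow> 'a"
    using that by (intro ext cinner_eqI) (metis cinner_commute)
  ultimately show ?thesis by blast
qed

lemma cinner_adj_left: "bounded_clinear A \<Longrightarrow> cinner (adj A x) y = cinner x (A y)"
  using theI'[OF adj_exists, of A] by (auto simp: adj_def)

lemma cinner_adj_right: "bounded_clinear A \<Longrightarrow> cinner x (adj A y) = cinner (A x) y"
  by (metis cinner_adj_left cinner_commute)

lemma adj_eqI:
  assumes "\<And>x y. cinner (A' x) y = cinner x (A y)" and "bounded_clinear A"
  shows "adj A = A'"
  using adj_exists[OF assms(2)] assms by (metis cinner_adj_left)

lemma adj_norm:
  assumes A: "bounded_clinear A"
  shows "norm (adj A x) \<le> onorm A * norm x"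
proof -
  have "(norm (adj A x))\<^sup>2 = cmod (cinner (adj A x) (adj A x))"
    by (simp add: cinner_self norm_power)
  also have "\<dots> = cmod (cinner x (A (adj A x)))" by (simp add: cinner_adj_left[OF A])
  also have "\<dots> \<le> norm x * norm (A (adj A x))" by (rule cinner_Cauchy_Schwarz)
  also have "\<dots> \<le> norm x * (onorm A * norm (adj A x))"
    by (intro mult_left_mono bounded_clinear_norm A) simp
  finally have "norm (adj A x) * norm (adj A x) \<le> (onorm A * norm x) * norm (adj A x)"
    by (simp add: power2_eq_square ac_simps)
  thus ?thesis
    using bounded_clinear_onorm_nonneg[OF A] by (cases "norm (adj A x) = 0") auto
qed

lemma bounded_clinear_adj:
  assumes A: "bounded_clinear A"
  shows "bounded_clinear (adj A)"
proof (rule bounded_clinearI[of _ "onorm A"])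
  show "adj A (x + y) = adj A x + adj A y" for x y
    by (rule cinner_eqI) (simp add: cinner_adj_right[OF A] cinner_simps)
  show "adj A (c *\<^sub>C x) = c *\<^sub>C adj A x" for c x
    by (rule cinner_eqI) (simp add: cinner_adj_right[OF A] cinner_simps)
qed (rule adj_norm[OF A])

lemma adj_adj: "bounded_clinear A \<Longrightarrow> adj (adj A) = A"
  by (intro adj_eqI bounded_clinear_adj) (auto simp: cinner_adj_right)

lemma adj_compose:
  "bounded_clinear A \<Longrightarrow> bounded_clinear B \<Longrightarrow> adj (A \<circ> B) = adj B \<circ> adj A"
  by (intro adj_eqI bounded_clinear_compose) (auto simp: cinner_adj_left)

lemma adj_plus:
  "bounded_clinear A \<Longrightarrow> bounded_clinear B \<Longrightarrow> adj (\<lambda>x. A x + B x) = (\<lambda>x. adj A x + adj B x)"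
  by (intro adj_eqI bounded_clinear_plus) (auto simp: cinner_adj_left cinner_simps)

lemma adj_smult:
  "bounded_clinear A \<Longrightarrow> adj (\<lambda>x. c *\<^sub>C A x) = (\<lambda>x. cnj c *\<^sub>C adj A x)"
  by (intro adj_eqI bounded_clinear_smult) (auto simp: cinner_adj_left cinner_simps)

lemma adj_id: "adj (\<lambda>x. x) = (\<lambda>x. x)"
  by (intro adj_eqI bounded_clinear_id) auto

lemma onorm_adj_le: "bounded_clinear A \<Longrightarrow> onorm (adj A) \<le> onorm A"
  by (intro onorm_bound adj_norm bounded_clinear_onorm_nonneg)

section \<open>Positive operators, square roots and polar decomposition\<close>

text \<open>Polarisation: reality at \<open>x + y\<close> relates the imaginary parts of the two
  mixed terms, and replacing \<open>y\<close> by \<open>\<i> *\<^sub>C y\<close> does the same for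
  their real parts.\<close>

lemma selfadjoint_of_real_form:
  fixes A :: "'a::chilbert_space \<Rightarrow> 'a"
  assumes A: "bounded_clinear A" and r: "\<And>x. Im (cinner x (A x)) = 0"
  shows "cinner (A x) y = cinner x (A y)"
proof -
  have *: "Im (cinner x (A y)) = - Im (cinner y (A x))" for x y
    using r[of "x + y"] r[of x] r[of y]
    by (simp add: bounded_clinear_add[OF A] cinner_simps)
  have "Re (cinner x (A y)) = Re (cinner y (A x))" for x y
    using *[of x "\<i> *\<^sub>C y"] by (simp add: bounded_clinear_scaleC[OF A] cinner_simps)
  hence "cinner x (A y) = cnj (cinner y (A x))"
    using *[of x y] by (simp add: complex_eq_iff)
  thus ?thesis by (subst cinner_commute) simp
qed

lemma positive_op_bounded_clinear: "positive_op A \<Longrightarrow> bounded_clinear A"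
  by (simp add: positive_op_def)

lemma positive_op_iff:
  "positive_op A \<longleftrightarrow> bounded_clinear A \<and> (\<forall>x. Im (cinner x (A x)) = 0 \<and> Re (cinner x (A x)) \<ge> 0)"
  by (auto simp: positive_op_def complex_nonneg_Reals_iff)

lemma positive_op_selfadjoint:
  "positive_op A \<Longrightarrow> cinner (A x) y = cinner x (A y)"
  by (rule selfadjoint_of_real_form) (auto simp: positive_op_iff)

lemma positive_op_Cauchy_Schwarz:
  assumes P: "positive_op A"
  shows "(cmod (cinner x (A y)))\<^sup>2 \<le> Re (cinner x (A x)) * Re (cinner y (A y))"
proof -
  have A: "bounded_clinear A" using P by (rule positive_op_bounded_clinear)
  define a b c where "a = Re (cinner x (A x))" and "b = Re (cinner y (A y))" and "c = cinner x (A y)"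
  have ab: "a \<ge> 0" "b \<ge> 0" using P by (auto simp: a_def b_def positive_op_iff)
  have aa: "cinner x (A x) = of_real a" "cinner y (A y) = of_real b"
    using P by (auto simp: a_def b_def positive_op_iff complex_eq_iff)
  have c': "cinner y (A x) = cnj c"
    unfolding c_def by (subst cinner_commute) (simp add: positive_op_selfadjoint[OF P])
  \<comment> \<open>Scaling \<open>x\<close> by \<open>c\<close> times a real \<open>t\<close> turns
    the mixed terms into multiples of \<open>(cmod c)^2\<close>, so that a real quadratic in
    \<open>t\<close> remains.\<close>
  have q: "0 \<le> t\<^sup>2 * (cmod c)\<^sup>2 * a - 2 * t * (cmod c)\<^sup>2 + b" for t :: real
  proof -
    have "0 \<le> Re (cinner (y - (of_real t * c) *\<^sub>C x) (A (y - (of_real t * c) *\<^sub>C x)))"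
      using P by (auto simp: positive_op_iff)
    also have "cinner (y - (of_real t * c) *\<^sub>C x) (A (y - (of_real t * c) *\<^sub>C x)) =
       of_real b - 2 * of_real t * (c * cnj c) + of_real t * of_real t * (c * cnj c) * of_real a"
      unfolding bounded_clinear_diff[OF A] bounded_clinear_scaleC[OF A] cinner_simps aa c' c_def[symmetric]
      by (simp add: algebra_simps)
    also have "\<dots> = of_real (t\<^sup>2 * (cmod c)\<^sup>2 * a - 2 * t * (cmod c)\<^sup>2 + b)"
      by (simp add: complex_norm_square[symmetric] power2_eq_square algebra_simps)
    finally show ?thesis by simp
  qed
  have "(cmod c)\<^sup>2 \<le> a * b"
  proof (cases "a = 0")
    case True
    show ?thesis
    proof (rule ccontr)
      assume "\<not> ?thesis"
      hence pos: "(cmod c)\<^sup>2 > 0" using True by simp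
      \<comment> \<open>For \<open>a = 0\<close> the bound is affine in \<open>t\<close>; at this
        value it reads \<open>0 \<le> - b - 2\<close>.\<close>
      show False using q[of "(b + 1) / (cmod c)\<^sup>2"] pos True ab by simp
    qed
  next
    case False
    hence "a > 0" using ab by simp
    have "0 \<le> (1/a)\<^sup>2 * (cmod c)\<^sup>2 * a - 2 * (1/a) * (cmod c)\<^sup>2 + b" by (rule q)
    also have "\<dots> = b - (cmod c)\<^sup>2 / a" using \<open>a > 0\<close> by (simp add: field_simps power2_eq_square)
    finally show ?thesis using \<open>a > 0\<close> by (simp add: field_simps)
  qed
  thus ?thesis by (simp add: a_def b_def c_def)
qed

lemma positive_op_eq_zero:
  assumes P: "positive_op A" and z: "cinner x (A x) = 0"
  shows "A x = 0"
proof -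
  have "cinner y (A x) = 0" for y
    using positive_op_Cauchy_Schwarz[OF P, of y x] z by simp
  from this[of "A x"] show ?thesis by (simp add: cinner_self)
qed

text \<open>Cauchy-Schwarz for the form of \<open>A\<close>, applied to the pair \<open>A x\<close>,
  \<open>x\<close>, bounds the fourth power of \<open>norm (A x)\<close> by
  \<open>M * (norm (A x))^2\<close> times \<open>M * (norm x)^2\<close>; cancelling leaves the
  claim. This turns a bound on the quadratic form into a bound on the operator.\<close>

lemma positive_op_norm_le:
  assumes P: "positive_op A" and le: "\<And>x. Re (cinner x (A x)) \<le> M * (norm x)\<^sup>2" and M: "0 \<le> M"
  shows "norm (A x) \<le> M * norm x"
proof -
  have "(norm (A x))\<^sup>2 * (norm (A x))\<^sup>2 = (cmod (cinner (A x) (A x)))\<^sup>2"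
    by (simp add: cinner_self norm_power)
  also have "\<dots> \<le> Re (cinner (A x) (A (A x))) * Re (cinner x (A x))"
    by (rule positive_op_Cauchy_Schwarz[OF P])
  also have "\<dots> \<le> (M * (norm (A x))\<^sup>2) * (M * (norm x)\<^sup>2)"
    using P M by (intro mult_mono le) (auto simp: positive_op_iff)
  finally have *: "(norm (A x))\<^sup>2 * (norm (A x))\<^sup>2 \<le> (M * norm x)\<^sup>2 * (norm (A x))\<^sup>2"
    by (simp add: power_mult_distrib power2_eq_square mult_ac)
  show ?thesis
  proof (cases "A x = 0")
    case False
    hence "(norm (A x))\<^sup>2 > 0" by simp
    hence "(norm (A x))\<^sup>2 \<le> (M * norm x)\<^sup>2"
      using * mult_le_cancel_right_pos[of "(norm (A x))\<^sup>2" "(norm (A x))\<^sup>2" "(M * norm x)\<^sup>2"]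
      by (simp only:)
    thus ?thesis by (rule power2_le_imp_le) (simp add: M)
  qed (use M in auto)
qed

text \<open>Scalar majorant of the iteration \<open>Y' = (C + Y\<^sup>2) / 2\<close> towards \<open>Y = 1 - sqrt (1 - C)\<close>
  for \<open>\<parallel>C\<parallel> \<le> 1\<close>: the increments of the operator iteration are dominated by those at \<open>C = 1\<close>.\<close>

primrec sqrt_major :: "nat \<Rightarrow> real" where
  "sqrt_major 0 = 0"
| "sqrt_major (Suc n) = (1 + (sqrt_major n)\<^sup>2) / 2"

lemma sqrt_major_bounds: "0 \<le> sqrt_major n \<and> sqrt_major n \<le> 1"
proof (induction n)
  case (Suc n)
  hence "(sqrt_major n)\<^sup>2 \<le> 1" by (simp add: power_le_one)
  thus ?case by simp
qed simp

lemma sqrt_major_le_Suc: "sqrt_major n \<le> sqrt_major (Suc n)"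
proof -
  have "0 \<le> (sqrt_major n - 1)\<^sup>2" by simp
  thus ?thesis by (simp add: power2_eq_square algebra_simps)
qed

lemma sqrt_major_Cauchy: "Cauchy sqrt_major"
proof -
  have "incseq sqrt_major" using sqrt_major_le_Suc by (rule incseq_SucI)
  moreover have "Bseq sqrt_major"
    using sqrt_major_bounds by (intro BseqI'[of _ 1]) simp
  ultimately show ?thesis
    by (intro convergent_Cauchy Bseq_monoseq_convergent) (auto intro: incseq_imp_monoseq)
qed

primrec sqrt_iter :: "('a::real_normed_vector \<Rightarrow>\<^sub>L 'a) \<Rightarrow> nat \<Rightarrow> ('a \<Rightarrow>\<^sub>L 'a)" where
  "sqrt_iter C 0 = 0"
| "sqrt_iter C (Suc n) = (1/2) *\<^sub>R (C + (sqrt_iter C n o\<^sub>L sqrt_iter C n))"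

lemma blinfun_compose_assoc: "(f o\<^sub>L g) o\<^sub>L h = f o\<^sub>L (g o\<^sub>L h)"
  by (rule blinfun_eqI) simp

lemma sqrt_iter_commute:
  assumes T: "T o\<^sub>L C = C o\<^sub>L T"
  shows "T o\<^sub>L sqrt_iter C n = sqrt_iter C n o\<^sub>L T"
proof (induction n)
  case (Suc n)
  let ?Y = "sqrt_iter C n"
  have "T o\<^sub>L (?Y o\<^sub>L ?Y) = (T o\<^sub>L ?Y) o\<^sub>L ?Y" by (rule blinfun_compose_assoc[symmetric])
  also have "\<dots> = ?Y o\<^sub>L (T o\<^sub>L ?Y)" by (simp only: Suc blinfun_compose_assoc)
  also have "\<dots> = (?Y o\<^sub>L ?Y) o\<^sub>L T" by (simp only: Suc blinfun_compose_assoc)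
  finally show ?case
    by (simp add: T bounded_bilinear.add_left[OF bounded_bilinear_blinfun_compose]
        bounded_bilinear.add_right[OF bounded_bilinear_blinfun_compose]
        bounded_bilinear.scaleR_left[OF bounded_bilinear_blinfun_compose]
        bounded_bilinear.scaleR_right[OF bounded_bilinear_blinfun_compose])
qed simp

lemma sqrt_iter_commute_self: "sqrt_iter C m o\<^sub>L sqrt_iter C n = sqrt_iter C n o\<^sub>L sqrt_iter C m"
  by (intro sqrt_iter_commute sqrt_iter_commute[symmetric] refl)

lemma sqrt_iter_bounds:
  assumes C: "norm C \<le> 1"
  shows "norm (sqrt_iter C n) \<le> sqrt_major n
    \<and> norm (sqrt_iter C (Suc n) - sqrt_iter C n) \<le> sqrt_major (Suc n) - sqrt_major n"
proof (induction n)
  case 0 show ?case using C by simp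
next
  case (Suc n)
  let ?Y = "sqrt_iter C n" and ?Z = "sqrt_iter C (Suc n)"
  have Z: "norm ?Z \<le> sqrt_major (Suc n)"
    using norm_triangle_ineq[of "?Z - ?Y" ?Y] Suc by (simp del: sqrt_iter.simps sqrt_major.simps)
  interpret bb: bounded_bilinear "(o\<^sub>L) :: ('a \<Rightarrow>\<^sub>L 'a) \<Rightarrow> ('a \<Rightarrow>\<^sub>L 'a) \<Rightarrow> _"
    by (rule bounded_bilinear_blinfun_compose)
  \<comment> \<open>Because iterates commute, the difference of squares factorises. The norm
    estimate of the product is then half of \<open>(p - q) * (p + q)\<close> for consecutive
    majorants \<open>p\<close> and \<open>q\<close>, which is exactly the next increment of the
    majorant.\<close>
  have "(?Z - ?Y) o\<^sub>L (?Z + ?Y) = (?Z o\<^sub>L ?Z) - (?Y o\<^sub>L ?Y)"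
    using sqrt_iter_commute_self[of C "Suc n" n]
    by (simp only: bb.diff_left bb.add_right) simp
  hence eq: "sqrt_iter C (Suc (Suc n)) - ?Z = (1/2) *\<^sub>R ((?Z - ?Y) o\<^sub>L (?Z + ?Y))"
    unfolding sqrt_iter.simps(2)[of C "Suc n"] sqrt_iter.simps(2)[of C n]
    by (simp only: scaleR_diff_right[symmetric]) simp
  have "norm (sqrt_iter C (Suc (Suc n)) - ?Z) \<le> (1/2) * (norm (?Z - ?Y) * norm (?Z + ?Y))"
    unfolding eq norm_scaleR using norm_blinfun_compose[of "?Z - ?Y" "?Z + ?Y"] by simp
  also have "\<dots> \<le> (1/2) * ((sqrt_major (Suc n) - sqrt_major n) * (sqrt_major (Suc n) + sqrt_major n))"
    using Suc Z norm_triangle_ineq[of ?Z ?Y] sqrt_major_le_Suc[of n]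
    by (intro mult_left_mono mult_mono) (auto simp del: sqrt_iter.simps sqrt_major.simps)
  also have "\<dots> = sqrt_major (Suc (Suc n)) - sqrt_major (Suc n)"
    unfolding sqrt_major.simps(2)[of "Suc n"] sqrt_major.simps(2)[of n]
    by (simp add: power2_eq_square field_simps)
  finally show ?case using Z by simp
qed

lemma sqrt_iter_diff_bound:
  assumes "norm C \<le> 1" "m \<le> n"
  shows "norm (sqrt_iter C n - sqrt_iter C m) \<le> sqrt_major n - sqrt_major m"
  using assms(2)
proof (induction n rule: dec_induct)
  case (step n)
  thus ?case
    using norm_triangle_ineq[of "sqrt_iter C (Suc n) - sqrt_iter C n" "sqrt_iter C n - sqrt_iter C m"]
      sqrt_iter_bounds[OF assms(1), of n] by (simp del: sqrt_iter.simps sqrt_major.simps)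
qed simp

lemma sqrt_iter_convergent:
  fixes C :: "'a::banach \<Rightarrow>\<^sub>L 'a"
  assumes C: "norm C \<le> 1"
  shows "convergent (sqrt_iter C)"
proof (rule Cauchy_convergent, rule metric_CauchyI)
  fix e :: real assume "e > 0"
  then obtain M where M: "\<And>m n. m \<ge> M \<Longrightarrow> n \<ge> M \<Longrightarrow> dist (sqrt_major m) (sqrt_major n) < e"
    using metric_CauchyD[OF sqrt_major_Cauchy] by metis
  have "dist (sqrt_iter C m) (sqrt_iter C n) < e" if "m \<ge> M" "n \<ge> M" for m n
  proof (cases "m \<le> n")
    case True
    thus ?thesis using sqrt_iter_diff_bound[OF C True] M[OF that]
      by (simp add: dist_norm norm_minus_commute)
  next
    case False
    hence "n \<le> m" by simp
    from sqrt_iter_diff_bound[OF C this] show ?thesis using M[OF that] by (simp add: dist_norm)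
  qed
  thus "\<exists>M. \<forall>m\<ge>M. \<forall>n\<ge>M. dist (sqrt_iter C m) (sqrt_iter C n) < e" by blast
qed

lemma sqrt_iter_clinear_selfadjoint:
  fixes C :: "'a::chilbert_space \<Rightarrow>\<^sub>L 'a"
  assumes "\<And>c x. C (c *\<^sub>C x) = c *\<^sub>C C x" "\<And>x y. cinner (C x) y = cinner x (C y)"
  shows "(\<forall>c x. sqrt_iter C n (c *\<^sub>C x) = c *\<^sub>C sqrt_iter C n x)
    \<and> (\<forall>x y. cinner (sqrt_iter C n x) y = cinner x (sqrt_iter C n y))"
  by (induction n)
    (auto simp: assms blinfun.add_left blinfun.scaleR_left cinner_simps scaleC_add_right
      scaleC_scaleC mult.commute simp flip: scaleC_of_real)

text \<open>The commutation property of the constructed root is what makes positive roots unique.\<close>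

lemma positive_contraction_sqrt:
  fixes A :: "'a::chilbert_space \<Rightarrow> 'a"
  assumes P: "positive_op A" and le: "\<And>x. Re (cinner x (A x)) \<le> (norm x)\<^sup>2"
  shows "\<exists>S. positive_op S \<and> S \<circ> S = A \<and> (\<forall>T. bounded_linear T \<and> T \<circ> A = A \<circ> T \<longrightarrow> T \<circ> S = S \<circ> T)"
proof -
  have A: "bounded_clinear A" using P by (rule positive_op_bounded_clinear)
  have bC: "bounded_clinear (\<lambda>x. x - A x)"
    by (intro bounded_clinear_minus bounded_clinear_id A)
  have PC: "positive_op (\<lambda>x. x - A x)"
    using P le bC by (auto simp: positive_op_iff cinner_diff_right cinner_self)
  \<comment> \<open>The root of \<open>A = 1 - C\<close> is sought as \<open>1 - Y\<close>, where
    \<open>Y\<close> is the fixed point \<open>2 Y = C + Y^2\<close> of the iteration. The bounds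
    \<open>0 \<le> A \<le> 1\<close> give \<open>norm C \<le> 1\<close>, which the majorant
    requires.\<close>
  define C where "C = Blinfun (\<lambda>x. x - A x)"
  have C_ap: "C x = x - A x" for x
    using bounded_linear_Blinfun_apply[OF bounded_clinear_bounded_linear[OF bC]] by (simp add: C_def)
  have "norm (C x) \<le> 1 * norm x" for x
    unfolding C_ap using P by (intro positive_op_norm_le[OF PC])
      (auto simp: cinner_diff_right cinner_self positive_op_iff)
  hence nC: "norm C \<le> 1" by (intro norm_blinfun_bound) auto
  obtain Y where Y: "sqrt_iter C \<longlonglongrightarrow> Y"
    using sqrt_iter_convergent[OF nC] by (auto simp: convergent_def)
  have Yx: "(\<lambda>n. sqrt_iter C n x) \<longlonglongrightarrow> Y x" for x
    by (intro blinfun.tendsto Y tendsto_const)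
  have "norm Y \<le> 1"
    by (rule LIMSEQ_le_const2[OF tendsto_norm[OF Y]])
      (use sqrt_iter_bounds[OF nC] sqrt_major_bounds in \<open>meson order_trans\<close>)
  hence nY: "norm (Y x) \<le> norm x" for x
    using norm_blinfun[of Y x] mult_right_mono[of "norm Y" 1 "norm x"] by simp
  have "Y = (1/2) *\<^sub>R (C + (Y o\<^sub>L Y))"
  proof (rule LIMSEQ_unique)
    show "(\<lambda>n. sqrt_iter C (Suc n)) \<longlonglongrightarrow> Y" using Y by (rule LIMSEQ_Suc)
    show "(\<lambda>n. sqrt_iter C (Suc n)) \<longlonglongrightarrow> (1/2) *\<^sub>R (C + (Y o\<^sub>L Y))" unfolding sqrt_iter.simps
      by (intro tendsto_intros bounded_bilinear.tendsto[OF bounded_bilinear_blinfun_compose] Y)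
  qed
  hence "2 *\<^sub>R Y = C + (Y o\<^sub>L Y)" by (metis (no_types) scaleR_half_double scaleR_2 scaleR_right_distrib)
  hence "(2 *\<^sub>R Y) x = (C + (Y o\<^sub>L Y)) x" for x by simp
  hence Yeq: "2 *\<^sub>R Y x = x - A x + Y (Y x)" for x
    by (simp add: blinfun.scaleR_left blinfun.add_left C_ap)
  have selfC: "cinner (C x) y = cinner x (C y)" for x y
    unfolding C_ap using positive_op_selfadjoint[OF PC] by simp
  have linC: "C (c *\<^sub>C x) = c *\<^sub>C C x" for c x
    unfolding C_ap using bounded_clinear_scaleC[OF bC] by simp
  note it = sqrt_iter_clinear_selfadjoint[of C, OF linC selfC]
  have linY: "Y (c *\<^sub>C x) = c *\<^sub>C Y x" for c x
  proof (rule LIMSEQ_unique[OF Yx])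
    have "(\<lambda>n. c *\<^sub>C sqrt_iter C n x) \<longlonglongrightarrow> c *\<^sub>C Y x" by (intro tendsto_intros Yx)
    thus "(\<lambda>n. sqrt_iter C n (c *\<^sub>C x)) \<longlonglongrightarrow> c *\<^sub>C Y x" using it by simp
  qed
  have selfY: "cinner (Y x) y = cinner x (Y y)" for x y
  proof (rule LIMSEQ_unique)
    show "(\<lambda>n. cinner (sqrt_iter C n x) y) \<longlonglongrightarrow> cinner (Y x) y" by (intro tendsto_intros Yx)
    have "(\<lambda>n. cinner x (sqrt_iter C n y)) \<longlonglongrightarrow> cinner x (Y y)" by (intro tendsto_intros Yx)
    thus "(\<lambda>n. cinner (sqrt_iter C n x) y) \<longlonglongrightarrow> cinner x (Y y)" using it by simp
  qed
  define S where "S = (\<lambda>x. x - Y x)"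
  have bY: "bounded_clinear (blinfun_apply Y)"
    unfolding bounded_clinear_def using linY blinfun.bounded_linear_right by auto
  have bS: "bounded_clinear S" unfolding S_def by (intro bounded_clinear_minus bounded_clinear_id bY)
  have "Im (cinner x (Y x)) = 0" for x
    using selfY[of x x] cinner_commute[of "Y x" x] by (auto simp: complex_eq_iff)
  moreover have "Re (cinner x (Y x)) \<le> (norm x)\<^sup>2" for x
  proof -
    have "Re (cinner x (Y x)) \<le> norm x * norm (Y x)"
      using cinner_Cauchy_Schwarz[of x "Y x"] complex_Re_le_cmod order_trans by blast
    also have "\<dots> \<le> norm x * norm x" by (intro mult_left_mono nY) simp
    finally show ?thesis by (simp add: power2_eq_square)
  qed
  ultimately have "positive_op S"
    using bS by (auto simp: positive_op_iff S_def cinner_diff_right cinner_self)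
  moreover have "S \<circ> S = A"
  proof
    fix x
    have "S (S x) = x - 2 *\<^sub>R Y x + Y (Y x)" by (simp add: S_def blinfun.diff_right scaleR_2)
    thus "(S \<circ> S) x = A x" by (simp add: Yeq)
  qed
  moreover have "T \<circ> S = S \<circ> T" if T: "bounded_linear T" "T \<circ> A = A \<circ> T" for T
  proof -
    have TA: "T (A x) = A (T x)" for x using T(2) by (metis comp_apply)
    define T' where "T' = Blinfun T"
    have T': "T' x = T x" for x by (simp add: T'_def bounded_linear_Blinfun_apply T(1))
    have "T' o\<^sub>L C = C o\<^sub>L T'"
      by (rule blinfun_eqI) (simp add: C_ap blinfun.diff_right T' TA)
    hence "T' o\<^sub>L sqrt_iter C n = sqrt_iter C n o\<^sub>L T'" for n by (rule sqrt_iter_commute)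
    hence comm: "T' (sqrt_iter C n x) = sqrt_iter C n (T' x)" for n x
      by (metis blinfun_apply_blinfun_compose)
    have "T' (Y x) = Y (T' x)" for x
    proof (rule LIMSEQ_unique)
      show "(\<lambda>n. T' (sqrt_iter C n x)) \<longlonglongrightarrow> T' (Y x)" by (intro tendsto_intros Yx)
      show "(\<lambda>n. T' (sqrt_iter C n x)) \<longlonglongrightarrow> Y (T' x)" unfolding comm by (rule Yx)
    qed
    hence "T (Y x) = Y (T x)" for x by (simp add: T')
    thus ?thesis by (auto simp: S_def linear_diff[OF bounded_linear.linear[OF T(1)]])
  qed
  ultimately show ?thesis by blast
qed

lemma positive_op_scaleR:
  assumes "positive_op A" "r \<ge> 0"
  shows "positive_op (\<lambda>x. complex_of_real r *\<^sub>C A x)"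
  using assms by (auto simp: positive_op_iff cinner_scaleC_right bounded_clinear_smult)

lemma positive_op_sqrt:
  fixes A :: "'a::chilbert_space \<Rightarrow> 'a"
  assumes P: "positive_op A"
  obtains S where "positive_op S" "S \<circ> S = A"
    "\<And>T. bounded_linear T \<Longrightarrow> T \<circ> A = A \<circ> T \<Longrightarrow> T \<circ> S = S \<circ> T"
proof -
  have A: "bounded_clinear A" using P by (rule positive_op_bounded_clinear)
  \<comment> \<open>The summand 1 keeps \<open>k\<close> positive when \<open>A = 0\<close>.
    Dividing by \<open>k\<close> brings the quadratic form below that of the identity, and the
    factor \<open>sqrt k\<close> undoes this for the root.\<close>
  define k where "k = onorm A + 1"
  have k: "k > 0" using bounded_clinear_onorm_nonneg[OF A] by (simp add: k_def)
  let ?B = "\<lambda>x. complex_of_real (1/k) *\<^sub>C A x"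
  have PB: "positive_op ?B" using k by (intro positive_op_scaleR P) auto
  have "Re (cinner x (?B x)) \<le> (norm x)\<^sup>2" for x
  proof -
    have "Re (cinner x (A x)) \<le> norm x * norm (A x)"
      using cinner_Cauchy_Schwarz[of x "A x"] complex_Re_le_cmod order_trans by blast
    also have "\<dots> \<le> norm x * (onorm A * norm x)"
      by (intro mult_left_mono bounded_clinear_norm A) simp
    also have "\<dots> \<le> k * (norm x)\<^sup>2"
      by (simp add: k_def power2_eq_square algebra_simps)
    finally show ?thesis using k by (simp add: cinner_scaleC_right field_simps)
  qed
  then obtain S where S: "positive_op S" "S \<circ> S = ?B"
    and comm: "\<And>T. bounded_linear T \<Longrightarrow> T \<circ> ?B = ?B \<circ> T \<Longrightarrow> T \<circ> S = S \<circ> T"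
    using positive_contraction_sqrt[OF PB] by blast
  have bS: "bounded_clinear S" using S(1) by (rule positive_op_bounded_clinear)
  have SS: "S (S x) = complex_of_real (1/k) *\<^sub>C A x" for x using S(2) by (metis comp_apply)
  let ?S = "\<lambda>x. complex_of_real (sqrt k) *\<^sub>C S x"
  show ?thesis
  proof (rule that[of ?S])
    show "positive_op ?S" using k by (intro positive_op_scaleR S) auto
    have "?S (?S x) = A x" for x
    proof -
      have "?S (?S x) = (complex_of_real (sqrt k) * complex_of_real (sqrt k) * complex_of_real (1/k)) *\<^sub>C A x"
        by (simp only: bounded_clinear_scaleC[OF bS] SS scaleC_scaleC mult.assoc)
      also have "complex_of_real (sqrt k) * complex_of_real (sqrt k) * complex_of_real (1/k) = 1"
        using k by (simp flip: of_real_mult)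
      finally show ?thesis by simp
    qed
    thus "?S \<circ> ?S = A" by auto
    fix T :: "'a \<Rightarrow> 'a" assume T: "bounded_linear T" "T \<circ> A = A \<circ> T"
    have TR: "T (complex_of_real r *\<^sub>C x) = complex_of_real r *\<^sub>C T x" for r x
      unfolding scaleC_of_real using T(1) by (simp add: linear_scale bounded_linear.linear)
    have "T \<circ> ?B = ?B \<circ> T"
    proof
      fix x
      have "T (A x) = A (T x)" using T(2) by (metis comp_apply)
      thus "(T \<circ> ?B) x = (?B \<circ> T) x" using TR[of "1/k"] by simp
    qed
    from comm[OF T(1) this] have "T (S x) = S (T x)" for x by (metis comp_apply)
    thus "T \<circ> ?S = ?S \<circ> T" using TR by auto
  qed
qed

text \<open>The constructed root \<open>S\<close> commutes with everything that commutes with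
  \<open>A\<close>, in particular with any root \<open>R\<close>. Hence
  \<open>(S + R) (S - R) = 0\<close>, and positivity makes \<open>S\<close> and \<open>R\<close>
  vanish separately at \<open>y = (S - R) x\<close>, so that \<open>y\<close> is orthogonal to
  itself. Both given roots are compared with \<open>S\<close>.\<close>

lemma positive_op_sqrt_unique:
  fixes A :: "'a::chilbert_space \<Rightarrow> 'a"
  assumes P: "positive_op P" "P \<circ> P = A" and Q: "positive_op Q" "Q \<circ> Q = A"
  shows "P = Q"
proof -
  have "R = S" if R: "positive_op R" "R \<circ> R = A" and S: "positive_op S" "S \<circ> S = A"
    and comm: "\<And>T. bounded_linear T \<Longrightarrow> T \<circ> A = A \<circ> T \<Longrightarrow> T \<circ> S = S \<circ> T" for R S
  proof
    fix x
    have bR: "bounded_clinear R" and bS: "bounded_clinear S"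
      using R S by (auto intro: positive_op_bounded_clinear)
    have "R \<circ> S = S \<circ> R"
      by (intro comm bounded_clinear_bounded_linear bR) (simp add: R(2)[symmetric] o_assoc)
    hence RS: "R (S x) = S (R x)" for x by (metis comp_apply)
    have RR: "R (R x) = A x" and SS: "S (S x) = A x" for x using R(2) S(2) by (metis comp_apply)+
    define y where "y = S x - R x"
    have "S y + R y = 0"
      by (simp add: y_def bounded_clinear_diff[OF bR] bounded_clinear_diff[OF bS] RS RR SS)
    hence "cinner y (S y) + cinner y (R y) = 0" by (simp add: cinner_add_right[symmetric])
    moreover have "Re (cinner y (S y)) \<ge> 0" "Re (cinner y (R y)) \<ge> 0"
      "Im (cinner y (S y)) = 0" "Im (cinner y (R y)) = 0"
      using R S by (auto simp: positive_op_iff)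
    ultimately have "cinner y (S y) = 0" "cinner y (R y) = 0"
      by (auto simp: complex_eq_iff)
    hence "S y = 0" "R y = 0" using positive_op_eq_zero R(1) S(1) by blast+
    moreover have "cinner y y = cinner x (S y) - cinner x (R y)"
      by (subst (1) y_def) (simp add: cinner_simps positive_op_selfadjoint[OF R(1)] positive_op_selfadjoint[OF S(1)])
    ultimately have "y = 0" by (simp add: cinner_self)
    thus "R x = S x" by (simp add: y_def)
  qed note * = this
  have "A x = P (P x)" for x using P(2) by auto
  hence "positive_op A"
    using P positive_op_bounded_clinear[OF P(1)] bounded_clinear_compose[of P P]
    by (auto simp: positive_op_iff positive_op_selfadjoint[OF P(1), symmetric] Re_cinner_self cinner_self)
  then obtain S where "positive_op S" "S \<circ> S = A"
    "\<And>T. bounded_linear T \<Longrightarrow> T \<circ> A = A \<circ> T \<Longrightarrow> T \<circ> S = S \<circ> T"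
    using positive_op_sqrt by blast
  thus ?thesis using *[OF P] *[OF Q] by metis
qed

section \<open>Absolute value and polar decomposition\<close>

lemma abs_op_characterization:
  assumes A: "bounded_clinear A"
  shows positive_abs_op: "positive_op (abs_op A)" and abs_op_square: "abs_op A \<circ> abs_op A = adj A \<circ> A"
proof -
  have "positive_op (adj A \<circ> A)"
    unfolding positive_op_iff
    using bounded_clinear_compose[OF bounded_clinear_adj[OF A] A]
    by (auto simp: cinner_adj_right[OF A] Re_cinner_self cinner_self)
  then obtain S where "positive_op S" "S \<circ> S = adj A \<circ> A" by (rule positive_op_sqrt) (rule that)
  hence "\<exists>!P. positive_op P \<and> P \<circ> P = adj A \<circ> A" using positive_op_sqrt_unique by blast
  from theI'[OF this] show "positive_op (abs_op A)" "abs_op A \<circ> abs_op A = adj A \<circ> A"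
    by (auto simp: abs_op_def)
qed

lemma norm_abs_op:
  assumes A: "bounded_clinear A"
  shows "norm (abs_op A x) = norm (A x)"
proof -
  note P = positive_abs_op[OF A]
  have "cinner (abs_op A x) (abs_op A x) = cinner x (abs_op A (abs_op A x))"
    by (rule positive_op_selfadjoint[OF P])
  also have "\<dots> = cinner x (adj A (A x))" using abs_op_square[OF A] by (metis comp_apply)
  also have "\<dots> = cinner (A x) (A x)" by (rule cinner_adj_right[OF A])
  finally show ?thesis
    by (simp add: cinner_self power2_eq_iff_nonneg flip: of_real_power)
qed

lemma bounded_clinear_has_sum:
  "bounded_clinear A \<Longrightarrow> (f has_sum s) I \<Longrightarrow> ((\<lambda>i. A (f i)) has_sum A s) I"
  by (rule has_sum_bounded_linear[OF bounded_clinear_bounded_linear])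

text \<open>The projection is the Fourier series along a maximal orthonormal family inside
  \<open>V\<close>: closedness keeps the limit in \<open>V\<close>, and maximality makes the map the
  identity there.\<close>

lemma closed_subspace_projection:
  fixes V :: "'a::chilbert_space set"
  assumes V: "closed V" "0 \<in> V" "\<And>x y. x \<in> V \<Longrightarrow> y \<in> V \<Longrightarrow> x + y \<in> V" "\<And>c x. x \<in> V \<Longrightarrow> c *\<^sub>C x \<in> V"
  obtains p where "bounded_clinear p" "\<And>x. p x \<in> V" "\<And>x. x \<in> V \<Longrightarrow> p x = x" "\<And>x. norm (p x) \<le> norm x"
proof -
  obtain E where E: "E \<subseteq> V" "orthonormal E" "\<And>x. x \<in> V \<Longrightarrow> (\<And>e. e \<in> E \<Longrightarrow> cinner e x = 0) \<Longrightarrow> x = 0"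
    using maximal_orthonormal_exists[of V] V(4) by blast
  define p where "p x = (\<Sum>\<^sub>\<infinity>e\<in>E. cinner e x *\<^sub>C e)" for x
  have s: "((\<lambda>e. cinner e x *\<^sub>C e) has_sum p x) E" for x
    unfolding p_def by (intro has_sum_infsum orthonormal_summable E Bessel_summable)
  have pV: "p x \<in> V" for x
  proof (rule Lim_in_closed_set[OF V(1)])
    show "(sum (\<lambda>e. cinner e x *\<^sub>C e) \<longlongrightarrow> p x) (finite_subsets_at_top E)"
      using s by (simp add: has_sum_def)
    have "sum (\<lambda>e. cinner e x *\<^sub>C e) F \<in> V" if "finite F" "F \<subseteq> E" for F
      using that E(1) V by (induction F rule: finite_induct) auto
    thus "\<forall>\<^sub>F F in finite_subsets_at_top E. sum (\<lambda>e. cinner e x *\<^sub>C e) F \<in> V"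
      by (intro eventually_finite_subsets_at_top_weakI)
  qed auto
  have pc: "cinner e (p x) = cinner e x" if "e \<in> E" for e x
    unfolding p_def by (rule orthonormal_cinner_infsum[OF E(2) Bessel_summable(1)[OF E(2)] that])
  have pid: "p x = x" if "x \<in> V" for x
  proof -
    have "p x + (-1) *\<^sub>C x \<in> V" using that by (intro V pV)
    hence "p x - x \<in> V" by (simp add: scaleC_minus_left)
    hence "p x - x = 0" by (rule E(3)) (simp add: cinner_diff_right pc)
    thus ?thesis by simp
  qed
  have np: "norm (p x) \<le> norm x" for x
  proof -
    have "((\<lambda>e. cinner (p x) (cinner e x *\<^sub>C e)) has_sum cinner (p x) (p x)) E"
      "((\<lambda>e. cinner x (cinner e x *\<^sub>C e)) has_sum cinner x (p x)) E"
      by (intro has_sum_cinner_right s)+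
    moreover have "cinner (p x) (cinner e x *\<^sub>C e) = cinner x (cinner e x *\<^sub>C e)" if "e \<in> E" for e
    proof -
      have "cinner (p x) e = cinner x e" using pc[OF that, of x] by (metis cinner_commute)
      thus ?thesis by (simp add: cinner_scaleC_right)
    qed
    ultimately have "cinner (p x) (p x) = cinner x (p x)" by (rule has_sum_eqI)
    hence "(norm (p x))\<^sup>2 = Re (cinner x (p x))" by (simp add: Re_cinner_self[symmetric])
    also have "\<dots> \<le> norm x * norm (p x)"
      using cinner_Cauchy_Schwarz[of x "p x"] complex_Re_le_cmod order_trans by blast
    finally show ?thesis by (cases "p x = 0") (auto simp: power2_eq_square)
  qed
  have "bounded_clinear p"
  proof (rule bounded_clinearI[of _ 1])
    show "p (x + y) = p x + p y" for x y
      by (rule has_sum_unique[OF s])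
        (use has_sum_add[OF s[of x] s[of y]] in \<open>simp add: cinner_simps scaleC_add_left\<close>)
    show "p (c *\<^sub>C x) = c *\<^sub>C p x" for c x
      by (rule has_sum_unique[OF s])
        (use has_sum_scaleC_right[OF s[of x], of c] in \<open>simp add: cinner_simps scaleC_scaleC\<close>)
  qed (use np in simp)
  thus ?thesis using pV pid np by (rule that)
qed

text \<open>Since \<open>P x\<close> and \<open>A x\<close> have equal norms, sending
  \<open>P x\<close> to \<open>A x\<close> is an isometry on the range of \<open>P\<close>. It
  extends to the closure by uniform continuity, and to the whole space by composing with the
  projection onto that closure.\<close>

lemma polar_decomposition:
  fixes A :: "'a::chilbert_space \<Rightarrow> 'a"
  assumes A: "bounded_clinear A"
  obtains W where "bounded_clinear W" "\<And>x. norm (W x) \<le> norm x"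
    "\<And>x. A x = W (abs_op A x)" "\<And>x. adj W (A x) = abs_op A x"
proof -
  define P where "P = abs_op A"
  have posP: "positive_op P" unfolding P_def by (rule positive_abs_op[OF A])
  have P: "bounded_clinear P" using posP by (rule positive_op_bounded_clinear)
  have nP: "norm (P x) = norm (A x)" for x unfolding P_def by (rule norm_abs_op[OF A])
  define V where "V = closure (range P)"
  \<comment> \<open>Any preimage may be chosen: two of them differ by a vector on which
    \<open>P\<close>, and therefore \<open>A\<close>, vanishes.\<close>
  define f where "f y = A (SOME x. P x = y)" for y
  have fP: "f (P x) = A x" for x
  proof -
    have "P (SOME z. P z = P x) = P x" by (rule someI_ex) blast
    hence "norm (P ((SOME z. P z = P x) - x)) = 0" by (simp add: bounded_clinear_diff[OF P])
    hence "A ((SOME z. P z = P x) - x) = 0" by (simp only: nP) simp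
    thus ?thesis by (simp add: f_def bounded_clinear_diff[OF A])
  qed
  have "uniformly_continuous_on (range P) f"
    unfolding uniformly_continuous_on_def
  proof (intro allI impI)
    fix e :: real assume "e > 0"
    have "dist (f y') (f y) < e" if "y \<in> range P" "y' \<in> range P" "dist y' y < e" for y y'
    proof -
      obtain x x' where x: "y = P x" "y' = P x'" using \<open>y \<in> range P\<close> \<open>y' \<in> range P\<close> by blast
      have "dist (f y') (f y) = norm (A (x' - x))" by (simp add: x fP dist_norm bounded_clinear_diff[OF A])
      also have "\<dots> = dist y' y" by (simp add: x dist_norm nP[symmetric] bounded_clinear_diff[OF P])
      finally show ?thesis using that by simp
    qed
    thus "\<exists>d>0. \<forall>x\<in>range P. \<forall>x'\<in>range P. dist x' x < d \<longrightarrow> dist (f x') (f x) < e"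
      using \<open>e > 0\<close> by blast
  qed
  then obtain g where g: "uniformly_continuous_on V g" and gf: "\<And>x. x \<in> range P \<Longrightarrow> f x = g x"
    unfolding V_def by (rule uniformly_continuous_on_extension_on_closure) blast
  have gP: "g (P x) = A x" for x using gf[of "P x"] fP by simp
  \<comment> \<open>Points of the closure are handled through approximating sequences along which
    both \<open>P\<close> and \<open>A\<close> converge; linearity and norm preservation of
    \<open>g\<close> are then limits of the same facts for \<open>P\<close> and
    \<open>A\<close>.\<close>
  have seq: "\<exists>z. (\<lambda>n. P (z n)) \<longlonglongrightarrow> x \<and> (\<lambda>n. A (z n)) \<longlonglongrightarrow> g x" if x: "x \<in> V" for x
  proof -
    obtain h where h: "\<And>n. h n \<in> range P" "h \<longlonglongrightarrow> x"
      using x unfolding V_def closure_sequential by blast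
    have "\<forall>n. \<exists>w. h n = P w" using h(1) by blast
    then obtain z where z: "\<And>n. h n = P (z n)" by metis
    have "(\<lambda>n. g (h n)) \<longlonglongrightarrow> g x"
      by (rule continuous_on_tendsto_compose[OF uniformly_continuous_imp_continuous[OF g] h(2) x])
        (use h(1) subsetD[OF closure_subset, of _ "range P"] in \<open>auto simp: V_def\<close>)
    moreover have "h = (\<lambda>n. P (z n))" using z by auto
    ultimately show ?thesis using h(2) by (auto simp: gP)
  qed
  have limV: "a \<in> V" if "(\<lambda>n. P (z n)) \<longlonglongrightarrow> a" for z a
    unfolding V_def closure_sequential using that by (intro exI[of _ "\<lambda>n. P (z n)"]) simp
  have uniq: "b = g a" if "(\<lambda>n. P (z n)) \<longlonglongrightarrow> a" "(\<lambda>n. A (z n)) \<longlonglongrightarrow> b" for z a b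
  proof -
    note aV = limV[OF that(1)]
    have "(\<lambda>n. g (P (z n))) \<longlonglongrightarrow> g a"
      by (rule continuous_on_tendsto_compose[OF uniformly_continuous_imp_continuous[OF g] that(1) aV])
        (use subsetD[OF closure_subset, of _ "range P"] in \<open>auto simp: V_def\<close>)
    thus ?thesis using that(2) by (simp add: gP LIMSEQ_unique)
  qed
  have sub: "x + y \<in> V \<and> g (x + y) = g x + g y" if xy: "x \<in> V" "y \<in> V" for x y
  proof -
    obtain z w where z: "(\<lambda>n. P (z n)) \<longlonglongrightarrow> x" "(\<lambda>n. A (z n)) \<longlonglongrightarrow> g x"
      and w: "(\<lambda>n. P (w n)) \<longlonglongrightarrow> y" "(\<lambda>n. A (w n)) \<longlonglongrightarrow> g y" using seq xy by metis
    have "(\<lambda>n. P (z n + w n)) \<longlonglongrightarrow> x + y" "(\<lambda>n. A (z n + w n)) \<longlonglongrightarrow> g x + g y"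
      unfolding bounded_clinear_add[OF P] bounded_clinear_add[OF A] by (intro tendsto_intros z w)+
    note lim = this
    show ?thesis using limV[OF lim(1)] uniq[OF lim] by simp
  qed
  have sc: "c *\<^sub>C x \<in> V \<and> g (c *\<^sub>C x) = c *\<^sub>C g x" if x: "x \<in> V" for x c
  proof -
    obtain z where z: "(\<lambda>n. P (z n)) \<longlonglongrightarrow> x" "(\<lambda>n. A (z n)) \<longlonglongrightarrow> g x" using seq x by metis
    have "(\<lambda>n. P (c *\<^sub>C z n)) \<longlonglongrightarrow> c *\<^sub>C x" "(\<lambda>n. A (c *\<^sub>C z n)) \<longlonglongrightarrow> c *\<^sub>C g x"
      unfolding bounded_clinear_scaleC[OF P] bounded_clinear_scaleC[OF A] by (intro tendsto_intros z)+
    note lim = this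
    show ?thesis using limV[OF lim(1)] uniq[OF lim] by simp
  qed
  have ng: "norm (g x) = norm x" if x: "x \<in> V" for x
  proof -
    obtain z where z: "(\<lambda>n. P (z n)) \<longlonglongrightarrow> x" "(\<lambda>n. A (z n)) \<longlonglongrightarrow> g x" using seq x by metis
    show ?thesis using tendsto_norm[OF z(1)] tendsto_norm[OF z(2)] by (simp add: nP LIMSEQ_unique)
  qed
  have "P 0 = 0" by (rule bounded_clinear_zero[OF P])
  hence "0 \<in> V" unfolding V_def by (metis closure_subset rangeI subsetD)
  obtain p where p: "bounded_clinear p" "\<And>x. p x \<in> V" "\<And>x. x \<in> V \<Longrightarrow> p x = x" "\<And>x. norm (p x) \<le> norm x"
    by (rule closed_subspace_projection[of V])
      (use sub sc \<open>0 \<in> V\<close> in \<open>auto simp: V_def\<close>)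
  define W where "W x = g (p x)" for x
  have nW: "norm (W x) \<le> norm x" for x using ng[OF p(2)] p(4) by (simp add: W_def)
  have W: "bounded_clinear W"
    by (rule bounded_clinearI[of _ 1])
      (use sub sc p nW in \<open>auto simp: W_def bounded_clinear_add[OF p(1)] bounded_clinear_scaleC[OF p(1)]\<close>)
  have PV: "P x \<in> V" for x unfolding V_def by (metis closure_subset rangeI subsetD)
  have WP: "A x = W (P x)" for x by (simp add: W_def p(3)[OF PV] gP)
  have "onorm W \<le> 1" using nW by (intro onorm_bound) auto
  hence nWa: "norm (adj W x) \<le> norm x" for x
    using adj_norm[OF W, of x] mult_right_mono[of "onorm W" 1 "norm x"] by simp
  \<comment> \<open>Expand the squared distance of the two sides: the mixed term is
    \<open>(norm (A x))^2\<close>, and since \<open>adj W\<close> is a contraction the total is at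
    most zero.\<close>
  have "adj W (A x) = P x" for x
  proof -
    have "cinner (adj W (A x)) (P x) = cinner (A x) (A x)"
      by (simp add: cinner_adj_left[OF W] WP[symmetric])
    hence "Re (cinner (adj W (A x)) (P x)) = (norm (A x))\<^sup>2" by (simp add: Re_cinner_self)
    hence "(norm (adj W (A x) - P x))\<^sup>2 = (norm (adj W (A x)))\<^sup>2 - (norm (A x))\<^sup>2"
      by (simp add: norm_diff_sq nP)
    also have "\<dots> \<le> 0" using power_mono[OF nWa[of "A x"], of 2] by simp
    finally show ?thesis by simp
  qed
  with W nW WP show ?thesis unfolding P_def by (rule that)
qed

section \<open>Trace class and Hilbert-Schmidt operators\<close>

text \<open>The trace norm of \<open>A\<close> is the smallest \<open>\<Sum>i. \<parallel>u i\<parallel> \<parallel>v i\<parallel>\<close> over the representations below and is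
  attained, which replaces the spectral theory of \<open>|A|\<close> throughout.\<close>

definition nuclear_rep ::
  "'i set \<Rightarrow> ('i \<Rightarrow> 'a::chilbert_space) \<Rightarrow> ('i \<Rightarrow> 'a) \<Rightarrow> ('a \<Rightarrow> 'a) \<Rightarrow> bool" where
  "nuclear_rep I u v A \<longleftrightarrow> (\<lambda>i. norm (u i) * norm (v i)) summable_on I \<and>
     (\<forall>x. ((\<lambda>i. cinner (v i) x *\<^sub>C u i) has_sum A x) I)"

lemma nuclear_rep_summable: "nuclear_rep I u v A \<Longrightarrow> (\<lambda>i. norm (u i) * norm (v i)) summable_on I"
  by (simp add: nuclear_rep_def)

lemma nuclear_rep_has_sum: "nuclear_rep I u v A \<Longrightarrow> ((\<lambda>i. cinner (v i) x *\<^sub>C u i) has_sum A x) I"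
  by (simp add: nuclear_rep_def)

lemma nuclear_rep_term_bound: "norm (cinner v x *\<^sub>C u) \<le> (norm u * norm v) * norm (x::'a::chilbert_space)"
  using mult_right_mono[OF cinner_Cauchy_Schwarz[of v x] norm_ge_zero[of u]]
  by (simp add: norm_scaleC mult_ac)

lemma nuclear_rep_abs_summable:
  assumes "(\<lambda>i. norm (u i) * norm (v i :: 'a::chilbert_space)) summable_on I"
  shows "(\<lambda>i. norm (cinner (v i) x *\<^sub>C u i)) summable_on I"
  by (rule Infinite_Sum.abs_summable_on_comparison_test'[OF summable_on_cmult_left[OF assms, of "norm x"]])
    (rule nuclear_rep_term_bound)

lemma nuclear_rep_exists:
  assumes "(\<lambda>i. norm (u i) * norm (v i :: 'a::chilbert_space)) summable_on I"
  obtains A where "nuclear_rep I u v A"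
proof -
  have "nuclear_rep I u v (\<lambda>x. \<Sum>\<^sub>\<infinity>i\<in>I. cinner (v i) x *\<^sub>C u i)"
    unfolding nuclear_rep_def
    using assms abs_summable_summable[OF nuclear_rep_abs_summable[OF assms]] by auto
  thus ?thesis by (rule that)
qed

lemma nuclear_rep_norm_le:
  assumes "nuclear_rep I u v A"
  shows "norm (A x) \<le> (\<Sum>\<^sub>\<infinity>i\<in>I. norm (u i) * norm (v i)) * norm x"
  by (rule norm_infsum_le[OF nuclear_rep_has_sum[OF assms]
      has_sum_cmult_left[OF has_sum_infsum[OF nuclear_rep_summable[OF assms]]]])
    (rule nuclear_rep_term_bound)

lemma nuclear_rep_bounded_clinear:
  assumes r: "nuclear_rep I u v A"
  shows "bounded_clinear A"
proof (rule bounded_clinearI)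
  show "A (x + y) = A x + A y" for x y
    by (rule has_sum_eqI[OF nuclear_rep_has_sum[OF r]
          has_sum_add[OF nuclear_rep_has_sum[OF r] nuclear_rep_has_sum[OF r]]])
       (simp add: cinner_simps scaleC_add_left)
  show "A (c *\<^sub>C x) = c *\<^sub>C A x" for c x
    by (rule has_sum_eqI[OF nuclear_rep_has_sum[OF r] has_sum_scaleC_right[OF nuclear_rep_has_sum[OF r]]])
       (simp add: cinner_simps scaleC_scaleC)
qed (rule nuclear_rep_norm_le[OF r])

lemma nuclear_rep_cinner:
  assumes r: "nuclear_rep I u v A"
  shows "((\<lambda>i. cinner (v i) x * cinner y (u i)) has_sum cinner y (A x)) I"
  using has_sum_cinner_right[OF nuclear_rep_has_sum[OF r], of y x] by (simp add: cinner_simps)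

lemma nuclear_rep_adj:
  assumes r: "nuclear_rep I u v A"
  shows "nuclear_rep I v u (adj A)"
proof -
  have s: "(\<lambda>i. norm (v i) * norm (u i)) summable_on I"
    using nuclear_rep_summable[OF r] by (simp add: mult.commute)
  then obtain A' where A': "nuclear_rep I v u A'" by (rule nuclear_rep_exists)
  have "adj A = A'"
  proof (rule adj_eqI)
    show "bounded_clinear A" by (rule nuclear_rep_bounded_clinear[OF r])
    show "cinner (A' x) y = cinner x (A y)" for x y
    proof (rule has_sum_eqI)
      show "((\<lambda>i. cnj (cinner (u i) x * cinner y (v i))) has_sum cinner (A' x) y) I"
        using nuclear_rep_cinner[OF A', of x y] by (subst cinner_commute) (simp only: has_sum_cnj_iff)
      show "((\<lambda>i. cinner (v i) y * cinner x (u i)) has_sum cinner x (A y)) I"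
        by (rule nuclear_rep_cinner[OF r])
      show "cnj (cinner (u i) x * cinner y (v i)) = cinner (v i) y * cinner x (u i)" for i
        by (simp add: cinner_commute[symmetric] mult.commute)
    qed
  qed
  thus ?thesis using A' by simp
qed

lemma nuclear_rep_left:
  assumes r: "nuclear_rep I u v A" and K: "bounded_clinear K"
  shows "nuclear_rep I (\<lambda>i. K (u i)) v (K \<circ> A)"
  unfolding nuclear_rep_def
proof (intro conjI allI)
  have "norm (K (u i)) * norm (v i) \<le> onorm K * (norm (u i) * norm (v i))" for i
    using mult_right_mono[OF bounded_clinear_norm[OF K, of "u i"] norm_ge_zero[of "v i"]]
    by (simp add: mult_ac)
  thus "(\<lambda>i. norm (K (u i)) * norm (v i)) summable_on I"
    by (intro summable_on_comparison_test[OF summable_on_cmult_right[OF nuclear_rep_summable[OF r]]]) auto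
  show "((\<lambda>i. cinner (v i) x *\<^sub>C K (u i)) has_sum (K \<circ> A) x) I" for x
    using bounded_clinear_has_sum[OF K nuclear_rep_has_sum[OF r, of x]]
    by (simp add: bounded_clinear_scaleC[OF K])
qed

lemma nuclear_rep_right:
  assumes r: "nuclear_rep I u v A" and K: "bounded_clinear K"
  shows "nuclear_rep I u (\<lambda>i. adj K (v i)) (A \<circ> K)"
proof -
  have A: "bounded_clinear A" by (rule nuclear_rep_bounded_clinear[OF r])
  have "nuclear_rep I (\<lambda>i. adj K (v i)) u (adj K \<circ> adj A)"
    by (intro nuclear_rep_left nuclear_rep_adj r bounded_clinear_adj K)
  hence "nuclear_rep I u (\<lambda>i. adj K (v i)) (adj (adj K \<circ> adj A))" by (rule nuclear_rep_adj)
  thus ?thesis by (simp add: adj_compose bounded_clinear_adj adj_adj A K)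
qed

lemma nuclear_rep_scaleC:
  assumes r: "nuclear_rep I u v A"
  shows "nuclear_rep I (\<lambda>i. c *\<^sub>C u i) v (\<lambda>x. c *\<^sub>C A x)"
  using nuclear_rep_left[OF r bounded_clinear_smult[OF bounded_clinear_id, of c]] by (simp add: o_def)

text \<open>Fubini for the family \<open>cinner (v i) e * cinner e (u i)\<close>: summing over
  \<open>e\<close> first is Parseval, summing over \<open>i\<close> first gives the diagonal entry
  of \<open>A\<close>. The resulting value does not depend on the basis.\<close>

lemma nuclear_trace:
  assumes r: "nuclear_rep I u v A" and E: "onb E"
  shows "((\<lambda>e. cinner e (A e)) has_sum (\<Sum>\<^sub>\<infinity>i\<in>I. cinner (v i) (u i))) E"
    and "(\<lambda>i. norm (cinner (v i) (u i))) summable_on I"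
proof -
  note oE = onb_orthonormal[OF E]
  define f where "f = (\<lambda>(i, e). cinner (v i) e * cinner e (u i))"
  have inner: "(\<lambda>e. norm (f (i, e))) summable_on E"
    "(\<Sum>\<^sub>\<infinity>e\<in>E. norm (f (i, e))) \<le> norm (u i) * norm (v i)" for i
    using Parseval_abs[OF oE, of "v i" "u i"] by (simp_all add: f_def norm_mult mult.commute)
  have "(\<lambda>p. norm (f p)) summable_on I \<times> E"
    unfolding Infinite_Sum.abs_summable_on_Sigma_iff
  proof (intro conjI ballI inner)
    show "(\<lambda>i. norm (\<Sum>\<^sub>\<infinity>e\<in>E. norm (f (i, e)))) summable_on I"
      by (rule Infinite_Sum.abs_summable_on_comparison_test'[OF nuclear_rep_summable[OF r]])
        (use inner in \<open>simp add: infsum_nonneg\<close>)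
  qed
  hence sf: "f summable_on I \<times> E" by (rule abs_summable_summable)
  have "((\<lambda>i. cinner (v i) (u i)) has_sum infsum f (I \<times> E)) I"
  proof (rule has_sum_SigmaD[OF has_sum_infsum[OF sf]])
    show "((\<lambda>e. f (i, e)) has_sum cinner (v i) (u i)) E" for i
      using Parseval[OF E] by (simp add: f_def)
  qed
  hence S: "infsum f (I \<times> E) = (\<Sum>\<^sub>\<infinity>i\<in>I. cinner (v i) (u i))"
    by (rule infsumI[symmetric])
  show "((\<lambda>e. cinner e (A e)) has_sum (\<Sum>\<^sub>\<infinity>i\<in>I. cinner (v i) (u i))) E"
  proof (rule has_sum_SigmaD)
    show "((\<lambda>(e, i). f (i, e)) has_sum (\<Sum>\<^sub>\<infinity>i\<in>I. cinner (v i) (u i))) (E \<times> I)"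
      using has_sum_infsum[OF sf] unfolding S by (subst (asm) has_sum_swap)
    show "((\<lambda>i. case (e, i) of (e, i) \<Rightarrow> f (i, e)) has_sum cinner e (A e)) I" for e
      using nuclear_rep_cinner[OF r, of e e] by (simp add: f_def)
  qed
  show "(\<lambda>i. norm (cinner (v i) (u i))) summable_on I"
    by (rule Infinite_Sum.abs_summable_on_comparison_test'[OF nuclear_rep_summable[OF r]])
      (subst mult.commute, rule cinner_Cauchy_Schwarz)
qed

lemma onb_some: "onb (SOME E::'a::chilbert_space set. orthonormal_basis UNIV cinner E)"
  unfolding orthonormal_basis_UNIV by (rule someI_ex[OF onb_exists])

lemma op_trace_nuclear:
  assumes r: "nuclear_rep I u v A"
  shows "op_trace A = (\<Sum>\<^sub>\<infinity>i\<in>I. cinner (v i) (u i))"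
  unfolding trace_on_def by (rule infsumI[OF nuclear_trace(1)[OF r onb_some]])

text \<open>Polar decomposition gives \<open>abs_op A = adj W \<circ> A\<close>, so a representation
  of \<open>A\<close> becomes one of its absolute value, with first vectors that are no longer than
  before.\<close>

lemma nuclear_rep_trace_class:
  fixes A :: "'a::chilbert_space \<Rightarrow> 'a"
  assumes r: "nuclear_rep I u v A"
  shows "A \<in> trace_class" and "trace_norm A \<le> (\<Sum>\<^sub>\<infinity>i\<in>I. norm (u i) * norm (v i))"
proof -
  have A: "bounded_clinear A" by (rule nuclear_rep_bounded_clinear[OF r])
  obtain W where W: "bounded_clinear W" "\<And>x. norm (W x) \<le> norm x" "\<And>x. adj W (A x) = abs_op A x"
    by (rule polar_decomposition[OF A]) blast
  have "onorm W \<le> 1" using W(2) by (intro onorm_bound) auto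
  hence nW: "norm (adj W x) \<le> norm x" for x
    using adj_norm[OF W(1), of x] mult_right_mono[of "onorm W" 1 "norm x"] by simp
  have eq: "adj W \<circ> A = abs_op A" using W(3) by auto
  have r': "nuclear_rep I (\<lambda>i. adj W (u i)) v (abs_op A)"
    using nuclear_rep_left[OF r bounded_clinear_adj[OF W(1)]] by (simp add: eq)
  obtain E :: "'a set" where E: "onb E" using onb_exists by blast
  have "(\<lambda>e. cinner e (abs_op A e)) summable_on E"
    using nuclear_trace(1)[OF r' E] by (rule has_sum_imp_summable)
  thus "A \<in> trace_class"
    unfolding trace_class_def using A E by (auto simp: orthonormal_basis_UNIV)
  have "trace_norm A \<le> cmod (op_trace (abs_op A))"
    unfolding trace_norm_def by (rule complex_Re_le_cmod)
  also have "op_trace (abs_op A) = (\<Sum>\<^sub>\<infinity>i\<in>I. cinner (v i) (adj W (u i)))"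
    by (rule op_trace_nuclear[OF r'])
  also have "cmod \<dots> \<le> (\<Sum>\<^sub>\<infinity>i\<in>I. norm (u i) * norm (v i))"
  proof (rule norm_infsum_le)
    show "((\<lambda>i. cinner (v i) (adj W (u i))) has_sum (\<Sum>\<^sub>\<infinity>i\<in>I. cinner (v i) (adj W (u i)))) I"
      by (rule has_sum_infsum[OF abs_summable_summable[OF nuclear_trace(2)[OF r' E]]])
    show "((\<lambda>i. norm (u i) * norm (v i)) has_sum (\<Sum>\<^sub>\<infinity>i\<in>I. norm (u i) * norm (v i))) I"
      by (intro has_sum_infsum nuclear_rep_summable[OF r])
    show "cmod (cinner (v i) (adj W (u i))) \<le> norm (u i) * norm (v i)" for i
      using cinner_Cauchy_Schwarz[of "v i" "adj W (u i)"] mult_left_mono[OF nW[of "u i"] norm_ge_zero[of "v i"]]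
      by (simp add: mult.commute)
  qed
  finally show "trace_norm A \<le> (\<Sum>\<^sub>\<infinity>i\<in>I. norm (u i) * norm (v i))" .
qed

lemma trace_class_bounded_clinear: "A \<in> trace_class \<Longrightarrow> bounded_clinear A"
  by (simp add: trace_class_def)

text \<open>With \<open>S\<close> the root of the absolute value, expanding \<open>S x\<close> in a
  basis gives \<open>abs_op A\<close> as the sum of \<open>rank1\<close>-type terms with both
  vectors \<open>S e\<close>; applying \<open>W\<close> to the first vector represents
  \<open>A\<close>. The cost is at most the sum of \<open>(norm (S e))^2\<close>, which is the trace
  norm, and the preceding bound excludes a smaller cost. The balance between \<open>u\<close> and
  \<open>v\<close> is recorded for polarisation.\<close>

lemma trace_class_nuclear:
  fixes A :: "'a::chilbert_space \<Rightarrow> 'a"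
  assumes A: "A \<in> trace_class"
  obtains E :: "'a set" and u v where "nuclear_rep E u v A"
    "(\<Sum>\<^sub>\<infinity>e\<in>E. norm (u e) * norm (v e)) = trace_norm A"
    "\<And>e. norm (u e) \<le> norm (v e)" "(\<lambda>e. (norm (v e))\<^sup>2) summable_on E"
    "(\<Sum>\<^sub>\<infinity>e\<in>E. (norm (v e))\<^sup>2) = trace_norm A"
proof -
  have bA: "bounded_clinear A" using A by (rule trace_class_bounded_clinear)
  obtain E :: "'a set" where E: "onb E" and s: "(\<lambda>e. cinner e (abs_op A e)) summable_on E"
    using A by (auto simp: trace_class_def orthonormal_basis_UNIV)
  obtain W where W: "bounded_clinear W" "\<And>x. norm (W x) \<le> norm x" "\<And>x. A x = W (abs_op A x)"
    by (rule polar_decomposition[OF bA]) blast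
  obtain S where S: "positive_op S" "S \<circ> S = abs_op A"
    by (rule positive_op_sqrt[OF positive_abs_op[OF bA]]) (rule that)
  have bS: "bounded_clinear S" using S(1) by (rule positive_op_bounded_clinear)
  have SS: "S (S x) = abs_op A x" for x using S(2) by (metis comp_apply)
  have nS: "cinner e (abs_op A e) = of_real ((norm (S e))\<^sup>2)" for e
    by (simp only: SS[symmetric] positive_op_selfadjoint[OF S(1), symmetric] cinner_self)
  have sS: "(\<lambda>e. (norm (S e))\<^sup>2) summable_on E"
    using summable_on_Re[OF s] by (simp only: nS Re_complex_of_real)
  have P: "nuclear_rep E (\<lambda>e. S e) (\<lambda>e. S e) (abs_op A)"
    unfolding nuclear_rep_def
  proof (intro conjI allI)
    show "(\<lambda>e. norm (S e) * norm (S e)) summable_on E" using sS by (simp add: power2_eq_square)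
    show "((\<lambda>e. cinner (S e) x *\<^sub>C S e) has_sum abs_op A x) E" for x
      using bounded_clinear_has_sum[OF bS onb_expansion[OF E, of "S x"]]
      by (simp add: bounded_clinear_scaleC[OF bS] SS positive_op_selfadjoint[OF S(1)])
  qed
  have eq: "W \<circ> abs_op A = A" using W(3) by auto
  have r: "nuclear_rep E (\<lambda>e. W (S e)) (\<lambda>e. S e) A"
    using nuclear_rep_left[OF P W(1)] by (simp add: eq)
  have "op_trace (abs_op A) = (\<Sum>\<^sub>\<infinity>e\<in>E. of_real ((norm (S e))\<^sup>2))"
    unfolding op_trace_nuclear[OF P] cinner_self ..
  also have "\<dots> = of_real (\<Sum>\<^sub>\<infinity>e\<in>E. (norm (S e))\<^sup>2)"
    by (rule infsumI) (intro has_sum_of_real has_sum_infsum sS)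
  finally have tn: "trace_norm A = (\<Sum>\<^sub>\<infinity>e\<in>E. (norm (S e))\<^sup>2)" by (simp add: trace_norm_def)
  have "(\<Sum>\<^sub>\<infinity>e\<in>E. norm (W (S e)) * norm (S e)) \<le> (\<Sum>\<^sub>\<infinity>e\<in>E. (norm (S e))\<^sup>2)"
    using W(2) by (intro infsum_mono nuclear_rep_summable[OF r] sS)
      (auto simp: power2_eq_square intro!: mult_right_mono)
  with nuclear_rep_trace_class(2)[OF r] tn
  have "(\<Sum>\<^sub>\<infinity>e\<in>E. norm (W (S e)) * norm (S e)) = trace_norm A" by simp
  with r show ?thesis using W(2) sS tn by (intro that[of E]) auto
qed

lemma op_trace_onb:
  fixes A :: "'a::chilbert_space \<Rightarrow> 'a"
  assumes A: "A \<in> trace_class" and E: "onb E"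
  shows "((\<lambda>e. cinner e (A e)) has_sum op_trace A) E"
  using trace_class_nuclear[OF A] nuclear_trace(1)[OF _ E] op_trace_nuclear by metis

lemma trace_norm_nonneg: "(A :: 'a::chilbert_space \<Rightarrow> 'a) \<in> trace_class \<Longrightarrow> 0 \<le> trace_norm A"
proof -
  assume "A \<in> trace_class"
  then obtain E :: "'a set" and v :: "'a \<Rightarrow> 'a" where "(\<Sum>\<^sub>\<infinity>e\<in>E. (norm (v e))\<^sup>2) = trace_norm A"
    by (rule trace_class_nuclear)
  thus ?thesis using infsum_nonneg[of E "\<lambda>e. (norm (v e))\<^sup>2"] by simp
qed

lemma trace_class_norm_le:
  assumes A: "A \<in> trace_class" shows "norm (A x) \<le> trace_norm A * norm x"
  using trace_class_nuclear[OF A] nuclear_rep_norm_le by metis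

lemma norm_op_trace_le:
  fixes A :: "'a::chilbert_space \<Rightarrow> 'a"
  assumes A: "A \<in> trace_class" shows "cmod (op_trace A) \<le> trace_norm A"
proof -
  obtain E :: "'a set" and u v where r: "nuclear_rep E u v A"
    "(\<Sum>\<^sub>\<infinity>e\<in>E. norm (u e) * norm (v e)) = trace_norm A"
    using trace_class_nuclear[OF A] by metis
  obtain E' :: "'a set" where E': "onb E'" using onb_exists by blast
  show ?thesis
    unfolding op_trace_nuclear[OF r(1)] r(2)[symmetric]
    by (rule norm_infsum_le[OF has_sum_infsum[OF abs_summable_summable[OF nuclear_trace(2)[OF r(1) E']]]
          has_sum_infsum[OF nuclear_rep_summable[OF r(1)]]])
       (subst mult.commute, rule cinner_Cauchy_Schwarz)
qed

lemma nuclear_rep_rank1: "nuclear_rep {()} (\<lambda>_. u) (\<lambda>_. v) (\<lambda>x. cinner v x *\<^sub>C u)"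
  by (auto simp: nuclear_rep_def has_sum_finite_iff)

lemma rank1_trace_class: "(\<lambda>x. cinner v x *\<^sub>C u) \<in> trace_class"
  and rank1_trace_norm: "trace_norm (\<lambda>x. cinner v x *\<^sub>C u) \<le> norm u * norm v"
  and rank1_trace: "op_trace (\<lambda>x. cinner v x *\<^sub>C u) = cinner v u"
  using nuclear_rep_trace_class[OF nuclear_rep_rank1, of v u] op_trace_nuclear[OF nuclear_rep_rank1, of v u]
  by simp_all

section \<open>Ideal property, infinite sums and linearity of the trace\<close>

lemma trace_class_left:
  fixes A :: "'a::chilbert_space \<Rightarrow> 'a"
  assumes A: "A \<in> trace_class" and K: "bounded_clinear K"
  shows "K \<circ> A \<in> trace_class" "trace_norm (K \<circ> A) \<le> onorm K * trace_norm A"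
proof -
  obtain E :: "'a set" and u v where r: "nuclear_rep E u v A"
    "(\<Sum>\<^sub>\<infinity>e\<in>E. norm (u e) * norm (v e)) = trace_norm A"
    using trace_class_nuclear[OF A] by metis
  note r' = nuclear_rep_left[OF r(1) K]
  show "K \<circ> A \<in> trace_class" by (rule nuclear_rep_trace_class[OF r'])
  have "trace_norm (K \<circ> A) \<le> (\<Sum>\<^sub>\<infinity>e\<in>E. norm (K (u e)) * norm (v e))"
    by (rule nuclear_rep_trace_class[OF r'])
  also have "\<dots> \<le> (\<Sum>\<^sub>\<infinity>e\<in>E. onorm K * (norm (u e) * norm (v e)))"
  proof (intro infsum_mono summable_on_cmult_right nuclear_rep_summable[OF r'] nuclear_rep_summable[OF r(1)])
    show "norm (K (u e)) * norm (v e) \<le> onorm K * (norm (u e) * norm (v e))" for e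
      using mult_right_mono[OF bounded_clinear_norm[OF K, of "u e"] norm_ge_zero[of "v e"]]
      by (simp add: mult_ac)
  qed
  also have "\<dots> = onorm K * trace_norm A" by (simp add: infsum_cmult_right' r(2))
  finally show "trace_norm (K \<circ> A) \<le> onorm K * trace_norm A" .
qed

lemma trace_class_adj:
  fixes A :: "'a::chilbert_space \<Rightarrow> 'a"
  assumes A: "A \<in> trace_class"
  shows "adj A \<in> trace_class" "trace_norm (adj A) \<le> trace_norm A" "op_trace (adj A) = cnj (op_trace A)"
proof -
  obtain E :: "'a set" and u v where r: "nuclear_rep E u v A"
    "(\<Sum>\<^sub>\<infinity>e\<in>E. norm (u e) * norm (v e)) = trace_norm A"
    using trace_class_nuclear[OF A] by metis
  note r' = nuclear_rep_adj[OF r(1)]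
  show "adj A \<in> trace_class" by (rule nuclear_rep_trace_class[OF r'])
  show "trace_norm (adj A) \<le> trace_norm A"
    using nuclear_rep_trace_class(2)[OF r'] r(2) by (simp add: mult.commute)
  have "cinner (u i) (v i) = cnj (cinner (v i) (u i))" for i by (rule cinner_commute)
  thus "op_trace (adj A) = cnj (op_trace A)"
    unfolding op_trace_nuclear[OF r'] op_trace_nuclear[OF r(1)] by simp
qed

text \<open>Adjoints reduce multiplication on the right to multiplication on the left. Cyclicity of
  the trace holds term by term, because both products have nuclear representations over the same
  index set.\<close>

lemma trace_class_right:
  fixes A :: "'a::chilbert_space \<Rightarrow> 'a"
  assumes A: "A \<in> trace_class" and K: "bounded_clinear K"
  shows "A \<circ> K \<in> trace_class" "trace_norm (A \<circ> K) \<le> onorm K * trace_norm A"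
    "op_trace (A \<circ> K) = op_trace (K \<circ> A)"
proof -
  note bA = trace_class_bounded_clinear[OF A]
  have eq: "A \<circ> K = adj (adj K \<circ> adj A)"
    by (simp add: adj_compose bounded_clinear_adj adj_adj bA K)
  have KA: "adj K \<circ> adj A \<in> trace_class"
    by (intro trace_class_left trace_class_adj A bounded_clinear_adj K)
  show "A \<circ> K \<in> trace_class" unfolding eq by (intro trace_class_adj KA)
  have "trace_norm (A \<circ> K) \<le> trace_norm (adj K \<circ> adj A)" unfolding eq by (rule trace_class_adj(2)[OF KA])
  also have "\<dots> \<le> onorm (adj K) * trace_norm (adj A)"
    by (intro trace_class_left trace_class_adj A bounded_clinear_adj K)
  also have "\<dots> \<le> onorm K * trace_norm A"
    by (intro mult_mono onorm_adj_le K trace_class_adj A bounded_clinear_onorm_nonneg trace_norm_nonneg)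
  finally show "trace_norm (A \<circ> K) \<le> onorm K * trace_norm A" .
  obtain E :: "'a set" and u v where r: "nuclear_rep E u v A"
    using trace_class_nuclear[OF A] by metis
  show "op_trace (A \<circ> K) = op_trace (K \<circ> A)"
    unfolding op_trace_nuclear[OF nuclear_rep_left[OF r K]] op_trace_nuclear[OF nuclear_rep_right[OF r K]]
    by (simp add: cinner_adj_left[OF K])
qed

text \<open>Optimal representations of the summands are concatenated over \<open>Sigma J E\<close>,
  where their costs add up. Only pointwise convergence to \<open>A\<close> is assumed, so the same
  argument yields the triangle inequality and completeness.\<close>

lemma trace_class_has_sum:
  fixes D :: "'j \<Rightarrow> 'a::chilbert_space \<Rightarrow> 'a"
  assumes D: "\<And>j. j \<in> J \<Longrightarrow> D j \<in> trace_class" and s: "(\<lambda>j. trace_norm (D j)) summable_on J"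
    and A: "\<And>x. ((\<lambda>j. D j x) has_sum A x) J"
  shows "A \<in> trace_class" "trace_norm A \<le> (\<Sum>\<^sub>\<infinity>j\<in>J. trace_norm (D j))"
proof -
  have "\<exists>E u v. nuclear_rep (E::'a set) u v (D j) \<and>
      (\<Sum>\<^sub>\<infinity>e\<in>E. norm (u e) * norm (v e)) = trace_norm (D j)" if "j \<in> J" for j
    using trace_class_nuclear[OF D[OF that]] by metis
  then obtain E :: "'j \<Rightarrow> 'a set" and u v where
    r: "\<And>j. j \<in> J \<Longrightarrow> nuclear_rep (E j) (u j) (v j) (D j)"
    and n: "\<And>j. j \<in> J \<Longrightarrow> (\<Sum>\<^sub>\<infinity>e\<in>E j. norm (u j e) * norm (v j e)) = trace_norm (D j)"
    by metis
  let ?n = "\<lambda>(j, e). norm (u j e) * norm (v j e)"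
  have hn: "((\<lambda>e. ?n (j, e)) has_sum trace_norm (D j)) (E j)" if "j \<in> J" for j
    using has_sum_infsum[OF nuclear_rep_summable[OF r[OF that]]] by (simp add: n[OF that])
  have sn: "?n summable_on Sigma J E"
    by (rule summable_on_SigmaI[OF hn s]) auto
  have tot: "infsum ?n (Sigma J E) = (\<Sum>\<^sub>\<infinity>j\<in>J. trace_norm (D j))"
    by (rule infsumI[symmetric], rule has_sum_SigmaD[OF has_sum_infsum[OF sn] hn])
  have r': "nuclear_rep (Sigma J E) (\<lambda>(j, e). u j e) (\<lambda>(j, e). v j e) A"
    unfolding nuclear_rep_def
  proof (intro conjI allI)
    show s': "(\<lambda>i. norm (case i of (j, e) \<Rightarrow> u j e) * norm (case i of (j, e) \<Rightarrow> v j e)) summable_on Sigma J E"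
      using sn by (simp add: case_prod_unfold)
    fix x
    show "((\<lambda>i. cinner (case i of (j, e) \<Rightarrow> v j e) x *\<^sub>C (case i of (j, e) \<Rightarrow> u j e)) has_sum A x) (Sigma J E)"
    proof (rule has_sum_SigmaI[OF _ A])
      show "(\<lambda>i. cinner (case i of (j, e) \<Rightarrow> v j e) x *\<^sub>C (case i of (j, e) \<Rightarrow> u j e)) summable_on Sigma J E"
        by (rule abs_summable_summable, rule nuclear_rep_abs_summable, rule s')
      show "((\<lambda>e. cinner (case (j, e) of (j, e) \<Rightarrow> v j e) x *\<^sub>C (case (j, e) of (j, e) \<Rightarrow> u j e))
          has_sum D j x) (E j)" if "j \<in> J" for j
        using nuclear_rep_has_sum[OF r[OF that]] by simp
    qed
  qed
  show "A \<in> trace_class" by (rule nuclear_rep_trace_class[OF r'])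
  show "trace_norm A \<le> (\<Sum>\<^sub>\<infinity>j\<in>J. trace_norm (D j))"
    using nuclear_rep_trace_class(2)[OF r'] tot by (simp add: case_prod_unfold)
qed

lemma trace_class_scaleC:
  fixes A :: "'a::chilbert_space \<Rightarrow> 'a"
  assumes A: "A \<in> trace_class"
  shows "(\<lambda>x. c *\<^sub>C A x) \<in> trace_class" "trace_norm (\<lambda>x. c *\<^sub>C A x) = cmod c * trace_norm A"
proof -
  have le: "(\<lambda>x. c *\<^sub>C A x) \<in> trace_class \<and> trace_norm (\<lambda>x. c *\<^sub>C A x) \<le> cmod c * trace_norm A"
    if A: "A \<in> trace_class" for c and A :: "'a \<Rightarrow> 'a"
  proof -
    obtain E :: "'a set" and u v where r: "nuclear_rep E u v A"
      "(\<Sum>\<^sub>\<infinity>e\<in>E. norm (u e) * norm (v e)) = trace_norm A"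
      using trace_class_nuclear[OF A] by metis
    note r' = nuclear_rep_scaleC[OF r(1), of c]
    have "(\<Sum>\<^sub>\<infinity>e\<in>E. norm (c *\<^sub>C u e) * norm (v e)) = cmod c * trace_norm A"
      by (simp add: norm_scaleC mult.assoc infsum_cmult_right' r(2))
    thus ?thesis using nuclear_rep_trace_class[OF r'] by auto
  qed
  show "(\<lambda>x. c *\<^sub>C A x) \<in> trace_class" using le[OF A] by blast
  show "trace_norm (\<lambda>x. c *\<^sub>C A x) = cmod c * trace_norm A"
  proof (cases "c = 0")
    case True thus ?thesis using le[OF A, of c] trace_norm_nonneg[of "\<lambda>x. c *\<^sub>C A x"] by auto
  next
    case False
    have "trace_norm A = trace_norm (\<lambda>x. inverse c *\<^sub>C c *\<^sub>C A x)"
      using False by (simp add: scaleC_scaleC)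
    also have "\<dots> \<le> cmod (inverse c) * trace_norm (\<lambda>x. c *\<^sub>C A x)"
      using le[of "\<lambda>x. c *\<^sub>C A x"] le[OF A] by blast
    finally have "cmod c * trace_norm A \<le> trace_norm (\<lambda>x. c *\<^sub>C A x)"
      using False mult_left_mono[of "trace_norm A" _ "cmod c"]
      by (fastforce simp: norm_inverse mult.assoc[symmetric])
    thus ?thesis using le[OF A, of c] by simp
  qed
qed

lemma trace_class_add:
  assumes A: "A \<in> trace_class" and B: "B \<in> trace_class"
  shows "(\<lambda>x. A x + B x) \<in> trace_class" "trace_norm (\<lambda>x. A x + B x) \<le> trace_norm A + trace_norm B"
proof -
  \<comment> \<open>A sum of two operators is a sum indexed by \<open>bool\<close>.\<close>
  let ?D = "\<lambda>j. if j then A else B"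
  have 1: "?D j \<in> trace_class" for j using A B by auto
  have 2: "(\<lambda>j. trace_norm (?D j)) summable_on UNIV" by simp
  have 3: "((\<lambda>j. ?D j x) has_sum (A x + B x)) UNIV" for x
    by (rule has_sum_finiteI) (auto simp: UNIV_bool add.commute)
  show "(\<lambda>x. A x + B x) \<in> trace_class" by (rule trace_class_has_sum(1)[OF 1 2 3])
  show "trace_norm (\<lambda>x. A x + B x) \<le> trace_norm A + trace_norm B"
    using trace_class_has_sum(2)[OF 1 2 3] by (simp add: UNIV_bool add.commute)
qed

lemma trace_class_zero: "(\<lambda>x. 0) \<in> trace_class" and trace_norm_zero: "trace_norm (\<lambda>x. 0) = 0"
  using trace_class_scaleC[OF rank1_trace_class, of 0] by simp_all

lemma trace_class_uminus: "A \<in> trace_class \<Longrightarrow> (\<lambda>x. - A x) \<in> trace_class"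
  using trace_class_scaleC(1)[of A "-1"] by (simp add: scaleC_minus_left)

lemma trace_class_diff:
  "A \<in> trace_class \<Longrightarrow> B \<in> trace_class \<Longrightarrow> (\<lambda>x. A x - B x) \<in> trace_class"
  using trace_class_add(1)[OF _ trace_class_uminus, of A B] by simp

lemma op_trace_add:
  fixes A :: "'a::chilbert_space \<Rightarrow> 'a"
  assumes "A \<in> trace_class" "B \<in> trace_class"
  shows "op_trace (\<lambda>x. A x + B x) = op_trace A + op_trace B"
proof -
  obtain E :: "'a set" where E: "onb E" using onb_exists by blast
  show ?thesis
    by (rule has_sum_eqI[OF op_trace_onb[OF trace_class_add(1)[OF assms] E]
          has_sum_add[OF op_trace_onb[OF assms(1) E] op_trace_onb[OF assms(2) E]]])
       (simp add: cinner_simps)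
qed

lemma op_trace_scaleC:
  fixes A :: "'a::chilbert_space \<Rightarrow> 'a"
  assumes "A \<in> trace_class"
  shows "op_trace (\<lambda>x. c *\<^sub>C A x) = c * op_trace A"
proof -
  obtain E :: "'a set" where E: "onb E" using onb_exists by blast
  show ?thesis
    by (rule has_sum_eqI[OF op_trace_onb[OF trace_class_scaleC(1)[OF assms] E]
          has_sum_cmult_right[OF op_trace_onb[OF assms E]]])
       (simp add: cinner_simps)
qed

lemma trace_norm_eq_zero:
  assumes "A \<in> trace_class" "trace_norm A = 0" shows "A = (\<lambda>x. 0)"
  using trace_class_norm_le[OF assms(1)] assms(2) by auto

section \<open>The Banach space of trace class operators\<close>

text \<open>As a type with its own norm, the trace class admits unconditional sums, limits and
  bounded bilinear maps in trace norm; \<open>tc_map\<close> carries maps on operators over to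
  it.\<close>

typedef (overloaded) 'a tc = "trace_class :: ('a::chilbert_space \<Rightarrow> 'a) set"
  morphisms tc_op Tc
  using trace_class_zero by blast

setup_lifting type_definition_tc

lemma tc_op_trace_class [simp]: "tc_op X \<in> trace_class"
  by (rule tc_op)

instantiation tc :: (chilbert_space) real_normed_vector
begin

lift_definition zero_tc :: "'a tc" is "\<lambda>x. 0" by (rule trace_class_zero)
lift_definition plus_tc :: "'a tc \<Rightarrow> 'a tc \<Rightarrow> 'a tc" is "\<lambda>A B x. A x + B x" by (rule trace_class_add)
lift_definition minus_tc :: "'a tc \<Rightarrow> 'a tc \<Rightarrow> 'a tc" is "\<lambda>A B x. A x - B x" by (rule trace_class_diff)
lift_definition uminus_tc :: "'a tc \<Rightarrow> 'a tc" is "\<lambda>A x. - A x" by (rule trace_class_uminus)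
lift_definition scaleR_tc :: "real \<Rightarrow> 'a tc \<Rightarrow> 'a tc" is "\<lambda>r A x. r *\<^sub>R A x"
  using trace_class_scaleC(1)[of _ "complex_of_real _"] by (simp add: scaleC_of_real)
lift_definition norm_tc :: "'a tc \<Rightarrow> real" is trace_norm .
definition dist_tc :: "'a tc \<Rightarrow> 'a tc \<Rightarrow> real" where "dist_tc A B = norm (A - B)"
definition sgn_tc :: "'a tc \<Rightarrow> 'a tc" where "sgn_tc A = inverse (norm A) *\<^sub>R A"
definition uniformity_tc :: "('a tc \<times> 'a tc) filter" where
  "uniformity_tc = (INF e\<in>{0 <..}. principal {(x, y). dist x y < e})"
definition open_tc :: "'a tc set \<Rightarrow> bool" where
  "open_tc U \<longleftrightarrow> (\<forall>x\<in>U. eventually (\<lambda>(x', y). x' = x \<longrightarrow> y \<in> U) uniformity)"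

instance
proof
  fix A B C :: "'a tc" and r s :: real
  show "A + B + C = A + (B + C)" by transfer (simp add: add.assoc)
  show "A + B = B + A" by transfer (simp add: add.commute)
  show "0 + A = A" by transfer simp
  show "- A + A = 0" by transfer simp
  show "A - B = A + - B" by transfer simp
  show "r *\<^sub>R (A + B) = r *\<^sub>R A + r *\<^sub>R B" by transfer (simp add: scaleR_add_right)
  show "(r + s) *\<^sub>R A = r *\<^sub>R A + s *\<^sub>R A" by transfer (simp add: scaleR_add_left)
  show "r *\<^sub>R s *\<^sub>R A = (r * s) *\<^sub>R A" by transfer simp
  show "1 *\<^sub>R A = A" by transfer simp
  show "dist A B = norm (A - B)" by (simp add: dist_tc_def)
  show "sgn A = inverse (norm A) *\<^sub>R A" by (simp add: sgn_tc_def)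
  show "uniformity = (INF e\<in>{0 <..}. principal {(x, y :: 'a tc). dist x y < e})"
    by (simp add: uniformity_tc_def)
  show "open U = (\<forall>x\<in>U. eventually (\<lambda>(x', y). x' = x \<longrightarrow> y \<in> U) uniformity)" for U :: "'a tc set"
    by (simp add: open_tc_def)
  show "norm A = 0 \<longleftrightarrow> A = 0" by transfer (auto simp: trace_norm_zero trace_norm_eq_zero)
  show "norm (A + B) \<le> norm A + norm B" by transfer (rule trace_class_add)
  show "norm (r *\<^sub>R A) = \<bar>r\<bar> * norm A"
    by transfer (use trace_class_scaleC(2)[of _ "complex_of_real _"] in \<open>simp add: scaleC_of_real\<close>)
qed

end

lemma tc_op_simps:
  "tc_op 0 = (\<lambda>x. 0)" "tc_op (X + Y) = (\<lambda>x. tc_op X x + tc_op Y x)"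
  "tc_op (X - Y) = (\<lambda>x. tc_op X x - tc_op Y x)" "tc_op (- X) = (\<lambda>x. - tc_op X x)"
  "tc_op (r *\<^sub>R X) = (\<lambda>x. r *\<^sub>R tc_op X x)"
  by (transfer, simp)+

lemma norm_tc_op: "norm X = trace_norm (tc_op X)"
  by transfer simp

lemma norm_tc_op_apply: "norm (tc_op X x) \<le> norm X * norm x"
  unfolding norm_tc_op by (rule trace_class_norm_le) simp

text \<open>The distance to the pointwise limit is the sum of the remaining increments, whose trace
  norms are dominated by a geometric series; the factor 2 is the sum of that series.\<close>

lemma trace_class_telescope:
  fixes X :: "nat \<Rightarrow> 'a::chilbert_space tc"
  assumes d: "\<And>k. norm (X (Suc k) - X k) < (1/2) ^ k" and L: "\<And>x. (\<lambda>n. tc_op (X n) x) \<longlonglongrightarrow> L x"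
  shows "(\<lambda>x. L x - tc_op (X n) x) \<in> trace_class"
    and "trace_norm (\<lambda>x. L x - tc_op (X n) x) \<le> 2 * (1/2) ^ n"
proof -
  let ?D = "\<lambda>k. tc_op (X (Suc (k + n)) - X (k + n))"
  have 1: "?D k \<in> trace_class" for k by simp
  have dk: "trace_norm (?D k) \<le> (1/2) ^ n * (1/2) ^ k" for k
    using d[of "k + n"] by (simp add: norm_tc_op power_add mult.commute)
  have geo: "(\<lambda>k. (1/2) ^ n * (1/2) ^ k :: real) sums ((1/2) ^ n * (1 / (1 - 1/2)))"
    by (intro sums_mult geometric_sums) simp
  hence hgeo: "((\<lambda>k. (1/2) ^ n * (1/2) ^ k :: real) has_sum ((1/2) ^ n * (1 / (1 - 1/2)))) UNIV"
    by (intro norm_summable_imp_has_sum) (auto simp: sums_iff)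
  have 2: "(\<lambda>k. trace_norm (?D k)) summable_on UNIV"
    by (rule summable_on_comparison_test[OF has_sum_imp_summable[OF hgeo] dk]) (simp add: trace_norm_nonneg)
  have 3: "((\<lambda>k. ?D k x) has_sum (L x - tc_op (X n) x)) UNIV" for x
  proof (rule norm_summable_imp_has_sum)
    have "(\<lambda>k. tc_op (X (k + n)) x) \<longlonglongrightarrow> L x" using L by (rule LIMSEQ_ignore_initial_segment)
    from telescope_sums[OF this] show "(\<lambda>k. ?D k x) sums (L x - tc_op (X n) x)"
      by (simp add: tc_op_simps)
    show "summable (\<lambda>k. norm (?D k x))"
    proof (rule summable_comparison_test')
      show "summable (\<lambda>k. trace_norm (?D k) * norm x)"
        by (intro summable_mult2 summable_on_imp_summable 2)
      show "norm (norm (?D k x)) \<le> trace_norm (?D k) * norm x" for k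
        using norm_tc_op_apply[of "X (Suc (k + n)) - X (k + n)" x] by (simp add: norm_tc_op)
    qed
  qed
  show "(\<lambda>x. L x - tc_op (X n) x) \<in> trace_class" by (rule trace_class_has_sum(1)[OF 1 2 3])
  have "trace_norm (\<lambda>x. L x - tc_op (X n) x) \<le> (\<Sum>\<^sub>\<infinity>k. trace_norm (?D k))"
    by (rule trace_class_has_sum(2)[OF 1 2 3])
  also have "\<dots> \<le> (\<Sum>\<^sub>\<infinity>k. (1/2) ^ n * (1/2) ^ k :: real)"
    by (rule infsum_mono[OF 2 has_sum_imp_summable[OF hgeo] dk])
  also have "\<dots> = 2 * (1/2) ^ n" using infsumI[OF hgeo] by simp
  finally show "trace_norm (\<lambda>x. L x - tc_op (X n) x) \<le> 2 * (1/2) ^ n" .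
qed

instance tc :: (chilbert_space) banach
proof
  fix Y :: "nat \<Rightarrow> 'a tc" assume Y: "Cauchy Y"
  have "\<exists>N. \<forall>m\<ge>N. \<forall>n\<ge>N. norm (Y m - Y n) < (1/2) ^ k" for k :: nat
    using CauchyD[OF Y, of "(1/2) ^ k"] by simp
  then obtain N where N: "\<And>k m n. m \<ge> N k \<Longrightarrow> n \<ge> N k \<Longrightarrow> norm (Y m - Y n) < (1/2) ^ (k::nat)"
    by metis
  \<comment> \<open>The recursion makes \<open>r\<close> strictly increasing with
    \<open>r k \<ge> N k\<close>, so consecutive members of the subsequence are within
    \<open>(1/2) ^ k\<close>.\<close>
  define r where "r = rec_nat (N 0) (\<lambda>k m. max (Suc m) (N (Suc k)))"
  have r0: "r 0 = N 0" and rS: "r (Suc k) = max (Suc (r k)) (N (Suc k))" for k by (simp_all add: r_def)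
  have "strict_mono r" by (rule strict_monoI_Suc) (simp add: rS)
  have rN: "r k \<ge> N k" for k by (cases k) (simp_all add: r0 rS)
  define X where "X = Y \<circ> r"
  have d: "norm (X (Suc k) - X k) < (1/2) ^ k" for k
    unfolding X_def o_def using rN[of k] by (intro N) (auto simp: rS)
  have "Cauchy X" unfolding X_def by (rule Cauchy_subseq_Cauchy[OF Y \<open>strict_mono r\<close>])
  have "convergent (\<lambda>n. tc_op (X n) x)" for x
  proof (rule Cauchy_convergent, rule CauchyI)
    fix e :: real assume "e > 0"
    hence "e / (norm x + 1) > 0" by (simp add: add_nonneg_pos)
    then obtain M where M: "\<And>m n. m \<ge> M \<Longrightarrow> n \<ge> M \<Longrightarrow> norm (X m - X n) < e / (norm x + 1)"
      using CauchyD[OF \<open>Cauchy X\<close>] by metis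
    have "norm (tc_op (X m) x - tc_op (X n) x) < e" if "m \<ge> M" "n \<ge> M" for m n
    proof -
      have "norm (tc_op (X m) x - tc_op (X n) x) \<le> norm (X m - X n) * norm x"
        using norm_tc_op_apply[of "X m - X n" x] by (simp add: tc_op_simps)
      also have "\<dots> \<le> norm (X m - X n) * (norm x + 1)" by (intro mult_left_mono) auto
      also have "\<dots> < e" using M[OF that] by (simp add: pos_less_divide_eq add_nonneg_pos)
      finally show ?thesis .
    qed
    thus "\<exists>M. \<forall>m\<ge>M. \<forall>n\<ge>M. norm (tc_op (X m) x - tc_op (X n) x) < e" by blast
  qed
  then obtain L where L: "\<And>x. (\<lambda>n. tc_op (X n) x) \<longlonglongrightarrow> L x" unfolding convergent_def by metis
  note tel = trace_class_telescope[OF d L]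
  have "(\<lambda>x. (L x - tc_op (X 0) x) + tc_op (X 0) x) \<in> trace_class"
    by (intro trace_class_add tel) simp
  hence Ltc: "L \<in> trace_class" by simp
  have n: "norm (X n - Tc L) \<le> 2 * (1/2) ^ n" for n
  proof -
    have "norm (Tc L - X n) = trace_norm (\<lambda>x. L x - tc_op (X n) x)"
      by (simp add: norm_tc_op tc_op_simps Tc_inverse[OF Ltc])
    thus ?thesis using tel(2)[of n] by (simp add: norm_minus_commute)
  qed
  have "(\<lambda>n. 2 * (1/2) ^ n :: real) \<longlonglongrightarrow> 2 * 0"
    by (intro tendsto_intros LIMSEQ_power_zero) simp
  hence "(\<lambda>n. X n - Tc L) \<longlonglongrightarrow> 0"
    by (intro Lim_null_comparison[OF eventuallyI[of "\<lambda>n. norm (X n - Tc L) \<le> 2 * (1/2) ^ n"]] n) simp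
  hence "X \<longlonglongrightarrow> Tc L" by (simp add: LIM_zero_iff)
  hence "Y \<longlonglongrightarrow> Tc L" unfolding X_def by (rule Cauchy_converges_subseq[OF Y \<open>strict_mono r\<close>])
  thus "convergent Y" by (rule convergentI)
qed

section \<open>The Hilbert space of Hilbert-Schmidt operators\<close>

text \<open>Sum the squared matrix entries in either order. Applied once it passes to the adjoint,
  applied twice it shows independence of the basis.\<close>

lemma hs_swap:
  fixes X :: "'a::chilbert_space \<Rightarrow> 'a"
  assumes X: "bounded_clinear X" and E: "onb E" and F: "onb F"
    and s: "((\<lambda>e. (norm (X e))\<^sup>2) has_sum s) E"
  shows "((\<lambda>f. (norm (adj X f))\<^sup>2) has_sum s) F"
proof -
  define g where "g = (\<lambda>(e, f). (cmod (cinner f (X e)))\<^sup>2)"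
  have 1: "((\<lambda>f. g (e, f)) has_sum (norm (X e))\<^sup>2) F" for e
    unfolding g_def using Parseval_norm[OF F, of "X e"] by simp
  have "g summable_on E \<times> F"
    by (rule summable_on_SigmaI[OF 1 has_sum_imp_summable[OF s]]) (auto simp: g_def)
  hence "(g has_sum s) (E \<times> F)" by (rule has_sum_SigmaI[OF 1 s])
  hence 2: "((\<lambda>(f, e). g (e, f)) has_sum s) (F \<times> E)" by (subst (asm) has_sum_swap)
  show ?thesis
  proof (rule has_sum_SigmaD[OF 2])
    have "cmod (cinner f (X e)) = cmod (cinner e (adj X f))" for e f
      by (metis cinner_adj_right[OF X] cinner_commute complex_mod_cnj)
    thus "((\<lambda>e. case (f, e) of (f, e) \<Rightarrow> g (e, f)) has_sum (norm (adj X f))\<^sup>2) E" for f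
      unfolding g_def using Parseval_norm[OF E, of "adj X f"] by simp
  qed
qed

lemma hilbert_schmidt_bounded_clinear: "X \<in> hilbert_schmidt \<Longrightarrow> bounded_clinear X"
  by (simp add: hilbert_schmidt_def)

lemma hilbert_schmidtI:
  "bounded_clinear X \<Longrightarrow> onb E \<Longrightarrow> (\<lambda>e. (norm (X e))\<^sup>2) summable_on E \<Longrightarrow> X \<in> hilbert_schmidt"
  by (auto simp: hilbert_schmidt_def orthonormal_basis_UNIV)

lemma hilbert_schmidt_onb:
  fixes X :: "'a::chilbert_space \<Rightarrow> 'a"
  assumes X: "X \<in> hilbert_schmidt" and E: "onb E"
  shows "(\<lambda>e. (norm (X e))\<^sup>2) summable_on E" "(\<lambda>e. (norm (adj X e))\<^sup>2) summable_on E"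
    "(\<Sum>\<^sub>\<infinity>e\<in>E. (norm (adj X e))\<^sup>2) = (\<Sum>\<^sub>\<infinity>e\<in>E. (norm (X e))\<^sup>2)"
proof -
  have bX: "bounded_clinear X" using X by (rule hilbert_schmidt_bounded_clinear)
  obtain E' :: "'a set" where E': "onb E'" "(\<lambda>e. (norm (X e))\<^sup>2) summable_on E'"
    using X by (auto simp: hilbert_schmidt_def orthonormal_basis_UNIV)
  have 1: "((\<lambda>f. (norm (adj X f))\<^sup>2) has_sum (\<Sum>\<^sub>\<infinity>e\<in>E'. (norm (X e))\<^sup>2)) E"
    by (rule hs_swap[OF bX E'(1) E has_sum_infsum[OF E'(2)]])
  have 2: "((\<lambda>f. (norm (X f))\<^sup>2) has_sum (\<Sum>\<^sub>\<infinity>e\<in>E'. (norm (X e))\<^sup>2)) E"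
    using hs_swap[OF bounded_clinear_adj[OF bX] E E 1] by (simp add: adj_adj bX)
  show "(\<lambda>e. (norm (X e))\<^sup>2) summable_on E" "(\<lambda>e. (norm (adj X e))\<^sup>2) summable_on E"
    "(\<Sum>\<^sub>\<infinity>e\<in>E. (norm (adj X e))\<^sup>2) = (\<Sum>\<^sub>\<infinity>e\<in>E. (norm (X e))\<^sup>2)"
    using 1 2 by (auto simp: has_sum_iff)
qed

lemma sum_norm_sq_le: "(norm (a + b :: 'a::real_normed_vector))\<^sup>2 \<le> 2 * (norm a)\<^sup>2 + 2 * (norm b)\<^sup>2"
proof -
  have "(norm (a + b))\<^sup>2 \<le> (norm a + norm b)\<^sup>2"
    by (intro power_mono norm_triangle_ineq) simp
  also have "\<dots> \<le> 2 * (norm a)\<^sup>2 + 2 * (norm b)\<^sup>2"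
    using zero_le_power2[of "norm a - norm b"] by (simp add: power2_eq_square algebra_simps)
  finally show ?thesis .
qed

lemma hilbert_schmidt_add:
  fixes X :: "'a::chilbert_space \<Rightarrow> 'a"
  assumes X: "X \<in> hilbert_schmidt" and Y: "Y \<in> hilbert_schmidt"
  shows "(\<lambda>x. X x + Y x) \<in> hilbert_schmidt"
proof -
  obtain E :: "'a set" where E: "onb E" using onb_exists by blast
  show ?thesis
  proof (rule hilbert_schmidtI[OF _ E])
    show "bounded_clinear (\<lambda>x. X x + Y x)"
      by (intro bounded_clinear_plus hilbert_schmidt_bounded_clinear X Y)
    have "(\<lambda>e. 2 * (norm (X e))\<^sup>2 + 2 * (norm (Y e))\<^sup>2) summable_on E"
      by (intro summable_on_add summable_on_cmult_right hilbert_schmidt_onb X Y E)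
    thus "(\<lambda>e. (norm (X e + Y e))\<^sup>2) summable_on E"
      by (rule summable_on_comparison_test) (auto intro: sum_norm_sq_le)
  qed
qed

lemma hilbert_schmidt_scaleC:
  fixes X :: "'a::chilbert_space \<Rightarrow> 'a"
  assumes X: "X \<in> hilbert_schmidt"
  shows "(\<lambda>x. c *\<^sub>C X x) \<in> hilbert_schmidt"
proof -
  obtain E :: "'a set" where E: "onb E" using onb_exists by blast
  show ?thesis
  proof (rule hilbert_schmidtI[OF _ E])
    show "bounded_clinear (\<lambda>x. c *\<^sub>C X x)"
      by (intro bounded_clinear_smult hilbert_schmidt_bounded_clinear X)
    show "(\<lambda>e. (norm (c *\<^sub>C X e))\<^sup>2) summable_on E"
      unfolding norm_scaleC power_mult_distrib
      by (rule summable_on_cmult_right[OF hilbert_schmidt_onb(1)[OF X E]])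
  qed
qed

lemma trace_class_hilbert_schmidt:
  fixes A :: "'a::chilbert_space \<Rightarrow> 'a"
  assumes A: "A \<in> trace_class"
  shows "A \<in> hilbert_schmidt"
proof -
  note bA = trace_class_bounded_clinear[OF A]
  obtain E :: "'a set" where E: "onb E" using onb_exists by blast
  have "adj A \<circ> A \<in> trace_class" by (intro trace_class_left A bounded_clinear_adj bA)
  from op_trace_onb[OF this E] have "(\<lambda>e. cinner e ((adj A \<circ> A) e)) summable_on E"
    by (rule has_sum_imp_summable)
  from summable_on_Re[OF this] have "(\<lambda>e. (norm (A e))\<^sup>2) summable_on E"
    by (simp add: cinner_adj_right[OF bA] Re_cinner_self)
  with bA E show ?thesis by (rule hilbert_schmidtI)
qed

text \<open>Expanding \<open>Y x\<close> in the basis before applying \<open>adj X\<close>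
  represents the product by the vectors \<open>adj X e\<close> and \<open>adj Y e\<close>. Thus
  \<open>hs_inner\<close> is indeed the trace of a trace class operator.\<close>

lemma hs_product_nuclear:
  fixes X :: "'a::chilbert_space \<Rightarrow> 'a"
  assumes X: "X \<in> hilbert_schmidt" and Y: "Y \<in> hilbert_schmidt" and E: "onb E"
  shows "nuclear_rep E (\<lambda>e. adj X e) (\<lambda>e. adj Y e) (adj X \<circ> Y)"
  unfolding nuclear_rep_def
proof (intro conjI allI)
  have bX: "bounded_clinear X" and bY: "bounded_clinear Y"
    using X Y by (auto intro: hilbert_schmidt_bounded_clinear)
  have "(\<lambda>e. (norm (adj X e))\<^sup>2 + (norm (adj Y e))\<^sup>2) summable_on E"
    by (intro summable_on_add hilbert_schmidt_onb X Y E)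
  thus "(\<lambda>e. norm (adj X e) * norm (adj Y e)) summable_on E"
  proof (rule summable_on_comparison_test)
    show "norm (adj X e) * norm (adj Y e) \<le> (norm (adj X e))\<^sup>2 + (norm (adj Y e))\<^sup>2" for e
      using sum_squares_bound[of "norm (adj X e)" "norm (adj Y e)"]
        mult_nonneg_nonneg[OF norm_ge_zero[of "adj X e"] norm_ge_zero[of "adj Y e"]] by linarith
  qed simp
  show "((\<lambda>e. cinner (adj Y e) x *\<^sub>C adj X e) has_sum (adj X \<circ> Y) x) E" for x
    using bounded_clinear_has_sum[OF bounded_clinear_adj[OF bX] onb_expansion[OF E, of "Y x"]]
    by (simp add: bounded_clinear_scaleC[OF bounded_clinear_adj[OF bX]] cinner_adj_left[OF bY])
qed

lemma hs_inner_has_sum: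
  fixes X :: "'a::chilbert_space \<Rightarrow> 'a"
  assumes X: "X \<in> hilbert_schmidt" and Y: "Y \<in> hilbert_schmidt" and E: "onb E"
  shows "((\<lambda>e. cinner (X e) (Y e)) has_sum hs_inner X Y) E"
  using op_trace_onb[OF nuclear_rep_trace_class(1)[OF hs_product_nuclear[OF X Y E]] E]
  by (simp add: hs_inner_def cinner_adj_right hilbert_schmidt_bounded_clinear X)

lemma hs_inner_self:
  fixes X :: "'a::chilbert_space \<Rightarrow> 'a"
  assumes X: "X \<in> hilbert_schmidt" and E: "onb E"
  shows "hs_inner X X = of_real (\<Sum>\<^sub>\<infinity>e\<in>E. (norm (X e))\<^sup>2)"
  by (rule has_sum_eqI[OF hs_inner_has_sum[OF X X E]
        has_sum_of_real[OF has_sum_infsum[OF hilbert_schmidt_onb(1)[OF X E]]]]) (simp add: cinner_self)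

lemma hs_norm_apply:
  fixes X :: "'a::chilbert_space \<Rightarrow> 'a"
  assumes X: "X \<in> hilbert_schmidt"
  shows "(norm (X x))\<^sup>2 \<le> Re (hs_inner X X) * (norm x)\<^sup>2"
proof -
  obtain E :: "'a set" where E: "onb E" using onb_exists by blast
  have bX: "bounded_clinear X" using X by (rule hilbert_schmidt_bounded_clinear)
  have "norm ((adj X \<circ> X) x) \<le> (\<Sum>\<^sub>\<infinity>e\<in>E. norm (adj X e) * norm (adj X e)) * norm x"
    by (rule nuclear_rep_norm_le[OF hs_product_nuclear[OF X X E]])
  also have "(\<Sum>\<^sub>\<infinity>e\<in>E. norm (adj X e) * norm (adj X e)) = Re (hs_inner X X)"
    using hilbert_schmidt_onb(3)[OF X E] hs_inner_self[OF X E] by (simp add: power2_eq_square)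
  finally have *: "norm (adj X (X x)) \<le> Re (hs_inner X X) * norm x" by simp
  have "(norm (X x))\<^sup>2 = Re (cinner x (adj X (X x)))" by (simp add: cinner_adj_right[OF bX] Re_cinner_self)
  also have "\<dots> \<le> norm x * norm (adj X (X x))"
    using cinner_Cauchy_Schwarz[of x "adj X (X x)"] complex_Re_le_cmod order_trans by blast
  also have "\<dots> \<le> norm x * (Re (hs_inner X X) * norm x)" by (intro mult_left_mono *) simp
  finally show ?thesis by (simp add: power2_eq_square mult_ac)
qed

text \<open>Minkowski's inequality on finite parts of a basis. It is proved from the sums because a
  norm has to be in place before \<open>hs\<close> can become an instance of
  \<open>chilbert_space\<close>.\<close>

lemma hs_triangle:
  fixes X :: "'a::chilbert_space \<Rightarrow> 'a"
  assumes X: "X \<in> hilbert_schmidt" and Y: "Y \<in> hilbert_schmidt"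
  shows "sqrt (Re (hs_inner (\<lambda>x. X x + Y x) (\<lambda>x. X x + Y x)))
    \<le> sqrt (Re (hs_inner X X)) + sqrt (Re (hs_inner Y Y))"
proof -
  obtain E :: "'a set" where E: "onb E" using onb_exists by blast
  note XY = hilbert_schmidt_add[OF X Y]
  have L: "L2_set (\<lambda>e. norm (Z e)) F \<le> sqrt (Re (hs_inner Z Z))"
    if "Z \<in> hilbert_schmidt" "finite F" "F \<subseteq> E" for Z F
    unfolding L2_set_def hs_inner_self[OF that(1) E]
    using finite_sum_le_infsum[OF hilbert_schmidt_onb(1)[OF that(1) E] that(2,3)] by simp
  let ?s = "sqrt (Re (hs_inner X X)) + sqrt (Re (hs_inner Y Y))"
  have "(\<Sum>e\<in>F. (norm (X e + Y e))\<^sup>2) \<le> ?s\<^sup>2" if F: "finite F" "F \<subseteq> E" for F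
  proof -
    have "L2_set (\<lambda>e. norm (X e + Y e)) F \<le> L2_set (\<lambda>e. norm (X e) + norm (Y e)) F"
      by (intro L2_set_mono norm_triangle_ineq) simp
    also have "\<dots> \<le> L2_set (\<lambda>e. norm (X e)) F + L2_set (\<lambda>e. norm (Y e)) F"
      by (rule L2_set_triangle_ineq)
    also have "\<dots> \<le> ?s" using L[OF X F] L[OF Y F] by simp
    finally have "(L2_set (\<lambda>e. norm (X e + Y e)) F)\<^sup>2 \<le> ?s\<^sup>2"
      by (rule power_mono) (rule L2_set_nonneg)
    thus ?thesis by (simp add: L2_set_def sum_nonneg)
  qed
  hence "(\<Sum>\<^sub>\<infinity>e\<in>E. (norm (X e + Y e))\<^sup>2) \<le> ?s\<^sup>2"
    by (intro infsum_le_finite_sums hilbert_schmidt_onb(1)[OF XY E]) auto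
  moreover have "?s \<ge> 0"
    by (simp add: hs_inner_self[OF X E] hs_inner_self[OF Y E] infsum_nonneg)
  ultimately show ?thesis
    unfolding hs_inner_self[OF XY E] by (intro real_le_lsqrt) (auto intro: infsum_nonneg)
qed

typedef (overloaded) 'a hs = "hilbert_schmidt :: ('a::chilbert_space \<Rightarrow> 'a) set"
  morphisms hs_op Hs
  using trace_class_hilbert_schmidt[OF trace_class_zero] by blast

setup_lifting type_definition_hs

lemma hs_op_hilbert_schmidt [simp]: "hs_op X \<in> hilbert_schmidt"
  by (rule hs_op)

instantiation hs :: (chilbert_space) real_normed_vector
begin

lift_definition zero_hs :: "'a hs" is "\<lambda>x. 0"
  by (rule trace_class_hilbert_schmidt[OF trace_class_zero])
lift_definition plus_hs :: "'a hs \<Rightarrow> 'a hs \<Rightarrow> 'a hs" is "\<lambda>A B x. A x + B x" by (rule hilbert_schmidt_add)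
lift_definition uminus_hs :: "'a hs \<Rightarrow> 'a hs" is "\<lambda>A x. - A x"
  using hilbert_schmidt_scaleC[of _ "-1"] by (simp add: scaleC_minus_left)
definition minus_hs :: "'a hs \<Rightarrow> 'a hs \<Rightarrow> 'a hs" where "minus_hs A B = A + - B"
lift_definition scaleR_hs :: "real \<Rightarrow> 'a hs \<Rightarrow> 'a hs" is "\<lambda>r A x. r *\<^sub>R A x"
  using hilbert_schmidt_scaleC[of _ "complex_of_real _"] by (simp add: scaleC_of_real)
lift_definition norm_hs :: "'a hs \<Rightarrow> real" is "\<lambda>A. sqrt (Re (hs_inner A A))" .
definition dist_hs :: "'a hs \<Rightarrow> 'a hs \<Rightarrow> real" where "dist_hs A B = norm (A - B)"
definition sgn_hs :: "'a hs \<Rightarrow> 'a hs" where "sgn_hs A = inverse (norm A) *\<^sub>R A"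
definition uniformity_hs :: "('a hs \<times> 'a hs) filter" where
  "uniformity_hs = (INF e\<in>{0 <..}. principal {(x, y). dist x y < e})"
definition open_hs :: "'a hs set \<Rightarrow> bool" where
  "open_hs U \<longleftrightarrow> (\<forall>x\<in>U. eventually (\<lambda>(x', y). x' = x \<longrightarrow> y \<in> U) uniformity)"

instance
proof
  fix A B C :: "'a hs" and r s :: real
  show "A + B + C = A + (B + C)" by transfer (simp add: add.assoc)
  show "A + B = B + A" by transfer (simp add: add.commute)
  show "0 + A = A" by transfer simp
  show "- A + A = 0" by transfer simp
  show "A - B = A + - B" by (rule minus_hs_def)
  show "r *\<^sub>R (A + B) = r *\<^sub>R A + r *\<^sub>R B" by transfer (simp add: scaleR_add_right)
  show "(r + s) *\<^sub>R A = r *\<^sub>R A + s *\<^sub>R A" by transfer (simp add: scaleR_add_left)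
  show "r *\<^sub>R s *\<^sub>R A = (r * s) *\<^sub>R A" by transfer simp
  show "1 *\<^sub>R A = A" by transfer simp
  show "dist A B = norm (A - B)" by (simp add: dist_hs_def)
  show "sgn A = inverse (norm A) *\<^sub>R A" by (simp add: sgn_hs_def)
  show "uniformity = (INF e\<in>{0 <..}. principal {(x, y :: 'a hs). dist x y < e})"
    by (simp add: uniformity_hs_def)
  show "open U = (\<forall>x\<in>U. eventually (\<lambda>(x', y). x' = x \<longrightarrow> y \<in> U) uniformity)" for U :: "'a hs set"
    by (simp add: open_hs_def)
  obtain E :: "'a set" where E: "onb E" using onb_exists by blast
  show "norm A = 0 \<longleftrightarrow> A = 0"
  proof transfer
    fix A :: "'a \<Rightarrow> 'a" assume A: "A \<in> hilbert_schmidt"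
    show "sqrt (Re (hs_inner A A)) = 0 \<longleftrightarrow> A = (\<lambda>x. 0)"
      using hs_norm_apply[OF A] hs_inner_self[OF A E] by auto
  qed
  show "norm (A + B) \<le> norm A + norm B" by transfer (rule hs_triangle)
  show "norm (r *\<^sub>R A) = \<bar>r\<bar> * norm A"
  proof transfer
    fix A :: "'a \<Rightarrow> 'a" and r :: real assume A: "A \<in> hilbert_schmidt"
    have A': "(\<lambda>x. r *\<^sub>R A x) \<in> hilbert_schmidt"
      using hilbert_schmidt_scaleC[OF A, of "complex_of_real r"] by (simp add: scaleC_of_real)
    show "sqrt (Re (hs_inner (\<lambda>x. r *\<^sub>R A x) (\<lambda>x. r *\<^sub>R A x))) = \<bar>r\<bar> * sqrt (Re (hs_inner A A))"
      unfolding hs_inner_self[OF A E] hs_inner_self[OF A' E]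
      by (simp add: power_mult_distrib infsum_cmult_right' real_sqrt_mult)
  qed
qed

end

lemma hs_op_simps:
  "hs_op 0 = (\<lambda>x. 0)" "hs_op (X + Y) = (\<lambda>x. hs_op X x + hs_op Y x)"
  "hs_op (X - Y) = (\<lambda>x. hs_op X x - hs_op Y x)" "hs_op (r *\<^sub>R X) = (\<lambda>x. r *\<^sub>R hs_op X x)"
  unfolding minus_hs_def by (transfer, simp)+

lemma norm_hs_op_sq:
  assumes "onb E"
  shows "(norm X)\<^sup>2 = (\<Sum>\<^sub>\<infinity>e\<in>E. (norm (hs_op X e))\<^sup>2)"
  using assms by transfer (simp add: hs_inner_self infsum_nonneg)

lemma norm_hs_op_apply: "norm (hs_op X x) \<le> norm X * norm x"
proof (rule power2_le_imp_le)
  obtain E :: "'a set" where E: "onb E" using onb_exists by blast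
  have "Re (hs_inner (hs_op X) (hs_op X)) = (norm X)\<^sup>2"
    by (simp add: norm_hs_op_sq[OF E] hs_inner_self[OF _ E])
  thus "(norm (hs_op X x))\<^sup>2 \<le> (norm X * norm x)\<^sup>2"
    using hs_norm_apply[of "hs_op X" x] by (simp add: power_mult_distrib)
qed simp

instance hs :: (chilbert_space) banach
proof
  fix X :: "nat \<Rightarrow> 'a hs" assume X: "Cauchy X"
  obtain E :: "'a set" where E: "onb E" using onb_exists by blast
  have "convergent (\<lambda>n. hs_op (X n) x)" for x
  proof (rule Cauchy_convergent, rule CauchyI)
    fix e :: real assume "e > 0"
    hence "e / (norm x + 1) > 0" by (simp add: add_nonneg_pos)
    then obtain M where M: "\<And>m n. m \<ge> M \<Longrightarrow> n \<ge> M \<Longrightarrow> norm (X m - X n) < e / (norm x + 1)"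
      using CauchyD[OF X] by metis
    have "norm (hs_op (X m) x - hs_op (X n) x) < e" if "m \<ge> M" "n \<ge> M" for m n
    proof -
      have "norm (hs_op (X m) x - hs_op (X n) x) \<le> norm (X m - X n) * norm x"
        using norm_hs_op_apply[of "X m - X n" x] by (simp add: hs_op_simps)
      also have "\<dots> \<le> norm (X m - X n) * (norm x + 1)" by (intro mult_left_mono) auto
      also have "\<dots> < e" using M[OF that] by (simp add: pos_less_divide_eq add_nonneg_pos)
      finally show ?thesis .
    qed
    thus "\<exists>M. \<forall>m\<ge>M. \<forall>n\<ge>M. norm (hs_op (X m) x - hs_op (X n) x) < e" by blast
  qed
  then obtain L where L: "\<And>x. (\<lambda>n. hs_op (X n) x) \<longlonglongrightarrow> L x" unfolding convergent_def by metis
  have Lc: "L (c *\<^sub>C x) = c *\<^sub>C L x" for c x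
  proof (rule LIMSEQ_unique[OF L])
    have "(\<lambda>n. c *\<^sub>C hs_op (X n) x) \<longlonglongrightarrow> c *\<^sub>C L x" by (intro tendsto_intros L)
    thus "(\<lambda>n. hs_op (X n) (c *\<^sub>C x)) \<longlonglongrightarrow> c *\<^sub>C L x"
      by (simp add: bounded_clinear_scaleC[OF hilbert_schmidt_bounded_clinear])
  qed
  have La: "L (x + y) = L x + L y" for x y
  proof (rule LIMSEQ_unique[OF L])
    have "(\<lambda>n. hs_op (X n) x + hs_op (X n) y) \<longlonglongrightarrow> L x + L y" by (intro tendsto_intros L)
    thus "(\<lambda>n. hs_op (X n) (x + y)) \<longlonglongrightarrow> L x + L y"
      by (simp add: bounded_clinear_add[OF hilbert_schmidt_bounded_clinear])
  qed
  obtain K where K: "\<And>n. norm (X n) \<le> K"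
    using Cauchy_Bseq[OF X] by (auto simp: Bseq_def)
  have Ln: "norm (L x) \<le> K * norm x" for x
  proof (rule LIMSEQ_le_const2[OF tendsto_norm[OF L]])
    show "\<exists>N. \<forall>n\<ge>N. norm (hs_op (X n) x) \<le> K * norm x"
      using norm_hs_op_apply[of "X _" x] mult_right_mono[OF K norm_ge_zero[of x]] order_trans by blast
  qed
  have bL: "bounded_clinear L" by (rule bounded_clinearI[OF La Lc Ln])
  \<comment> \<open>For a finite set of basis vectors the index \<open>m\<close> can be sent to
    infinity inside the sum, with a bound independent of the set; taking all finite sets gives the
    full Hilbert-Schmidt estimate.\<close>
  have fin: "(\<Sum>e\<in>F. (norm (hs_op (X n) e - L e))\<^sup>2) \<le> d\<^sup>2"
    if d: "\<And>m. m \<ge> M \<Longrightarrow> norm (X n - X m) \<le> d" and F: "finite F" "F \<subseteq> E" for n M d F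
  proof (rule LIMSEQ_le_const2)
    show "(\<lambda>m. \<Sum>e\<in>F. (norm (hs_op (X n) e - hs_op (X m) e))\<^sup>2) \<longlonglongrightarrow> (\<Sum>e\<in>F. (norm (hs_op (X n) e - L e))\<^sup>2)"
      by (intro tendsto_intros L)
    have "(\<Sum>e\<in>F. (norm (hs_op (X n) e - hs_op (X m) e))\<^sup>2) \<le> d\<^sup>2" if "m \<ge> M" for m
    proof -
      have "(\<Sum>e\<in>F. (norm (hs_op (X n) e - hs_op (X m) e))\<^sup>2) = (\<Sum>e\<in>F. (norm (hs_op (X n - X m) e))\<^sup>2)"
        by (simp add: hs_op_simps)
      also have "\<dots> \<le> (\<Sum>\<^sub>\<infinity>e\<in>E. (norm (hs_op (X n - X m) e))\<^sup>2)"
        by (rule finite_sum_le_infsum[OF hilbert_schmidt_onb(1)[OF _ E] F]) auto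
      also have "\<dots> = (norm (X n - X m))\<^sup>2" by (simp add: norm_hs_op_sq[OF E])
      also have "\<dots> \<le> d\<^sup>2" by (intro power_mono d that) simp
      finally show ?thesis .
    qed
    thus "\<exists>N. \<forall>m\<ge>N. (\<Sum>e\<in>F. (norm (hs_op (X n) e - hs_op (X m) e))\<^sup>2) \<le> d\<^sup>2" by blast
  qed
  have diff: "(\<lambda>x. hs_op (X n) x - L x) \<in> hilbert_schmidt \<and>
      (\<Sum>\<^sub>\<infinity>e\<in>E. (norm (hs_op (X n) e - L e))\<^sup>2) \<le> d\<^sup>2"
    if d: "\<And>m. m \<ge> M \<Longrightarrow> norm (X n - X m) \<le> d" for n M d
  proof -
    have s: "(\<lambda>e. (norm (hs_op (X n) e - L e))\<^sup>2) summable_on E"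
      by (rule nonneg_bdd_above_summable_on) (use fin[OF d] in \<open>auto intro!: bdd_aboveI2\<close>)
    moreover have "(\<Sum>\<^sub>\<infinity>e\<in>E. (norm (hs_op (X n) e - L e))\<^sup>2) \<le> d\<^sup>2"
      by (rule infsum_le_finite_sums[OF s]) (use fin[OF d] in auto)
    moreover have "bounded_clinear (\<lambda>x. hs_op (X n) x - L x)"
      by (intro bounded_clinear_minus bL hilbert_schmidt_bounded_clinear) simp
    ultimately show ?thesis using hilbert_schmidtI[OF _ E] by blast
  qed
  obtain M0 where M0: "\<And>m n. m \<ge> M0 \<Longrightarrow> n \<ge> M0 \<Longrightarrow> norm (X m - X n) < 1"
    using CauchyD[OF X, of 1] by auto
  have "(\<lambda>x. hs_op (X M0) x - L x) \<in> hilbert_schmidt"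
    using diff[of M0 M0 1] M0 by (simp add: less_imp_le)
  from hilbert_schmidt_add[OF hilbert_schmidt_scaleC[OF this, of "-1"], of "hs_op (X M0)"]
  have Lhs: "L \<in> hilbert_schmidt" by (simp add: scaleC_minus_left)
  have "X \<longlonglongrightarrow> Hs L"
  proof (rule LIMSEQ_I)
    fix r :: real assume "r > 0"
    then obtain M where M: "\<And>m n. m \<ge> M \<Longrightarrow> n \<ge> M \<Longrightarrow> norm (X m - X n) < r / 2"
      using CauchyD[OF X, of "r/2"] by auto
    have "norm (X n - Hs L) < r" if "n \<ge> M" for n
    proof -
      have "(\<Sum>\<^sub>\<infinity>e\<in>E. (norm (hs_op (X n) e - L e))\<^sup>2) \<le> (r/2)\<^sup>2"
        using diff[of M n "r/2"] M that by (simp add: less_imp_le)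
      hence "(norm (X n - Hs L))\<^sup>2 \<le> (r/2)\<^sup>2"
        by (simp add: norm_hs_op_sq[OF E] hs_op_simps Hs_inverse[OF Lhs])
      hence "norm (X n - Hs L) \<le> r/2" by (rule power2_le_imp_le) (use \<open>r > 0\<close> in simp)
      thus ?thesis using \<open>r > 0\<close> by simp
    qed
    thus "\<exists>no. \<forall>n\<ge>no. norm (X n - Hs L) < r" by blast
  qed
  thus "convergent X" by (rule convergentI)
qed

text \<open>With this instance, Bessel and Parseval apply to Hilbert-Schmidt operators themselves,
  which is where the trace of a map on operators is computed.\<close>

instantiation hs :: (chilbert_space) chilbert_space
begin

lift_definition scaleC_hs :: "complex \<Rightarrow> 'a hs \<Rightarrow> 'a hs" is "\<lambda>c A x. c *\<^sub>C A x"
  by (rule hilbert_schmidt_scaleC)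
lift_definition cinner_hs :: "'a hs \<Rightarrow> 'a hs \<Rightarrow> complex" is hs_inner .

instance
proof
  fix x y z :: "'a hs" and a b :: complex and r :: real
  obtain E :: "'a set" where E: "onb E" using onb_exists by blast
  note hsum = hs_inner_has_sum[OF _ _ E]
  show "complex_of_real r *\<^sub>C x = r *\<^sub>R x" by transfer (simp add: scaleC_of_real)
  show "a *\<^sub>C (x + y) = a *\<^sub>C x + a *\<^sub>C y" by transfer (simp add: scaleC_add_right)
  show "(a + b) *\<^sub>C x = a *\<^sub>C x + b *\<^sub>C x" by transfer (simp add: scaleC_add_left)
  show "a *\<^sub>C b *\<^sub>C x = (a * b) *\<^sub>C x" by transfer (simp add: scaleC_scaleC)
  show "cinner x y = cnj (cinner y x)"
  proof transfer
    fix X Y :: "'a \<Rightarrow> 'a" assume XY: "X \<in> hilbert_schmidt" "Y \<in> hilbert_schmidt"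
    have "((\<lambda>e. cnj (cinner (Y e) (X e))) has_sum cnj (hs_inner Y X)) E"
      using hsum[OF XY(2,1)] by (simp only: has_sum_cnj_iff)
    from hsum[OF XY] this show "hs_inner X Y = cnj (hs_inner Y X)"
      by (rule has_sum_eqI) (rule cinner_commute)
  qed
  show "cinner x (y + z) = cinner x y + cinner x z"
  proof transfer
    fix X Y Z :: "'a \<Rightarrow> 'a" assume XYZ: "X \<in> hilbert_schmidt" "Y \<in> hilbert_schmidt" "Z \<in> hilbert_schmidt"
    show "hs_inner X (\<lambda>x. Y x + Z x) = hs_inner X Y + hs_inner X Z"
      by (rule has_sum_eqI[OF hsum[OF XYZ(1) hilbert_schmidt_add[OF XYZ(2,3)]]
            has_sum_add[OF hsum[OF XYZ(1,2)] hsum[OF XYZ(1,3)]]]) (simp add: cinner_simps)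
  qed
  show "cinner x (a *\<^sub>C y) = a * cinner x y"
  proof transfer
    fix X Y :: "'a \<Rightarrow> 'a" and a assume XY: "X \<in> hilbert_schmidt" "Y \<in> hilbert_schmidt"
    show "hs_inner X (\<lambda>x. a *\<^sub>C Y x) = a * hs_inner X Y"
      by (rule has_sum_eqI[OF hsum[OF XY(1) hilbert_schmidt_scaleC[OF XY(2)]]
            has_sum_cmult_right[OF hsum[OF XY]]]) (simp add: cinner_simps)
  qed
  show "cinner x x = complex_of_real ((norm x)\<^sup>2)"
    unfolding cinner_hs.rep_eq norm_hs_op_sq[OF E] hs_inner_self[OF hs_op_hilbert_schmidt E] ..
qed

end

lemma hs_orthonormal_basis:
  assumes F: "orthonormal_basis hilbert_schmidt hs_inner F"
  shows "F \<subseteq> hilbert_schmidt" "inj_on Hs F" "onb (Hs ` F)"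
proof -
  show sub: "F \<subseteq> hilbert_schmidt" using F by (simp add: orthonormal_basis_def)
  show "inj_on Hs F" using sub by (intro inj_onI) (metis Hs_inverse subsetD)
  have ci: "cinner (Hs A) X = hs_inner A (hs_op X)" if "A \<in> F" for A X
    using that sub by (simp add: cinner_hs.rep_eq Hs_inverse subset_iff)
  show "onb (Hs ` F)" unfolding onb_def
  proof (intro conjI allI impI)
    show "orthonormal (Hs ` F)" unfolding orthonormal_def
    proof (intro ballI)
      fix A B assume "A \<in> Hs ` F" "B \<in> Hs ` F"
      then obtain a b where ab: "A = Hs a" "B = Hs b" "a \<in> F" "b \<in> F" by auto
      have "a = b \<longleftrightarrow> A = B" using ab sub by (metis Hs_inverse subsetD)
      moreover have "cinner A B = (if a = b then 1 else 0)"
        using F ab sub by (simp add: ci Hs_inverse subset_iff orthonormal_basis_def)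
      ultimately show "cinner A B = (if A = B then 1 else 0)" by simp
    qed
    fix X assume "\<forall>A\<in>Hs ` F. cinner A X = 0"
    hence "\<forall>A\<in>F. hs_inner A (hs_op X) = 0" using ci by auto
    hence "hs_inner (hs_op X) (hs_op X) = 0" using F by (simp add: orthonormal_basis_def)
    hence "cinner X X = 0" by (simp add: cinner_hs.rep_eq)
    thus "X = 0" by (simp add: cinner_self)
  qed
qed

lemma hs_orthonormal_basis_exists:
  "\<exists>F. orthonormal_basis hilbert_schmidt (hs_inner :: ('a::chilbert_space \<Rightarrow> 'a) \<Rightarrow> _) F"
proof -
  obtain G :: "'a hs set" where G: "onb G" using onb_exists by blast
  have "orthonormal_basis hilbert_schmidt hs_inner (hs_op ` G)"
    unfolding orthonormal_basis_def
  proof (intro conjI ballI impI)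
    show "hs_inner A B = (if A = B then 1 else 0)" if AB: "A \<in> hs_op ` G" "B \<in> hs_op ` G" for A B
    proof -
      obtain a b where ab: "A = hs_op a" "B = hs_op b" "a \<in> G" "b \<in> G" using AB by auto
      have "cinner a b = (if a = b then 1 else 0)"
        using G ab by (simp add: onb_def orthonormal_def)
      thus ?thesis using ab by (simp add: cinner_hs.rep_eq hs_op_inject)
    qed
    fix A :: "'a \<Rightarrow> 'a" assume A: "A \<in> hilbert_schmidt" "\<forall>B\<in>hs_op ` G. hs_inner B A = 0"
    hence "\<forall>B\<in>G. cinner B (Hs A) = 0" by (simp add: cinner_hs.rep_eq Hs_inverse)
    hence "Hs A = 0" using G by (simp add: onb_def)
    hence "cinner (Hs A) (Hs A) = 0" by simp
    thus "hs_inner A A = 0" using A by (simp add: cinner_hs.rep_eq Hs_inverse)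
  qed auto
  thus ?thesis by blast
qed

section \<open>The sesquilinear form of a map on the trace class\<close>

lemma linear_mapsD:
  assumes "L \<in> linear_maps"
  shows linear_maps_trace_class: "X \<in> trace_class \<Longrightarrow> L X \<in> trace_class"
    and linear_maps_add: "X \<in> trace_class \<Longrightarrow> Y \<in> trace_class \<Longrightarrow> L (\<lambda>x. X x + Y x) = (\<lambda>x. L X x + L Y x)"
    and linear_maps_scaleC: "X \<in> trace_class \<Longrightarrow> L (\<lambda>x. c *\<^sub>C X x) = (\<lambda>x. c *\<^sub>C L X x)"
    and linear_maps_undefined: "X \<notin> trace_class \<Longrightarrow> L X = undefined"
  using assms by (auto simp: linear_maps_def)

lemma bounded_maps_linear: "L \<in> bounded_maps \<Longrightarrow> L \<in> linear_maps"
  by (simp add: bounded_maps_def)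

lemma bounded_mapsE:
  assumes "L \<in> bounded_maps"
  obtains K where "K \<ge> 0" "\<And>X. X \<in> trace_class \<Longrightarrow> trace_norm (L X) \<le> K * trace_norm X"
proof -
  obtain C where C: "\<And>X. X \<in> trace_class \<Longrightarrow> trace_norm (L X) \<le> C * trace_norm X"
    using assms by (auto simp: bounded_maps_def)
  have "trace_norm (L X) \<le> max C 0 * trace_norm X" if "X \<in> trace_class" for X
    using C[OF that] mult_right_mono[of C "max C 0" "trace_norm X"] trace_norm_nonneg[OF that] by simp
  thus ?thesis by (intro that[of "max C 0"]) auto
qed

definition tc_map :: "(('a::chilbert_space \<Rightarrow> 'a) \<Rightarrow> 'a \<Rightarrow> 'a) \<Rightarrow> 'a tc \<Rightarrow> 'a tc" where
  "tc_map L X = Tc (L (tc_op X))"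

lemma tc_op_tc_map: "L \<in> linear_maps \<Longrightarrow> tc_op (tc_map L X) = L (tc_op X)"
  by (simp add: tc_map_def Tc_inverse linear_maps_trace_class)

lemma bounded_linear_tc_map:
  assumes L: "L \<in> bounded_maps"
  shows "bounded_linear (tc_map L)"
proof -
  note lL = bounded_maps_linear[OF L]
  obtain K where K: "\<And>X. X \<in> trace_class \<Longrightarrow> trace_norm (L X) \<le> K * trace_norm X"
    using bounded_mapsE[OF L] by blast
  show ?thesis
  proof (rule bounded_linear_intro[of _ K])
    show "tc_map L (X + Y) = tc_map L X + tc_map L Y" for X Y
      by (subst tc_op_inject[symmetric]) (simp add: tc_op_tc_map[OF lL] tc_op_simps linear_maps_add[OF lL])
    show "tc_map L (r *\<^sub>R X) = r *\<^sub>R tc_map L X" for r X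
      by (subst tc_op_inject[symmetric])
        (simp add: tc_op_tc_map[OF lL] tc_op_simps linear_maps_scaleC[OF lL] flip: scaleC_of_real)
    show "norm (tc_map L X) \<le> norm X * K" for X
      using K[of "tc_op X"] by (simp add: norm_tc_op tc_op_tc_map[OF lL] mult.commute)
  qed
qed

definition rank1 :: "'a::chilbert_space \<Rightarrow> 'a \<Rightarrow> 'a \<Rightarrow> 'a" where
  "rank1 u v = (\<lambda>x. cinner v x *\<^sub>C u)"

lemma rank1_in_trace_class [simp]: "rank1 u v \<in> trace_class"
  unfolding rank1_def by (rule rank1_trace_class)

lemma trace_norm_rank1: "trace_norm (rank1 u v) \<le> norm u * norm v"
  unfolding rank1_def by (rule rank1_trace_norm)

lemma adj_rank1: "adj (rank1 u v) = rank1 v u"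
  by (intro adj_eqI trace_class_bounded_clinear rank1_in_trace_class)
    (simp add: rank1_def cinner_simps cinner_commute[symmetric] mult.commute)

lemma rank1_scaleC_left: "rank1 (c *\<^sub>C u) v = (\<lambda>x. c *\<^sub>C rank1 u v x)"
  by (auto simp: rank1_def scaleC_scaleC mult.commute)

lemma hs_norm_le_trace_norm:
  assumes X: "X \<in> trace_class"
  shows "norm (Hs X) \<le> trace_norm X"
proof (rule power2_le_imp_le)
  have bX: "bounded_clinear X" by (rule trace_class_bounded_clinear[OF X])
  have "onorm X \<le> trace_norm X"
    by (intro onorm_bound trace_norm_nonneg X trace_class_norm_le)
  hence *: "onorm (adj X) \<le> trace_norm X" using onorm_adj_le[OF bX] by simp
  have "(norm (Hs X))\<^sup>2 = Re (cinner (Hs X) (Hs X))" by (simp add: cinner_self)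
  also have "\<dots> = Re (op_trace (adj X \<circ> X))"
    by (simp add: cinner_hs.rep_eq Hs_inverse trace_class_hilbert_schmidt X hs_inner_def)
  also have "\<dots> \<le> trace_norm (adj X \<circ> X)"
    using norm_op_trace_le[OF trace_class_left(1)[OF X bounded_clinear_adj[OF bX]]]
      complex_Re_le_cmod order_trans by blast
  also have "\<dots> \<le> onorm (adj X) * trace_norm X"
    by (intro trace_class_left X bounded_clinear_adj bX)
  also have "\<dots> \<le> trace_norm X * trace_norm X"
    by (intro mult_right_mono * trace_norm_nonneg X)
  finally show "(norm (Hs X))\<^sup>2 \<le> (trace_norm X)\<^sup>2" by (simp add: power2_eq_square)
qed (rule trace_norm_nonneg[OF X])

text \<open>Turns matrix coefficients into Hilbert-Schmidt inner products, so that Parseval over a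
  basis of operators can produce them.\<close>

lemma hs_inner_rank1:
  assumes X: "X \<in> hilbert_schmidt"
  shows "hs_inner (rank1 u v) X = cinner u (X v)"
proof -
  have bX: "bounded_clinear X" using X by (rule hilbert_schmidt_bounded_clinear)
  have "rank1 v u \<circ> X = rank1 v (adj X u)"
    by (auto simp: rank1_def cinner_adj_left[OF bX])
  hence "hs_inner (rank1 u v) X = op_trace (rank1 v (adj X u))" by (simp add: hs_inner_def adj_rank1)
  also have "\<dots> = cinner (adj X u) v" unfolding rank1_def by (rule rank1_trace)
  also have "\<dots> = cinner u (X v)" by (rule cinner_adj_left[OF bX])
  finally show ?thesis .
qed

lemma hs_norm_rank1: "norm (Hs (rank1 u v)) \<le> norm u * norm v"
  using hs_norm_le_trace_norm[OF rank1_in_trace_class, of u v] trace_norm_rank1[of u v] by simp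

lemma hs_inner_eq: "X \<in> hilbert_schmidt \<Longrightarrow> Y \<in> hilbert_schmidt \<Longrightarrow> hs_inner X Y = cinner (Hs X) (Hs Y)"
  by (simp add: cinner_hs.rep_eq Hs_inverse)

lemma hs_Parseval:
  assumes F: "orthonormal_basis hilbert_schmidt hs_inner F"
    and X: "X \<in> hilbert_schmidt" and Y: "Y \<in> hilbert_schmidt"
  shows "((\<lambda>G. hs_inner X G * hs_inner G Y) has_sum hs_inner X Y) F"
    and "(\<lambda>G. cmod (hs_inner X G) * cmod (hs_inner G Y)) summable_on F"
    and "(\<Sum>\<^sub>\<infinity>G\<in>F. cmod (hs_inner X G) * cmod (hs_inner G Y)) \<le> norm (Hs X) * norm (Hs Y)"
proof -
  note F' = hs_orthonormal_basis[OF F]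
  have G: "G \<in> hilbert_schmidt" if "G \<in> F" for G using F'(1) that by blast
  have "((\<lambda>G. cinner (Hs X) G * cinner G (Hs Y)) has_sum cinner (Hs X) (Hs Y)) (Hs ` F)"
    by (rule Parseval[OF F'(3)])
  hence "(((\<lambda>G. cinner (Hs X) G * cinner G (Hs Y)) \<circ> Hs) has_sum hs_inner X Y) F"
    by (simp add: has_sum_reindex[OF F'(2)] hs_inner_eq[OF X Y])
  thus "((\<lambda>G. hs_inner X G * hs_inner G Y) has_sum hs_inner X Y) F"
    by (rule has_sum_cong[THEN iffD1, rotated]) (simp add: hs_inner_eq G X Y)
  have "(\<lambda>G. cmod (cinner (Hs X) G) * cmod (cinner G (Hs Y))) summable_on Hs ` F"
    by (rule Parseval_abs(1)[OF onb_orthonormal[OF F'(3)]])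
  hence "((\<lambda>G. cmod (cinner (Hs X) G) * cmod (cinner G (Hs Y))) \<circ> Hs) summable_on F"
    by (simp add: summable_on_reindex[OF F'(2)])
  thus "(\<lambda>G. cmod (hs_inner X G) * cmod (hs_inner G Y)) summable_on F"
    by (rule summable_on_cong[THEN iffD1, rotated]) (simp add: hs_inner_eq G X Y)
  have "(\<Sum>\<^sub>\<infinity>G\<in>F. cmod (hs_inner X G) * cmod (hs_inner G Y))
      = infsum ((\<lambda>G. cmod (cinner (Hs X) G) * cmod (cinner G (Hs Y))) \<circ> Hs) F"
    by (rule infsum_cong) (simp add: hs_inner_eq G X Y)
  also have "\<dots> = (\<Sum>\<^sub>\<infinity>G\<in>Hs ` F. cmod (cinner (Hs X) G) * cmod (cinner G (Hs Y)))"
    by (rule infsum_reindex[OF F'(2), symmetric])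
  also have "\<dots> \<le> norm (Hs X) * norm (Hs Y)"
    by (rule Parseval_abs(2)[OF onb_orthonormal[OF F'(3)]])
  finally show "(\<Sum>\<^sub>\<infinity>G\<in>F. cmod (hs_inner X G) * cmod (hs_inner G Y)) \<le> norm (Hs X) * norm (Hs Y)" .
qed

section \<open>The Choi form on trace class operators\<close>

lemma bounded_linear_tc_op_apply: "bounded_linear (\<lambda>X. tc_op X x)"
  by (rule bounded_linear_intro[of _ "norm x"])
    (simp_all add: tc_op_simps norm_tc_op_apply)

lemma bounded_linear_hs_inner_tc:
  fixes G :: "'a::chilbert_space \<Rightarrow> 'a"
  assumes G: "G \<in> hilbert_schmidt"
  shows "bounded_linear (\<lambda>X. hs_inner G (tc_op X))"
proof (rule bounded_linear_intro[of _ "norm (Hs G)"])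
  have tc: "tc_op X \<in> hilbert_schmidt" for X :: "'a tc" by (intro trace_class_hilbert_schmidt) simp
  have eq: "hs_inner G (tc_op X) = cinner (Hs G) (Hs (tc_op X))" for X by (rule hs_inner_eq[OF G tc])
  have "Hs (tc_op (X + Y)) = Hs (tc_op X) + Hs (tc_op Y)" for X Y :: "'a tc"
    by (subst hs_op_inject[symmetric]) (simp add: hs_op_simps tc_op_simps Hs_inverse tc hilbert_schmidt_add)
  thus "hs_inner G (tc_op (X + Y)) = hs_inner G (tc_op X) + hs_inner G (tc_op Y)" for X Y
    by (simp add: eq cinner_simps)
  have "(\<lambda>x. r *\<^sub>R tc_op X x) \<in> hilbert_schmidt" for r and X :: "'a tc"
    using hilbert_schmidt_scaleC[OF tc, of "complex_of_real r" X] by (simp add: scaleC_of_real)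
  hence "Hs (tc_op (r *\<^sub>R X)) = r *\<^sub>R Hs (tc_op X)" for r and X :: "'a tc"
    by (subst hs_op_inject[symmetric]) (simp add: hs_op_simps tc_op_simps Hs_inverse tc)
  thus "hs_inner G (tc_op (r *\<^sub>R X)) = r *\<^sub>R hs_inner G (tc_op X)" for r X
    by (simp add: eq cinner_simps scaleR_conv_of_real)
  show "norm (hs_inner G (tc_op X)) \<le> norm X * norm (Hs G)" for X
    unfolding eq using cinner_Cauchy_Schwarz[of "Hs G" "Hs (tc_op X)"]
      mult_left_mono[OF hs_norm_le_trace_norm[of "tc_op X"] norm_ge_zero[of "Hs G"]]
    by (simp add: norm_tc_op mult.commute)
qed

text \<open>Inserting both representations writes the product as a double series of rank one
  operators with coefficients \<open>cinner (v i) (G (v' j))\<close>. It converges absolutely in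
  trace norm, so a bounded map may be applied term by term.\<close>

lemma sandwich_has_sum:
  assumes A: "nuclear_rep I u v A" and C: "nuclear_rep J u' v' C" and G: "bounded_clinear G"
  shows "((\<lambda>(i, j). Tc (rank1 (cinner (v i) (G (v' j)) *\<^sub>C u i) (u' j))) has_sum Tc (A \<circ> G \<circ> adj C)) (I \<times> J)"
proof -
  let ?f = "\<lambda>(i, j). Tc (rank1 (cinner (v i) (G (v' j)) *\<^sub>C u i) (u' j))"
  have bC: "bounded_clinear C" by (rule nuclear_rep_bounded_clinear[OF C])
  have AGC: "A \<circ> G \<circ> adj C \<in> trace_class"
    by (intro trace_class_right nuclear_rep_trace_class[OF A] G bounded_clinear_adj bC)
  have prod: "(\<lambda>(i, j). (norm (u i) * norm (v i)) * (norm (u' j) * norm (v' j))) summable_on I \<times> J"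
    by (rule summable_on_SigmaI[where g = "\<lambda>i. (norm (u i) * norm (v i)) * (\<Sum>\<^sub>\<infinity>j\<in>J. norm (u' j) * norm (v' j))"])
      (auto intro!: has_sum_cmult_right has_sum_infsum summable_on_cmult_left nuclear_rep_summable[OF A]
        nuclear_rep_summable[OF C])
  have "(\<lambda>p. norm (?f p)) summable_on I \<times> J"
  proof (rule Infinite_Sum.abs_summable_on_comparison_test'[OF summable_on_cmult_right[OF prod, of "onorm G"]])
    fix p assume "p \<in> I \<times> J"
    obtain i j where p: "p = (i, j)" by (cases p)
    have "cmod (cinner (v i) (G (v' j))) \<le> norm (v i) * (onorm G * norm (v' j))"
      using cinner_Cauchy_Schwarz[of "v i" "G (v' j)"]
        mult_left_mono[OF bounded_clinear_norm[OF G, of "v' j"] norm_ge_zero[of "v i"]] by simp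
    hence "(cmod (cinner (v i) (G (v' j))) * norm (u i)) * norm (u' j)
        \<le> ((norm (v i) * (onorm G * norm (v' j))) * norm (u i)) * norm (u' j)"
      by (intro mult_right_mono) auto
    thus "norm (?f p) \<le> onorm G * (case p of (i, j) \<Rightarrow> (norm (u i) * norm (v i)) * (norm (u' j) * norm (v' j)))"
      using trace_norm_rank1[of "cinner (v i) (G (v' j)) *\<^sub>C u i" "u' j"]
      by (simp add: p norm_tc_op Tc_inverse norm_scaleC mult_ac)
  qed
  hence s: "?f summable_on I \<times> J" by (rule abs_summable_summable)
  let ?S = "infsum ?f (I \<times> J)"
  have "tc_op ?S x = (A \<circ> G \<circ> adj C) x" for x
  proof -
    have 1: "((\<lambda>p. tc_op (?f p) x) has_sum tc_op ?S x) (I \<times> J)"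
      by (rule has_sum_bounded_linear[OF bounded_linear_tc_op_apply has_sum_infsum[OF s]])
    have 2: "((\<lambda>j. tc_op (?f (i, j)) x) has_sum (cinner (v i) (G (adj C x)) *\<^sub>C u i)) J" for i
    proof -
      have "((\<lambda>j. cinner (v i) (G (cinner (u' j) x *\<^sub>C v' j)) *\<^sub>C u i)
          has_sum (cinner (v i) (G (adj C x)) *\<^sub>C u i)) J"
        by (intro has_sum_scaleC_left has_sum_cinner_right bounded_clinear_has_sum[OF G]
            nuclear_rep_has_sum nuclear_rep_adj C)
      thus ?thesis
        by (simp add: Tc_inverse bounded_clinear_scaleC[OF G] cinner_simps)
          (simp add: rank1_def scaleC_scaleC)
    qed
    have "((\<lambda>i. cinner (v i) (G (adj C x)) *\<^sub>C u i) has_sum tc_op ?S x) I"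
      by (rule has_sum_SigmaD[OF 1 2])
    from has_sum_unique[OF this nuclear_rep_has_sum[OF A]] show ?thesis by simp
  qed
  hence "?S = Tc (A \<circ> G \<circ> adj C)"
    by (subst tc_op_inject[symmetric]) (auto simp: Tc_inverse AGC)
  thus ?thesis using has_sum_infsum[OF s] by simp
qed

text \<open>\<open>choi_form L |x><y| |x'><y'| = <y, L(|x><x'|) y'>\<close>: this is the Choi form of \<open>L\<close>, extended from
  rank one to trace class operators, where it is the trace of \<open>X \<mapsto> L (A X C\<^sup>*)\<close>. Hence the defining
  condition of \<^const>\<open>CP_on\<close> reads \<open>choi_form \<Phi> B\<^sup>* B\<^sup>* = 0\<close>.\<close>

definition choi_form ::
  "(('a::chilbert_space \<Rightarrow> 'a) \<Rightarrow> 'a \<Rightarrow> 'a) \<Rightarrow> ('a \<Rightarrow> 'a) \<Rightarrow> ('a \<Rightarrow> 'a) \<Rightarrow> complex" where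
  "choi_form L A C = hs_trace (\<lambda>X. L (A \<circ> X \<circ> adj C))"

text \<open>The very term chosen inside \<open>trace_on\<close>, so that unfolding
  \<open>hs_trace\<close> yields a sum over it.\<close>

abbreviation (input) hs_basis :: "('a::chilbert_space \<Rightarrow> 'a) set" where
  "hs_basis \<equiv> SOME F. orthonormal_basis hilbert_schmidt hs_inner F"

lemma hs_basis: "orthonormal_basis hilbert_schmidt hs_inner hs_basis"
  by (rule someI_ex[OF hs_orthonormal_basis_exists])

text \<open>Both series are iterated sums of one absolutely summable family \<open>h\<close>,
  indexed by two representations and a basis of operators. Summing over the basis is Parseval and
  gives a matrix coefficient of \<open>L (rank1 (u i) (u' j))\<close>; summing over the
  representations reassembles \<open>A \<circ> G \<circ> adj C\<close> and gives a diagonal term of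
  the trace.\<close>

lemma choi_form_has_sums:
  fixes A C :: "'a::chilbert_space \<Rightarrow> 'a"
  assumes L: "L \<in> bounded_maps" and A: "nuclear_rep I u v A" and C: "nuclear_rep J u' v' C"
  shows "((\<lambda>G. hs_inner G (L (A \<circ> G \<circ> adj C))) has_sum choi_form L A C) hs_basis"
    and "((\<lambda>(i, j). cinner (v i) (L (rank1 (u i) (u' j)) (v' j))) has_sum choi_form L A C) (I \<times> J)"
proof -
  note F = hs_basis
  note lL = bounded_maps_linear[OF L]
  obtain K where K: "K \<ge> 0" "\<And>X. X \<in> trace_class \<Longrightarrow> trace_norm (L X) \<le> K * trace_norm X"
    using bounded_mapsE[OF L] by blast
  have GF: "G \<in> hilbert_schmidt" "bounded_clinear G" if "G \<in> hs_basis" for G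
    using hs_orthonormal_basis(1)[OF F] that hilbert_schmidt_bounded_clinear by blast+
  let ?R = "\<lambda>i j. L (rank1 (u i) (u' j))"
  have R: "?R i j \<in> trace_class" for i j by (intro linear_maps_trace_class[OF lL]) simp
  have Rh: "?R i j \<in> hilbert_schmidt" for i j by (intro trace_class_hilbert_schmidt R)
  have bC: "bounded_clinear C" by (rule nuclear_rep_bounded_clinear[OF C])
  define h where "h = (\<lambda>((i, j), G). hs_inner (rank1 (v i) (v' j)) G * hs_inner G (?R i j))"
  have r1: "rank1 a b \<in> hilbert_schmidt" for a b :: 'a by (intro trace_class_hilbert_schmidt) simp
  have prod: "(\<lambda>(i, j). (norm (u i) * norm (v i)) * (norm (u' j) * norm (v' j))) summable_on I \<times> J"
    by (rule summable_on_SigmaI[where g = "\<lambda>i. (norm (u i) * norm (v i)) * (\<Sum>\<^sub>\<infinity>j\<in>J. norm (u' j) * norm (v' j))"])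
      (auto intro!: has_sum_cmult_right has_sum_infsum summable_on_cmult_left nuclear_rep_summable[OF A]
        nuclear_rep_summable[OF C])
  have Rn: "norm (Hs (?R i j)) \<le> K * (norm (u i) * norm (u' j))" for i j
    using hs_norm_le_trace_norm[OF R[of i j]] K(2)[of "rank1 (u i) (u' j)"]
      mult_left_mono[OF trace_norm_rank1[of "u i" "u' j"] K(1)] by simp
  have bnd: "norm (Hs (rank1 (v i) (v' j))) * norm (Hs (?R i j))
      \<le> K * ((norm (u i) * norm (v i)) * (norm (u' j) * norm (v' j)))" for i j
  proof -
    have "norm (Hs (rank1 (v i) (v' j))) * norm (Hs (?R i j))
        \<le> (norm (v i) * norm (v' j)) * (K * (norm (u i) * norm (u' j)))"
      by (intro mult_mono hs_norm_rank1 Rn) auto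
    thus ?thesis by (simp add: mult_ac)
  qed
  have "(\<lambda>q. norm (h q)) summable_on (I \<times> J) \<times> hs_basis"
  proof (subst Infinite_Sum.abs_summable_on_Sigma_iff, intro conjI ballI)
    fix p assume "p \<in> I \<times> J"
    obtain i j where p: "p = (i, j)" by (cases p)
    show "(\<lambda>G. norm (h (p, G))) summable_on hs_basis"
      using hs_Parseval(2)[OF F r1[of "v i" "v' j"] Rh[of i j]] by (simp add: h_def p norm_mult)
  next
    show "(\<lambda>p. norm (\<Sum>\<^sub>\<infinity>G\<in>hs_basis. norm (h (p, G)))) summable_on I \<times> J"
    proof (rule Infinite_Sum.abs_summable_on_comparison_test'[OF summable_on_cmult_right[OF prod, of K]])
      fix p assume "p \<in> I \<times> J"
      obtain i j where p: "p = (i, j)" by (cases p)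
      have "(\<Sum>\<^sub>\<infinity>G\<in>hs_basis. norm (h (p, G))) \<le> norm (Hs (rank1 (v i) (v' j))) * norm (Hs (?R i j))"
        using hs_Parseval(3)[OF F r1[of "v i" "v' j"] Rh[of i j]] by (simp add: h_def p norm_mult)
      with bnd[of i j] show "norm (\<Sum>\<^sub>\<infinity>G\<in>hs_basis. norm (h (p, G)))
          \<le> K * (case p of (i, j) \<Rightarrow> (norm (u i) * norm (v i)) * (norm (u' j) * norm (v' j)))"
        by (simp add: p infsum_nonneg)
    qed
  qed
  hence sh: "h summable_on (I \<times> J) \<times> hs_basis" by (rule abs_summable_summable)
  have in1: "((\<lambda>G. h ((i, j), G)) has_sum cinner (v i) (?R i j (v' j))) hs_basis" for i j
    using hs_Parseval(1)[OF F r1 Rh] by (simp add: h_def hs_inner_rank1[OF Rh])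
  have in2: "((\<lambda>p. h (p, G)) has_sum hs_inner G (L (A \<circ> G \<circ> adj C))) (I \<times> J)" if G: "G \<in> hs_basis" for G
  proof -
    have AGC: "A \<circ> G \<circ> adj C \<in> trace_class"
      by (intro trace_class_right nuclear_rep_trace_class[OF A] GF[OF G] bounded_clinear_adj bC)
    have "bounded_linear (\<lambda>X. hs_inner G (tc_op (tc_map L X)))"
      by (rule bounded_linear_compose[OF bounded_linear_hs_inner_tc[OF GF(1)[OF G]] bounded_linear_tc_map[OF L]])
    from has_sum_bounded_linear[OF this sandwich_has_sum[OF A C GF(2)[OF G]]]
    have *: "((\<lambda>p. hs_inner G (L (tc_op (case p of (i, j) \<Rightarrow> Tc (rank1 (cinner (v i) (G (v' j)) *\<^sub>C u i) (u' j))))))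
        has_sum hs_inner G (L (A \<circ> G \<circ> adj C))) (I \<times> J)"
      by (simp add: tc_op_tc_map[OF lL] Tc_inverse AGC)
    have sc: "hs_inner G (\<lambda>x. c *\<^sub>C ?R i j x) = c * hs_inner G (?R i j)" for c i j
    proof -
      have "Hs (\<lambda>x. c *\<^sub>C ?R i j x) = c *\<^sub>C Hs (?R i j)"
        by (subst hs_op_inject[symmetric]) (simp add: scaleC_hs.rep_eq Hs_inverse Rh hilbert_schmidt_scaleC)
      thus ?thesis by (simp add: hs_inner_eq GF[OF G] Rh hilbert_schmidt_scaleC cinner_simps)
    qed
    show ?thesis
    proof (rule has_sum_cong[THEN iffD1, OF _ *])
      fix p assume "p \<in> I \<times> J"
      obtain i j where p: "p = (i, j)" by (cases p)
      show "hs_inner G (L (tc_op (case p of (i, j) \<Rightarrow> Tc (rank1 (cinner (v i) (G (v' j)) *\<^sub>C u i) (u' j)))))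
          = h (p, G)"
        by (simp add: p h_def Tc_inverse rank1_scaleC_left[of _ "u i"] trace_class_scaleC(1) linear_maps_scaleC[OF lL] sc
            hs_inner_rank1[OF GF(1)[OF G]])
    qed
  qed
  let ?S = "infsum h ((I \<times> J) \<times> hs_basis)"
  have S1: "((\<lambda>p. case p of (i, j) \<Rightarrow> cinner (v i) (?R i j (v' j))) has_sum ?S) (I \<times> J)"
    by (rule has_sum_SigmaD[OF has_sum_infsum[OF sh]]) (use in1 in auto)
  have S2: "((\<lambda>G. hs_inner G (L (A \<circ> G \<circ> adj C))) has_sum ?S) hs_basis"
  proof (rule has_sum_SigmaD)
    show "((\<lambda>(G, p). h (p, G)) has_sum ?S) (hs_basis \<times> (I \<times> J))"
      using has_sum_infsum[OF sh] by (subst (asm) has_sum_swap)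
  qed (use in2 in simp)
  have S: "?S = choi_form L A C"
    unfolding choi_form_def trace_on_def by (rule infsumI[OF S2, symmetric])
  show "((\<lambda>G. hs_inner G (L (A \<circ> G \<circ> adj C))) has_sum choi_form L A C) hs_basis"
    using S2 unfolding S .
  show "((\<lambda>(i, j). cinner (v i) (?R i j (v' j))) has_sum choi_form L A C) (I \<times> J)"
    using S1 unfolding S .
qed

lemma choi_form_basis:
  fixes A C :: "'a::chilbert_space \<Rightarrow> 'a"
  assumes L: "L \<in> bounded_maps" and A: "A \<in> trace_class" and C: "C \<in> trace_class"
  shows "((\<lambda>G. hs_inner G (L (A \<circ> G \<circ> adj C))) has_sum choi_form L A C) hs_basis"
proof -
  obtain E :: "'a set" and u v where r: "nuclear_rep E u v A" by (rule trace_class_nuclear[OF A])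
  obtain E' :: "'a set" and u' v' where r': "nuclear_rep E' u' v' C" by (rule trace_class_nuclear[OF C])
  show ?thesis by (rule choi_form_has_sums(1)[OF L r r'])
qed

lemma choi_form_bound:
  fixes A C :: "'a::chilbert_space \<Rightarrow> 'a"
  assumes L: "L \<in> bounded_maps" and A: "A \<in> trace_class" and C: "C \<in> trace_class"
    and K: "K \<ge> 0" "\<And>X. X \<in> trace_class \<Longrightarrow> trace_norm (L X) \<le> K * trace_norm X"
  shows "cmod (choi_form L A C) \<le> K * trace_norm A * trace_norm C"
proof -
  obtain E :: "'a set" and u v where r: "nuclear_rep E u v A"
    "(\<Sum>\<^sub>\<infinity>e\<in>E. norm (u e) * norm (v e)) = trace_norm A" by (rule trace_class_nuclear[OF A])
  obtain E' :: "'a set" and u' v' where r': "nuclear_rep E' u' v' C"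
    "(\<Sum>\<^sub>\<infinity>e\<in>E'. norm (u' e) * norm (v' e)) = trace_norm C" by (rule trace_class_nuclear[OF C])
  have hC: "((\<lambda>j. norm (u' j) * norm (v' j)) has_sum trace_norm C) E'"
    using has_sum_infsum[OF nuclear_rep_summable[OF r'(1)]] r'(2) by simp
  have hA: "((\<lambda>i. norm (u i) * norm (v i)) has_sum trace_norm A) E"
    using has_sum_infsum[OF nuclear_rep_summable[OF r(1)]] r(2) by simp
  have "((\<lambda>(i, j). K * ((norm (u i) * norm (v i)) * (norm (u' j) * norm (v' j))))
      has_sum K * (trace_norm A * trace_norm C)) (E \<times> E')"
  proof (rule has_sum_SigmaI)
    show "((\<lambda>j. case (i, j) of (i, j) \<Rightarrow> K * ((norm (u i) * norm (v i)) * (norm (u' j) * norm (v' j))))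
        has_sum K * ((norm (u i) * norm (v i)) * trace_norm C)) E'" for i
      by (simp only: prod.case) (intro has_sum_cmult_right hC)
    show out: "((\<lambda>i. K * ((norm (u i) * norm (v i)) * trace_norm C)) has_sum K * (trace_norm A * trace_norm C)) E"
      by (intro has_sum_cmult_right has_sum_cmult_left hA)
    show "(\<lambda>(i, j). K * ((norm (u i) * norm (v i)) * (norm (u' j) * norm (v' j)))) summable_on E \<times> E'"
    proof (rule summable_on_SigmaI[OF _ has_sum_imp_summable[OF out]])
      show "((\<lambda>j. case (i, j) of (i, j) \<Rightarrow> K * ((norm (u i) * norm (v i)) * (norm (u' j) * norm (v' j))))
        has_sum K * ((norm (u i) * norm (v i)) * trace_norm C)) E'" for i
        by (simp only: prod.case) (intro has_sum_cmult_right hC)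
    qed (use K(1) in auto)
  qed
  hence "cmod (choi_form L A C) \<le> K * (trace_norm A * trace_norm C)"
  proof (rule norm_infsum_le[OF choi_form_has_sums(2)[OF L r(1) r'(1)]])
    fix p assume "p \<in> E \<times> E'"
    obtain i j where p: "p = (i, j)" by (cases p)
    let ?R = "L (rank1 (u i) (u' j))"
    have R: "?R \<in> trace_class" by (intro linear_maps_trace_class[OF bounded_maps_linear[OF L]]) simp
    have "cmod (cinner (v i) (?R (v' j))) \<le> norm (v i) * norm (?R (v' j))" by (rule cinner_Cauchy_Schwarz)
    also have "\<dots> \<le> norm (v i) * (trace_norm ?R * norm (v' j))"
      by (intro mult_left_mono trace_class_norm_le R) simp
    also have "\<dots> \<le> norm (v i) * ((K * (norm (u i) * norm (u' j))) * norm (v' j))"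
      using order_trans[OF K(2) mult_left_mono[OF trace_norm_rank1 K(1)], OF rank1_in_trace_class]
      by (intro mult_left_mono mult_right_mono) auto
    finally show "cmod (case p of (i, j) \<Rightarrow> cinner (v i) (L (rank1 (u i) (u' j)) (v' j)))
        \<le> (case p of (i, j) \<Rightarrow> K * ((norm (u i) * norm (v i)) * (norm (u' j) * norm (v' j))))"
      by (simp add: p mult_ac)
  qed
  thus ?thesis by (simp add: mult.assoc)
qed

lemma hs_inner_add_right:
  assumes "X \<in> hilbert_schmidt" "Y \<in> hilbert_schmidt" "Z \<in> hilbert_schmidt"
  shows "hs_inner X (\<lambda>x. Y x + Z x) = hs_inner X Y + hs_inner X Z"
proof -
  have "Hs (\<lambda>x. Y x + Z x) = Hs Y + Hs Z"
    by (subst hs_op_inject[symmetric]) (simp add: hs_op_simps Hs_inverse assms hilbert_schmidt_add)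
  thus ?thesis by (simp add: hs_inner_eq assms hilbert_schmidt_add cinner_simps)
qed

lemma hs_inner_scaleC_right:
  assumes "X \<in> hilbert_schmidt" "Y \<in> hilbert_schmidt"
  shows "hs_inner X (\<lambda>x. c *\<^sub>C Y x) = c * hs_inner X Y"
proof -
  have "Hs (\<lambda>x. c *\<^sub>C Y x) = c *\<^sub>C Hs Y"
    by (subst hs_op_inject[symmetric]) (simp add: scaleC_hs.rep_eq Hs_inverse assms hilbert_schmidt_scaleC)
  thus ?thesis by (simp add: hs_inner_eq assms hilbert_schmidt_scaleC cinner_simps)
qed

lemma sandwich_trace_class:
  assumes "A \<in> trace_class" "C \<in> trace_class" "bounded_clinear G"
  shows "A \<circ> G \<circ> adj C \<in> trace_class"
  by (intro trace_class_right assms bounded_clinear_adj trace_class_bounded_clinear)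

text \<open>Checked on each diagonal term of the trace over the fixed basis. The second argument
  enters through its adjoint, hence conjugate linearly.\<close>

lemma choi_form_lin:
  fixes A C D :: "'a::chilbert_space \<Rightarrow> 'a"
  assumes L: "L \<in> bounded_maps" and A: "A \<in> trace_class" and D: "D \<in> trace_class" and C: "C \<in> trace_class"
  shows choi_form_add_left: "choi_form L (\<lambda>x. A x + D x) C = choi_form L A C + choi_form L D C"
    and choi_form_scaleC_left: "choi_form L (\<lambda>x. c *\<^sub>C A x) C = c * choi_form L A C"
    and choi_form_add_right: "choi_form L C (\<lambda>x. A x + D x) = choi_form L C A + choi_form L C D"
    and choi_form_scaleC_right: "choi_form L C (\<lambda>x. c *\<^sub>C A x) = cnj c * choi_form L C A"
proof -
  note lL = bounded_maps_linear[OF L]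
  have GF: "G \<in> hilbert_schmidt" "bounded_clinear G" if "G \<in> hs_basis" for G :: "'a \<Rightarrow> 'a"
    using hs_orthonormal_basis(1)[OF hs_basis] that hilbert_schmidt_bounded_clinear by blast+
  note bA = trace_class_bounded_clinear[OF A] and bD = trace_class_bounded_clinear[OF D]
    and bC = trace_class_bounded_clinear[OF C]
  have hs: "L X \<in> hilbert_schmidt" if "X \<in> trace_class" for X
    by (intro trace_class_hilbert_schmidt linear_maps_trace_class[OF lL] that)
  note T = sandwich_trace_class[OF A C] sandwich_trace_class[OF D C] sandwich_trace_class[OF C A]
    sandwich_trace_class[OF C D]
  show "choi_form L (\<lambda>x. A x + D x) C = choi_form L A C + choi_form L D C"
  proof (rule has_sum_eqI[OF choi_form_basis[OF L trace_class_add(1)[OF A D] C]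
        has_sum_add[OF choi_form_basis[OF L A C] choi_form_basis[OF L D C]]])
    fix G :: "'a \<Rightarrow> 'a" assume "G \<in> hs_basis" note G = GF[OF this]
    have "(\<lambda>x. A x + D x) \<circ> G \<circ> adj C = (\<lambda>x. (A \<circ> G \<circ> adj C) x + (D \<circ> G \<circ> adj C) x)" by auto
    thus "hs_inner G (L ((\<lambda>x. A x + D x) \<circ> G \<circ> adj C)) =
        hs_inner G (L (A \<circ> G \<circ> adj C)) + hs_inner G (L (D \<circ> G \<circ> adj C))"
      by (simp only: linear_maps_add[OF lL] hs_inner_add_right hs T G)
  qed
  show "choi_form L (\<lambda>x. c *\<^sub>C A x) C = c * choi_form L A C"
  proof (rule has_sum_eqI[OF choi_form_basis[OF L trace_class_scaleC(1)[OF A] C]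
        has_sum_cmult_right[OF choi_form_basis[OF L A C]]])
    fix G :: "'a \<Rightarrow> 'a" assume "G \<in> hs_basis" note G = GF[OF this]
    have "(\<lambda>x. c *\<^sub>C A x) \<circ> G \<circ> adj C = (\<lambda>x. c *\<^sub>C (A \<circ> G \<circ> adj C) x)" by auto
    thus "hs_inner G (L ((\<lambda>x. c *\<^sub>C A x) \<circ> G \<circ> adj C)) = c * hs_inner G (L (A \<circ> G \<circ> adj C))"
      by (simp only: linear_maps_scaleC[OF lL] hs_inner_scaleC_right hs T G)
  qed
  show "choi_form L C (\<lambda>x. A x + D x) = choi_form L C A + choi_form L C D"
  proof (rule has_sum_eqI[OF choi_form_basis[OF L C trace_class_add(1)[OF A D]]
        has_sum_add[OF choi_form_basis[OF L C A] choi_form_basis[OF L C D]]])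
    fix G :: "'a \<Rightarrow> 'a" assume "G \<in> hs_basis" note G = GF[OF this]
    have "C \<circ> G \<circ> adj (\<lambda>x. A x + D x) = (\<lambda>x. (C \<circ> G \<circ> adj A) x + (C \<circ> G \<circ> adj D) x)"
      by (auto simp: adj_plus bA bD bounded_clinear_add[OF G(2)] bounded_clinear_add[OF bC])
    thus "hs_inner G (L (C \<circ> G \<circ> adj (\<lambda>x. A x + D x))) =
        hs_inner G (L (C \<circ> G \<circ> adj A)) + hs_inner G (L (C \<circ> G \<circ> adj D))"
      by (simp only: linear_maps_add[OF lL] hs_inner_add_right hs T G)
  qed
  show "choi_form L C (\<lambda>x. c *\<^sub>C A x) = cnj c * choi_form L C A"
  proof (rule has_sum_eqI[OF choi_form_basis[OF L C trace_class_scaleC(1)[OF A]]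
        has_sum_cmult_right[OF choi_form_basis[OF L C A]]])
    fix G :: "'a \<Rightarrow> 'a" assume "G \<in> hs_basis" note G = GF[OF this]
    have "C \<circ> G \<circ> adj (\<lambda>x. c *\<^sub>C A x) = (\<lambda>x. cnj c *\<^sub>C (C \<circ> G \<circ> adj A) x)"
      by (auto simp: adj_smult bA bounded_clinear_scaleC[OF G(2)] bounded_clinear_scaleC[OF bC])
    thus "hs_inner G (L (C \<circ> G \<circ> adj (\<lambda>x. c *\<^sub>C A x))) = cnj c * hs_inner G (L (C \<circ> G \<circ> adj A))"
      by (simp only: linear_maps_scaleC[OF lL] hs_inner_scaleC_right hs T G)
  qed
qed

lemma choi_form_plus:
  fixes A C :: "'a::chilbert_space \<Rightarrow> 'a"
  assumes L: "L \<in> bounded_maps" "M \<in> bounded_maps" "N \<in> bounded_maps"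
    and eq: "\<And>X. X \<in> trace_class \<Longrightarrow> N X = (\<lambda>x. L X x + M X x)"
    and A: "A \<in> trace_class" and C: "C \<in> trace_class"
  shows "choi_form N A C = choi_form L A C + choi_form M A C"
proof (rule has_sum_eqI[OF choi_form_basis[OF L(3) A C]
      has_sum_add[OF choi_form_basis[OF L(1) A C] choi_form_basis[OF L(2) A C]]])
  fix G :: "'a \<Rightarrow> 'a" assume "G \<in> hs_basis"
  hence G: "G \<in> hilbert_schmidt" "bounded_clinear G"
    using hs_orthonormal_basis(1)[OF hs_basis] hilbert_schmidt_bounded_clinear by blast+
  note T = sandwich_trace_class[OF A C G(2)]
  have "L X \<in> hilbert_schmidt" "M X \<in> hilbert_schmidt" if "X \<in> trace_class" for X
    using linear_maps_trace_class[OF bounded_maps_linear[OF L(1)] that]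
      linear_maps_trace_class[OF bounded_maps_linear[OF L(2)] that]
    by (auto intro: trace_class_hilbert_schmidt)
  thus "hs_inner G (N (A \<circ> G \<circ> adj C)) = hs_inner G (L (A \<circ> G \<circ> adj C)) + hs_inner G (M (A \<circ> G \<circ> adj C))"
    by (simp only: eq[OF T] hs_inner_add_right G T)
qed

lemma choi_form_rank1:
  assumes "L \<in> bounded_maps"
  shows "choi_form L (rank1 x y) (rank1 x' y') = cinner y (L (rank1 x x') y')"
  using choi_form_has_sums(2)[OF assms nuclear_rep_rank1[where u = x and v = y]
      nuclear_rep_rank1[where u = x' and v = y']]
  by (simp add: has_sum_finite_iff rank1_def)

lemma trace_nuclear_has_sum:
  fixes A :: "'a::chilbert_space \<Rightarrow> 'a"
  assumes "nuclear_rep I u v A"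
  shows "((\<lambda>i. cinner (v i) (u i)) has_sum op_trace A) I"
proof -
  obtain E :: "'a set" where E: "onb E" using onb_exists by blast
  show ?thesis unfolding op_trace_nuclear[OF assms]
    by (rule has_sum_infsum[OF abs_summable_summable[OF nuclear_trace(2)[OF assms E]]])
qed

section \<open>The Lyapunov part of a generator\<close>

definition lyapunov_map :: "('a::chilbert_space \<Rightarrow> 'a) \<Rightarrow> ('a \<Rightarrow> 'a) \<Rightarrow> 'a \<Rightarrow> 'a" where
  "lyapunov_map K = (\<lambda>X\<in>trace_class. \<lambda>x. K (X x) + X (adj K x))"

lemma lyapunov_map_bounded:
  assumes K: "bounded_clinear K"
  shows "lyapunov_map K \<in> bounded_maps"
proof -
  note aK = bounded_clinear_adj[OF K]
  have cm: "lyapunov_map K X = (\<lambda>x. (K \<circ> X) x + (X \<circ> adj K) x)" if "X \<in> trace_class" for X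
    using that by (simp add: lyapunov_map_def)
  have tc: "lyapunov_map K X \<in> trace_class" if "X \<in> trace_class" for X
    unfolding cm[OF that] by (intro trace_class_add trace_class_left trace_class_right that K aK)
  have "lyapunov_map K \<in> linear_maps"
    unfolding linear_maps_def
  proof (intro CollectI conjI ballI allI)
    show "lyapunov_map K \<in> trace_class \<rightarrow>\<^sub>E trace_class"
      using tc by (auto simp: lyapunov_map_def PiE_def)
    fix X :: "'a \<Rightarrow> 'a" assume X: "X \<in> trace_class"
    show "lyapunov_map K (\<lambda>x. X x + Y x) = (\<lambda>x. lyapunov_map K X x + lyapunov_map K Y x)"
      if "Y \<in> trace_class" for Y
      using X that by (auto simp: lyapunov_map_def trace_class_add bounded_clinear_add[OF K])
    show "lyapunov_map K (\<lambda>x. c *\<^sub>C X x) = (\<lambda>x. c *\<^sub>C lyapunov_map K X x)" for c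
      using X by (auto simp: lyapunov_map_def trace_class_scaleC bounded_clinear_scaleC[OF K] scaleC_add_right)
  qed
  moreover have "trace_norm (lyapunov_map K X) \<le> (onorm K + onorm (adj K)) * trace_norm X"
    if X: "X \<in> trace_class" for X
  proof -
    have "trace_norm (lyapunov_map K X) \<le> trace_norm (K \<circ> X) + trace_norm (X \<circ> adj K)"
      unfolding cm[OF X] by (intro trace_class_add trace_class_left trace_class_right X K aK)
    also have "\<dots> \<le> onorm K * trace_norm X + onorm (adj K) * trace_norm X"
      by (intro add_mono trace_class_left trace_class_right X K aK)
    finally show ?thesis by (simp add: distrib_right)
  qed
  ultimately show ?thesis by (auto simp: bounded_maps_def)
qed

text \<open>On rank one operators each of the two summands is a product of a factor depending on the
  first argument and one depending on the second, so the double series factorises into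
  traces.\<close>

lemma choi_form_lyapunov_map:
  fixes A C :: "'a::chilbert_space \<Rightarrow> 'a"
  assumes K: "bounded_clinear K" and A: "A \<in> trace_class" and C: "C \<in> trace_class"
  shows "choi_form (lyapunov_map K) A C =
    op_trace (K \<circ> A) * cnj (op_trace C) + op_trace A * cnj (op_trace (K \<circ> C))"
proof -
  obtain E :: "'a set" and u v where r: "nuclear_rep E u v A" by (rule trace_class_nuclear[OF A])
  obtain E' :: "'a set" and u' v' where r': "nuclear_rep E' u' v' C" by (rule trace_class_nuclear[OF C])
  have val: "cinner y (lyapunov_map K (rank1 x x') y')
      = cinner y (K x) * cinner x' y' + cinner y x * cinner (K x') y'" for x y x' y'
    by (simp add: lyapunov_map_def) (simp add: rank1_def bounded_clinear_scaleC[OF K] cinner_simps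
        cinner_adj_right[OF K] mult.commute)
  have cj: "((\<lambda>j. cinner (u' j) (v' j)) has_sum cnj (op_trace C)) E'"
    "((\<lambda>j. cinner (K (u' j)) (v' j)) has_sum cnj (op_trace (K \<circ> C))) E'"
    using has_sum_cnj_iff[THEN iffD2, OF trace_nuclear_has_sum[OF r']]
      has_sum_cnj_iff[THEN iffD2, OF trace_nuclear_has_sum[OF nuclear_rep_left[OF r' K]]]
    by (simp_all only: cinner_commute[symmetric])
  have 1: "((\<lambda>i. cinner (v i) (K (u i)) * cnj (op_trace C) + cinner (v i) (u i) * cnj (op_trace (K \<circ> C)))
      has_sum choi_form (lyapunov_map K) A C) E"
  proof (rule has_sum_SigmaD[OF choi_form_has_sums(2)[OF lyapunov_map_bounded[OF K] r r']])
    show "((\<lambda>j. case (i, j) of (i, j) \<Rightarrow> cinner (v i) (lyapunov_map K (rank1 (u i) (u' j)) (v' j)))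
       has_sum cinner (v i) (K (u i)) * cnj (op_trace C) + cinner (v i) (u i) * cnj (op_trace (K \<circ> C))) E'" for i
      unfolding prod.case val by (intro has_sum_add has_sum_cmult_right cj)
  qed
  have 2: "((\<lambda>i. cinner (v i) (K (u i)) * cnj (op_trace C) + cinner (v i) (u i) * cnj (op_trace (K \<circ> C)))
      has_sum op_trace (K \<circ> A) * cnj (op_trace C) + op_trace A * cnj (op_trace (K \<circ> C))) E"
    by (intro has_sum_add has_sum_cmult_left trace_nuclear_has_sum[OF r]
        trace_nuclear_has_sum[OF nuclear_rep_left[OF r K]])
  show ?thesis by (rule has_sum_unique[OF 1 2])
qed

section \<open>Completely positive maps\<close>

lemma CP_linear: "\<Phi> \<in> CP \<Longrightarrow> \<Phi> \<in> linear_maps"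
  by (simp add: CP_def)

lemma CP_block_positive:
  assumes "\<Phi> \<in> CP" "\<And>i j. i < n \<Longrightarrow> j < n \<Longrightarrow> X i j \<in> trace_class" "block_positive n X"
  shows "block_positive n (\<lambda>i j. \<Phi> (X i j))"
  using assms by (simp add: CP_def)

lemma nonneg_Reals_iff: "z \<in> \<real>\<^sub>\<ge>\<^sub>0 \<longleftrightarrow> Im z = 0 \<and> Re z \<ge> 0"
  by (auto simp: complex_nonneg_Reals_iff)

lemma tendsto_nonneg_Reals:
  fixes z :: complex
  assumes "(f \<longlongrightarrow> z) F" "F \<noteq> bot" "\<And>x. f x \<in> \<real>\<^sub>\<ge>\<^sub>0"
  shows "z \<in> \<real>\<^sub>\<ge>\<^sub>0"
proof (rule Lim_in_closed_set)
  show "closed (\<real>\<^sub>\<ge>\<^sub>0 :: complex set)" by (rule closed_nonneg_Reals_complex)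
  show "\<forall>\<^sub>F x in F. f x \<in> \<real>\<^sub>\<ge>\<^sub>0" by (simp add: assms(3))
qed (rule assms)+

text \<open>Upgrades the pointwise sum in \<open>nuclear_rep\<close> to convergence in trace norm,
  so that continuous maps can be evaluated through rank one operators.\<close>

lemma tc_has_sum:
  assumes "nuclear_rep I u v A"
  shows "((\<lambda>i. Tc (rank1 (u i) (v i))) has_sum Tc A) I"
proof -
  have A: "A \<in> trace_class" by (rule nuclear_rep_trace_class[OF assms])
  have n: "norm (Tc (rank1 (u i) (v i))) \<le> norm (u i) * norm (v i)" for i
    using trace_norm_rank1[of "u i" "v i"] by (simp add: norm_tc_op Tc_inverse)
  have s: "(\<lambda>i. Tc (rank1 (u i) (v i))) summable_on I"
    by (rule abs_summable_summable, rule Infinite_Sum.abs_summable_on_comparison_test'[OF nuclear_rep_summable[OF assms] n])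
  have "tc_op (\<Sum>\<^sub>\<infinity>i\<in>I. Tc (rank1 (u i) (v i))) x = A x" for x
  proof (rule has_sum_eqI)
    show "((\<lambda>i. tc_op (Tc (rank1 (u i) (v i))) x) has_sum tc_op (\<Sum>\<^sub>\<infinity>i\<in>I. Tc (rank1 (u i) (v i))) x) I"
      by (rule has_sum_bounded_linear[OF bounded_linear_tc_op_apply has_sum_infsum[OF s]])
    show "((\<lambda>i. cinner (v i) x *\<^sub>C u i) has_sum A x) I" by (rule nuclear_rep_has_sum[OF assms])
  qed (simp add: Tc_inverse, simp add: rank1_def)
  hence "(\<Sum>\<^sub>\<infinity>i\<in>I. Tc (rank1 (u i) (v i))) = Tc A"
    by (subst tc_op_inject[symmetric]) (auto simp: Tc_inverse A)
  thus ?thesis using has_sum_infsum[OF s] by simp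
qed

section \<open>Automatic boundedness of completely positive maps\<close>

lemma positive_trace:
  fixes A :: "'a::chilbert_space \<Rightarrow> 'a"
  assumes A: "A \<in> trace_class" and P: "positive_op A"
  shows "trace_norm A = Re (op_trace A)"
proof -
  note bA = trace_class_bounded_clinear[OF A]
  have "adj A = A" using positive_op_selfadjoint[OF P] by (intro adj_eqI bA)
  hence "abs_op A = A"
    using positive_op_sqrt_unique[OF positive_abs_op[OF bA] abs_op_square[OF bA] P] by simp
  thus ?thesis by (simp add: trace_norm_def)
qed

lemma op_trace_mono:
  fixes A B :: "'a::chilbert_space \<Rightarrow> 'a"
  assumes A: "A \<in> trace_class" and B: "B \<in> trace_class"
    and le: "\<And>x. Re (cinner x (A x)) \<le> Re (cinner x (B x))"
  shows "Re (op_trace A) \<le> Re (op_trace B)"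
proof -
  obtain E :: "'a set" where E: "onb E" using onb_exists by blast
  show ?thesis
    by (rule has_sum_mono[OF has_sum_Re[OF op_trace_onb[OF A E]] has_sum_Re[OF op_trace_onb[OF B E]] le])
qed

lemma CP_positive:
  assumes \<Phi>: "\<Phi> \<in> CP" and X: "X \<in> trace_class" "positive_op X"
  shows "positive_op (\<Phi> X)"
proof -
  have "block_positive 1 (\<lambda>i j. X)" using X(2) by (simp add: block_positive_def positive_op_def)
  hence "block_positive 1 (\<lambda>i j. \<Phi> X)" using CP_block_positive[OF \<Phi>, of 1 "\<lambda>i j. X"] X(1) by simp
  hence *: "(\<Sum>i<1. cinner (x i) (\<Sum>j<1. \<Phi> X (x j))) \<in> \<real>\<^sub>\<ge>\<^sub>0" for x :: "nat \<Rightarrow> 'a"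
    unfolding block_positive_def by blast
  have "cinner x (\<Phi> X x) \<in> \<real>\<^sub>\<ge>\<^sub>0" for x using *[of "\<lambda>_. x"] by simp
  moreover have "bounded_clinear (\<Phi> X)"
    by (intro trace_class_bounded_clinear linear_maps_trace_class[OF CP_linear[OF \<Phi>]] X)
  ultimately show ?thesis by (simp add: positive_op_def)
qed

lemma positive_op_diff:
  assumes "bounded_clinear A" "bounded_clinear B"
    and "\<And>x. Im (cinner x (A x)) = 0" "\<And>x. Im (cinner x (B x)) = 0"
    and "\<And>x. Re (cinner x (B x)) \<le> Re (cinner x (A x))"
  shows "positive_op (\<lambda>x. A x - B x)"
  using assms by (auto simp: positive_op_iff cinner_diff_right bounded_clinear_minus)

text \<open>Boundedness on the positive cone: otherwise a norm-convergent sum of positive operators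
  with rapidly growing images would have an image of infinite trace.\<close>

lemma CP_bounded_positive:
  fixes \<Phi> :: "('a::chilbert_space \<Rightarrow> 'a) \<Rightarrow> 'a \<Rightarrow> 'a"
  assumes \<Phi>: "\<Phi> \<in> CP"
  shows "\<exists>M\<ge>0. \<forall>X\<in>trace_class. positive_op X \<longrightarrow> trace_norm (\<Phi> X) \<le> M * trace_norm X"
proof (rule ccontr)
  note l\<Phi> = CP_linear[OF \<Phi>]
  assume unbdd: "\<not> ?thesis"
  have "\<exists>X. X \<in> trace_class \<and> positive_op X \<and> trace_norm (\<Phi> X) > 4 ^ n * trace_norm X" for n :: nat
  proof -
    have "(0::real) \<le> 4 ^ n" by simp
    hence "\<not> (\<forall>X\<in>trace_class. positive_op X \<longrightarrow> trace_norm (\<Phi> X) \<le> 4 ^ n * trace_norm X)"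
      using unbdd by blast
    thus ?thesis by (auto simp: not_le)
  qed
  then obtain X where X: "\<And>n::nat. X n \<in> trace_class" "\<And>n. positive_op (X n)"
    "\<And>n. trace_norm (\<Phi> (X n)) > 4 ^ n * trace_norm (X n)" by metis
  have pos: "trace_norm (X n) > 0" for n
  proof (rule ccontr)
    assume "\<not> ?thesis"
    hence "trace_norm (X n) = 0" using trace_norm_nonneg[OF X(1)[of n]] by simp
    moreover from this have "X n = (\<lambda>x. 0)" by (rule trace_norm_eq_zero[OF X(1)])
    moreover have "\<Phi> (\<lambda>x. 0) = (\<lambda>x. 0)"
      using linear_maps_scaleC[OF l\<Phi> trace_class_zero, of 0] by simp
    ultimately show False using X(3)[of n] by (simp add: trace_norm_zero)
  qed
  \<comment> \<open>The factor \<open>4 ^ n\<close> is split evenly: the rescaled operators have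
    trace norm \<open>(1/2) ^ n\<close>, which is summable, while their images keep trace norm at
    least \<open>2 ^ n\<close>.\<close>
  define r where "r n = 1 / (2 ^ n * trace_norm (X n))" for n
  have r: "r n > 0" for n using pos[of n] by (simp add: r_def)
  define Y where "Y n = (\<lambda>x. complex_of_real (r n) *\<^sub>C X n x)" for n
  have Ytc: "Y n \<in> trace_class" for n unfolding Y_def by (intro trace_class_scaleC X)
  have Yp: "positive_op (Y n)" for n unfolding Y_def using r[of n] by (intro positive_op_scaleR X) simp
  have Yn: "trace_norm (Y n) = (1/2) ^ n" for n
  proof -
    have "trace_norm (Y n) = r n * trace_norm (X n)"
      unfolding Y_def trace_class_scaleC(2)[OF X(1)] using r[of n] by simp
    thus ?thesis using pos[of n] by (simp add: r_def power_one_over)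
  qed
  have Y\<Phi>: "trace_norm (\<Phi> (Y n)) \<ge> 2 ^ n" for n
  proof -
    have "\<Phi> (Y n) = (\<lambda>x. complex_of_real (r n) *\<^sub>C \<Phi> (X n) x)"
      unfolding Y_def by (rule linear_maps_scaleC[OF l\<Phi> X(1)])
    hence "trace_norm (\<Phi> (Y n)) = r n * trace_norm (\<Phi> (X n))"
      using r[of n] by (simp add: trace_class_scaleC(2) linear_maps_trace_class[OF l\<Phi> X(1)])
    also have "\<dots> \<ge> r n * (4 ^ n * trace_norm (X n))"
      using r[of n] X(3)[of n] by (intro mult_left_mono) auto
    also have "r n * (4 ^ n * trace_norm (X n)) = 4 ^ n / 2 ^ n" using pos[of n] by (simp add: r_def)
    also have "(4::real) ^ n / 2 ^ n = 2 ^ n" by (simp add: power_divide[symmetric])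
    finally show ?thesis .
  qed
  have "summable (\<lambda>n. norm (Tc (Y n)))"
    by (simp add: norm_tc_op Tc_inverse Ytc Yn summable_geometric)
  hence "summable (\<lambda>n. Tc (Y n))" by (rule summable_norm_cancel)
  then obtain Z where Z: "(\<lambda>n. Tc (Y n)) sums Z" by (auto simp: summable_def)
  have Zx: "(\<lambda>n. cinner x (Y n x)) sums cinner x (tc_op Z x)" for x
  proof -
    have "(\<lambda>n. tc_op (Tc (Y n)) x) sums tc_op Z x"
      by (rule bounded_linear.sums[OF bounded_linear_tc_op_apply Z])
    hence "(\<lambda>n. Y n x) sums tc_op Z x" by (simp add: Tc_inverse Ytc)
    thus ?thesis by (rule bounded_linear.sums[OF bounded_linear_cinner_right])
  qed
  have bZ: "bounded_clinear (tc_op Z)" by (intro trace_class_bounded_clinear) simp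
  have reY: "Re (cinner x (Y n x)) \<ge> 0" "Im (cinner x (Y n x)) = 0" for n x
    using Yp by (auto simp: positive_op_iff)
  have ImZ: "Im (cinner x (tc_op Z x)) = 0" for x
    using bounded_linear.sums[OF bounded_linear_Im Zx[of x]] by (simp add: reY sums_iff)
  have ReZ: "Re (cinner x (Y n x)) \<le> Re (cinner x (tc_op Z x))" for n x
  proof -
    have s: "(\<lambda>n. Re (cinner x (Y n x))) sums Re (cinner x (tc_op Z x))"
      by (rule bounded_linear.sums[OF bounded_linear_Re Zx])
    hence "sum (\<lambda>n. Re (cinner x (Y n x))) {n} \<le> suminf (\<lambda>n. Re (cinner x (Y n x)))"
      by (intro sum_le_suminf) (auto simp: reY sums_iff)
    thus ?thesis using s by (simp add: sums_iff)
  qed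
  have posZ: "positive_op (tc_op Z)"
    using bZ ImZ order_trans[OF reY(1) ReZ] by (auto simp: positive_op_iff)
  have \<Phi>tc: "\<Phi> (tc_op Z) \<in> trace_class" "\<Phi> (Y n) \<in> trace_class" for n
    by (intro linear_maps_trace_class[OF l\<Phi>] Ytc tc_op_trace_class)+
  have "2 ^ n \<le> trace_norm (\<Phi> (tc_op Z))" for n
  proof -
    \<comment> \<open>The sum dominates each of its summands, and positivity of
      \<open>\<Phi>\<close> carries this over to the images. On positive operators the trace norm is
      the trace, which is monotone.\<close>
    let ?D = "\<lambda>x. tc_op Z x - Y n x"
    have D: "?D \<in> trace_class" by (intro trace_class_diff Ytc) simp
    have "positive_op ?D"
      by (intro positive_op_diff bZ trace_class_bounded_clinear Ytc ImZ reY ReZ)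
    hence pD: "positive_op (\<Phi> ?D)" by (rule CP_positive[OF \<Phi> D])
    have "\<Phi> (tc_op Z) = (\<lambda>x. \<Phi> ?D x + \<Phi> (Y n) x)"
      using linear_maps_add[OF l\<Phi> D Ytc[of n]] by simp
    hence "Re (cinner x (\<Phi> (Y n) x)) \<le> Re (cinner x (\<Phi> (tc_op Z) x))" for x
      using pD by (auto simp: positive_op_iff cinner_simps)
    hence "Re (op_trace (\<Phi> (Y n))) \<le> Re (op_trace (\<Phi> (tc_op Z)))" by (rule op_trace_mono[OF \<Phi>tc(2,1)])
    thus ?thesis
      using Y\<Phi>[of n] positive_trace[OF \<Phi>tc(1) CP_positive[OF \<Phi> _ posZ]]
        positive_trace[OF \<Phi>tc(2)[of n] CP_positive[OF \<Phi> Ytc Yp]] by simp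
  qed
  moreover obtain n where "trace_norm (\<Phi> (tc_op Z)) < 2 ^ n"
    using real_arch_pow[of 2 "trace_norm (\<Phi> (tc_op Z))"] by auto
  ultimately show False by (meson not_le)
qed

lemma nuclear_rep_diag_positive:
  assumes "nuclear_rep I w w P"
  shows "positive_op P"
  unfolding positive_op_iff
proof (intro conjI allI)
  show "bounded_clinear P" by (rule nuclear_rep_bounded_clinear[OF assms])
  fix x
  have s: "((\<lambda>i. of_real ((cmod (cinner (w i) x))\<^sup>2)) has_sum cinner x (P x)) I"
  proof -
    have "cinner (w i) x * cinner x (w i) = of_real ((cmod (cinner (w i) x))\<^sup>2)" for i
      by (simp only: complex_norm_square cinner_commute[symmetric])
    thus ?thesis using nuclear_rep_cinner[OF assms, of x x] by simp
  qed
  show "Re (cinner x (P x)) \<ge> 0" by (rule has_sum_nonneg[OF has_sum_Re[OF s]]) simp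
  show "Im (cinner x (P x)) = 0"
    by (rule has_sum_eqI[OF has_sum_Im[OF s] has_sum_0]) auto
qed

text \<open>Averaging over the fourth roots of unity keeps one of the four mixed terms. A rank one
  operator is thereby a combination of four positive ones.\<close>

lemma rank1_polarization:
  "4 *\<^sub>R (cinner v x *\<^sub>C u) = (\<Sum>k<4. \<i> ^ k *\<^sub>C (cinner (u + \<i> ^ k *\<^sub>C v) x *\<^sub>C (u + \<i> ^ k *\<^sub>C (v::'a::chilbert_space))))"
proof -
  define a b where "a = cinner u x" and "b = cinner v x"
  have inv: "cnj (\<i> ^ k) * \<i> ^ k = 1" for k :: nat
    by (simp add: power_mult_distrib[symmetric])
  have k: "\<i> ^ k *\<^sub>C (cinner (u + \<i> ^ k *\<^sub>C v) x *\<^sub>C (u + \<i> ^ k *\<^sub>C v))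
      = (\<i> ^ k * a + b) *\<^sub>C u + (\<i> ^ k * \<i> ^ k * a + \<i> ^ k * b) *\<^sub>C v" for k :: nat
  proof -
    have "\<i> ^ k * (a + cnj (\<i> ^ k) * b) = \<i> ^ k * a + (cnj (\<i> ^ k) * \<i> ^ k) * b"
      by (simp only: algebra_simps)
    hence 1: "\<i> ^ k * cinner (u + \<i> ^ k *\<^sub>C v) x = \<i> ^ k * a + b"
      unfolding inv by (simp add: cinner_simps a_def b_def)
    have "\<i> ^ k *\<^sub>C (cinner (u + \<i> ^ k *\<^sub>C v) x *\<^sub>C (u + \<i> ^ k *\<^sub>C v))
        = (\<i> ^ k * a + b) *\<^sub>C (u + \<i> ^ k *\<^sub>C v)" by (simp only: scaleC_scaleC 1)
    thus ?thesis by (simp add: scaleC_add_right scaleC_scaleC algebra_simps)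
  qed
  have four: "(4 * b) *\<^sub>C u = b *\<^sub>C u + (b *\<^sub>C u + (b *\<^sub>C u + b *\<^sub>C u))"
    by (simp flip: scaleC_add_left)
  have e: "\<i> ^ 3 = - \<i>" by (simp add: power3_eq_cube)
  have "{..<4::nat} = {0, 1, 2, 3}" by auto
  hence "(\<Sum>k<4. \<i> ^ k *\<^sub>C (cinner (u + \<i> ^ k *\<^sub>C v) x *\<^sub>C (u + \<i> ^ k *\<^sub>C v)))
      = ((a + b) + (\<i> * a + b) + (- a + b) + (- \<i> * a + b)) *\<^sub>C u
      + ((a + b) + (- a + \<i> * b) + (a - b) + (- a - \<i> * b)) *\<^sub>C v"
    unfolding k by (simp add: e scaleC_add_left scaleC_minus_left add_ac four)
  also have "\<dots> = complex_of_real 4 *\<^sub>C (b *\<^sub>C u)" by (simp add: scaleC_scaleC algebra_simps)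
  finally show ?thesis unfolding scaleC_of_real by (simp add: b_def)
qed

text \<open>Polarising a nuclear representation term by term gives \<open>4 X\<close> as a
  combination of four positive operators \<open>P k\<close> with unimodular coefficients. The
  balance \<open>norm (u e) \<le> norm (v e)\<close>, with the squares of \<open>norm (v e)\<close>
  summing to the trace norm, bounds each \<open>trace_norm (P k)\<close> by
  \<open>4 * trace_norm X\<close>. Four images, divided by 4, leave the constant
  \<open>4 * M\<close>.\<close>

lemma CP_bounded:
  fixes \<Phi> :: "('a::chilbert_space \<Rightarrow> 'a) \<Rightarrow> 'a \<Rightarrow> 'a"
  assumes \<Phi>: "\<Phi> \<in> CP"
  shows "\<Phi> \<in> bounded_maps"
proof -
  note l\<Phi> = CP_linear[OF \<Phi>]
  obtain M where M: "M \<ge> 0" "\<And>X. X \<in> trace_class \<Longrightarrow> positive_op X \<Longrightarrow> trace_norm (\<Phi> X) \<le> M * trace_norm X"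
    using CP_bounded_positive[OF \<Phi>] by blast
  have "trace_norm (\<Phi> X) \<le> (4 * M) * trace_norm X" if X: "X \<in> trace_class" for X
  proof -
    obtain E :: "'a set" and u v where r: "nuclear_rep E u v X"
      and "(\<Sum>\<^sub>\<infinity>e\<in>E. norm (u e) * norm (v e)) = trace_norm X"
      and nuv: "\<And>e. norm (u e) \<le> norm (v e)" and sv: "(\<lambda>e. (norm (v e))\<^sup>2) summable_on E"
      and tv: "(\<Sum>\<^sub>\<infinity>e\<in>E. (norm (v e))\<^sup>2) = trace_norm X" by (rule trace_class_nuclear[OF X]) blast
    define w where "w k e = u e + \<i> ^ k *\<^sub>C v e" for k :: nat and e
    have nw: "norm (w k e) * norm (w k e) \<le> 4 * (norm (v e))\<^sup>2" for k e
    proof -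
      have "norm (w k e) \<le> norm (u e) + norm (v e)"
        unfolding w_def using norm_triangle_ineq[of "u e" "\<i> ^ k *\<^sub>C v e"] by (simp add: norm_scaleC norm_power)
      also have "\<dots> \<le> 2 * norm (v e)" using nuv[of e] by simp
      finally have "norm (w k e) * norm (w k e) \<le> (2 * norm (v e)) * (2 * norm (v e))"
        by (intro mult_mono) auto
      thus ?thesis by (simp add: power2_eq_square)
    qed
    have sw: "(\<lambda>e. norm (w k e) * norm (w k e)) summable_on E" for k
      by (rule summable_on_comparison_test[OF summable_on_cmult_right[OF sv, of 4]]) (use nw in auto)
    have "\<exists>P. nuclear_rep E (w k) (w k) P" for k using nuclear_rep_exists[OF sw] by metis
    then obtain P where P: "\<And>k. nuclear_rep E (w k) (w k) (P k)" by metis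
    have Ptc: "P k \<in> trace_class" for k by (rule nuclear_rep_trace_class[OF P])
    have Pn: "trace_norm (P k) \<le> 4 * trace_norm X" for k
    proof -
      have "trace_norm (P k) \<le> (\<Sum>\<^sub>\<infinity>e\<in>E. norm (w k e) * norm (w k e))"
        by (rule nuclear_rep_trace_class[OF P])
      also have "\<dots> \<le> (\<Sum>\<^sub>\<infinity>e\<in>E. 4 * (norm (v e))\<^sup>2)"
        by (intro infsum_mono sw summable_on_cmult_right sv nw)
      also have "\<dots> = 4 * trace_norm X" by (simp add: infsum_cmult_right' tv)
      finally show ?thesis .
    qed
    have \<Phi>P: "trace_norm (\<Phi> (P k)) \<le> M * (4 * trace_norm X)" for k
      using M(2)[OF Ptc nuclear_rep_diag_positive[OF P], of k] mult_left_mono[OF Pn[of k] M(1)] by simp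
    have dec: "4 *\<^sub>R X x = (\<Sum>k<4. \<i> ^ k *\<^sub>C P k x)" for x
    proof (rule has_sum_eqI)
      show "((\<lambda>e. 4 *\<^sub>R (cinner (v e) x *\<^sub>C u e)) has_sum 4 *\<^sub>R X x) E"
        by (rule has_sum_bounded_linear[OF bounded_linear_scaleR_right nuclear_rep_has_sum[OF r]])
      show "((\<lambda>e. \<Sum>k<4. \<i> ^ k *\<^sub>C (cinner (w k e) x *\<^sub>C w k e)) has_sum (\<Sum>k<4. \<i> ^ k *\<^sub>C P k x)) E"
        unfolding has_sum_def sum.swap[of _ "{..<4}"]
        by (intro tendsto_sum) (use has_sum_scaleC_right[OF nuclear_rep_has_sum[OF P]] in \<open>simp add: has_sum_def\<close>)
    qed (simp only: w_def rank1_polarization)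
    \<comment> \<open>The four terms are bracketed as nested binary sums, the shape in which
      additivity and homogeneity of \<open>\<Phi>\<close> can be applied.\<close>
    have X4: "X = (\<lambda>x. (1/4) *\<^sub>C ((\<lambda>x. 1 *\<^sub>C P 0 x + \<i> *\<^sub>C P 1 x) x + (\<lambda>x. (-1) *\<^sub>C P 2 x + (-\<i>) *\<^sub>C P 3 x) x))"
    proof
      fix x
      have e: "\<i> ^ 3 = - \<i>" by (simp add: power3_eq_cube)
      have "{..<4::nat} = {0, 1, 2, 3}" by auto
      hence "4 *\<^sub>R X x = (1 *\<^sub>C P 0 x + \<i> *\<^sub>C P 1 x) + ((-1) *\<^sub>C P 2 x + (-\<i>) *\<^sub>C P 3 x)"
        using dec[of x] e by (simp add: add.assoc)
      hence "(1/4) *\<^sub>R (4 *\<^sub>R X x) = (1/4) *\<^sub>R ((1 *\<^sub>C P 0 x + \<i> *\<^sub>C P 1 x) + ((-1) *\<^sub>C P 2 x + (-\<i>) *\<^sub>C P 3 x))"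
        by (simp only:)
      moreover have "(1/4) *\<^sub>R (4 *\<^sub>R X x) = X x" by simp
      moreover have "(1/4::real) *\<^sub>R z = (1/4::complex) *\<^sub>C z" for z :: 'a
        using scaleC_of_real[of "1/4" z] by simp
      ultimately show "X x = (1/4) *\<^sub>C ((\<lambda>x. 1 *\<^sub>C P 0 x + \<i> *\<^sub>C P 1 x) x + (\<lambda>x. (-1) *\<^sub>C P 2 x + (-\<i>) *\<^sub>C P 3 x) x)"
        by simp
    qed
    note lin = linear_maps_add[OF l\<Phi>] linear_maps_scaleC[OF l\<Phi>] trace_class_add(1) trace_class_scaleC(1) Ptc
    have c: "trace_norm (\<lambda>x. c *\<^sub>C \<Phi> (P k) x) \<le> M * (4 * trace_norm X)" "(\<lambda>x. c *\<^sub>C \<Phi> (P k) x) \<in> trace_class"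
      if "cmod c = 1" for c k
      using \<Phi>P[of k] that by (simp_all add: trace_class_scaleC linear_maps_trace_class[OF l\<Phi> Ptc])
    have sum2: "trace_norm (\<lambda>x. c *\<^sub>C \<Phi> (P k) x + d *\<^sub>C \<Phi> (P l) x) \<le> 2 * (M * (4 * trace_norm X))"
      "(\<lambda>x. c *\<^sub>C \<Phi> (P k) x + d *\<^sub>C \<Phi> (P l) x) \<in> trace_class"
      if "cmod c = 1" "cmod d = 1" for c d k l
      using trace_class_add[OF c(2)[OF that(1), of k] c(2)[OF that(2), of l]] c(1)[OF that(1), of k]
        c(1)[OF that(2), of l] by auto
    let ?S = "\<lambda>x. (1 *\<^sub>C \<Phi> (P 0) x + \<i> *\<^sub>C \<Phi> (P 1) x) + ((-1) *\<^sub>C \<Phi> (P 2) x + (-\<i>) *\<^sub>C \<Phi> (P 3) x)"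
    have S: "?S \<in> trace_class" "trace_norm ?S \<le> 4 * (M * (4 * trace_norm X))"
      using trace_class_add[OF sum2(2)[of 1 \<i> 0 1] sum2(2)[of "-1" "-\<i>" 2 3]]
        sum2(1)[of 1 \<i> 0 1] sum2(1)[of "-1" "-\<i>" 2 3] by auto
    have "\<Phi> X = (\<lambda>x. (1/4) *\<^sub>C ?S x)" by (subst X4) (simp only: lin)
    hence "trace_norm (\<Phi> X) = (1/4) * trace_norm ?S" by (simp only: trace_class_scaleC(2)[OF S(1)]) simp
    thus ?thesis using S(2) by simp
  qed
  thus ?thesis using l\<Phi> by (auto simp: bounded_maps_def)
qed

section \<open>Positivity of the Choi form and its null vectors\<close>

lemma bounded_bilinear_choi_form:
  assumes L: "L \<in> bounded_maps"
  shows "bounded_bilinear (\<lambda>X Y. choi_form L (tc_op X) (tc_op Y))"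
proof
  note lin = choi_form_lin[OF L tc_op_trace_class tc_op_trace_class tc_op_trace_class]
  show "choi_form L (tc_op (X + X')) (tc_op Y) = choi_form L (tc_op X) (tc_op Y) + choi_form L (tc_op X') (tc_op Y)"
    "choi_form L (tc_op Y) (tc_op (X + X')) = choi_form L (tc_op Y) (tc_op X) + choi_form L (tc_op Y) (tc_op X')" for X X' Y
    unfolding tc_op_simps by (rule lin)+
  have sc: "tc_op (r *\<^sub>R X) = (\<lambda>x. complex_of_real r *\<^sub>C tc_op X x)" for r and X :: "'a tc"
    by (simp add: tc_op_simps scaleC_of_real)
  show "choi_form L (tc_op (r *\<^sub>R X)) (tc_op Y) = r *\<^sub>R choi_form L (tc_op X) (tc_op Y)"
    "choi_form L (tc_op X) (tc_op (r *\<^sub>R Y)) = r *\<^sub>R choi_form L (tc_op X) (tc_op Y)" for r X Y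
    unfolding sc lin(2,4) by (simp_all add: scaleR_conv_of_real)
  obtain K where K: "K \<ge> 0" "\<And>X. X \<in> trace_class \<Longrightarrow> trace_norm (L X) \<le> K * trace_norm X"
    using bounded_mapsE[OF L] by blast
  show "\<exists>K. \<forall>X Y. norm (choi_form L (tc_op X) (tc_op Y)) \<le> norm X * norm Y * K"
    using choi_form_bound[OF L tc_op_trace_class tc_op_trace_class K]
    by (intro exI[of _ K]) (simp add: norm_tc_op mult_ac)
qed

definition choi_positive :: "(('a::chilbert_space \<Rightarrow> 'a) \<Rightarrow> 'a \<Rightarrow> 'a) \<Rightarrow> bool" where
  "choi_positive \<Phi> \<longleftrightarrow> (\<forall>A\<in>trace_class. choi_form \<Phi> A A \<in> \<real>\<^sub>\<ge>\<^sub>0)"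

lemma choi_form_finite:
  assumes L: "L \<in> bounded_maps" and F: "finite F"
  shows "choi_form L (\<lambda>x. \<Sum>i\<in>F. rank1 (u i) (v i) x) (\<lambda>x. \<Sum>i\<in>F. rank1 (u i) (v i) x) =
    (\<Sum>i\<in>F. cinner (v i) (\<Sum>j\<in>F. L (rank1 (u i) (u j)) (v j)))"
proof -
  have r: "nuclear_rep F u v (\<lambda>x. \<Sum>i\<in>F. rank1 (u i) (v i) x)"
    using F by (auto simp: nuclear_rep_def rank1_def intro: has_sum_finiteI)
  have "choi_form L (\<lambda>x. \<Sum>i\<in>F. rank1 (u i) (v i) x) (\<lambda>x. \<Sum>i\<in>F. rank1 (u i) (v i) x)
      = (\<Sum>(i, j)\<in>F \<times> F. cinner (v i) (L (rank1 (u i) (u j)) (v j)))"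
    using choi_form_has_sums(2)[OF L r r] F by (simp add: has_sum_finite_iff)
  thus ?thesis by (simp add: sum.cartesian_product cinner_sum_right)
qed

lemma block_positive_rank1: "block_positive n (\<lambda>i j. rank1 (u i) (u j))"
  unfolding block_positive_def
proof
  fix x :: "nat \<Rightarrow> 'a"
  define s where "s = (\<Sum>j<n. cinner (u j) (x j))"
  have "(\<Sum>i<n. cinner (x i) (\<Sum>j<n. rank1 (u i) (u j) (x j))) = (\<Sum>i<n. cinner (x i) (u i) * s)"
    by (simp add: rank1_def cinner_sum_right cinner_simps s_def sum_distrib_left mult.commute)
  also have "\<dots> = cnj s * s"
    by (simp add: s_def sum_distrib_right cinner_commute[symmetric])
  also have "\<dots> = of_real ((cmod s)\<^sup>2)" by (simp only: complex_norm_square mult.commute)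
  finally show "(\<Sum>i<n. cinner (x i) (\<Sum>j<n. rank1 (u i) (u j) (x j))) \<in> \<real>\<^sub>\<ge>\<^sub>0"
    by (simp only: nonneg_Reals_iff) simp
qed

text \<open>Finite partial sums of a nuclear representation converge in trace norm, the form is
  jointly continuous, and the nonnegative reals are closed; so finite rank operators
  suffice.\<close>

lemma choi_positiveI:
  fixes L :: "('a::chilbert_space \<Rightarrow> 'a) \<Rightarrow> 'a \<Rightarrow> 'a"
  assumes L: "L \<in> bounded_maps"
    and fin: "\<And>(n::nat) u v. (\<Sum>i<n. cinner (v i) (\<Sum>j<n. L (rank1 (u i) (u j)) (v j))) \<in> \<real>\<^sub>\<ge>\<^sub>0"
  shows "choi_positive L"
  unfolding choi_positive_def
proof
  fix A :: "'a \<Rightarrow> 'a" assume A: "A \<in> trace_class"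
  obtain E :: "'a set" and u v where r: "nuclear_rep E u v A" by (rule trace_class_nuclear[OF A])
  let ?S = "\<lambda>F. \<Sum>i\<in>F. Tc (rank1 (u i) (v i))"
  have "(?S \<longlongrightarrow> Tc A) (finite_subsets_at_top E)"
    using tc_has_sum[OF r] by (simp add: has_sum_def)
  hence "((\<lambda>F. choi_form L (tc_op (?S F)) (tc_op (?S F))) \<longlongrightarrow> choi_form L (tc_op (Tc A)) (tc_op (Tc A)))
      (finite_subsets_at_top E)"
    by (intro bounded_bilinear.tendsto[OF bounded_bilinear_choi_form[OF L]])
  hence lim: "((\<lambda>F. choi_form L (tc_op (?S F)) (tc_op (?S F))) \<longlongrightarrow> choi_form L A A) (finite_subsets_at_top E)"
    by (simp add: Tc_inverse A)
  have "choi_form L (tc_op (?S F)) (tc_op (?S F)) \<in> \<real>\<^sub>\<ge>\<^sub>0" for F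
  proof (cases "finite F")
    case True
    have tS: "tc_op (?S F) = (\<lambda>x. \<Sum>i\<in>F. rank1 (u i) (v i) x)"
      using True by (induction F rule: finite_induct) (auto simp: tc_op_simps Tc_inverse)
    \<comment> \<open>The hypothesis speaks of vectors numbered below \<open>n\<close>, so the
      finite index set is enumerated.\<close>
    obtain h where h: "bij_betw h {..<card F} F"
      using ex_bij_betw_nat_finite[OF True] by (auto simp: atLeast0LessThan)
    have "choi_form L (tc_op (?S F)) (tc_op (?S F))
        = (\<Sum>i\<in>F. cinner (v i) (\<Sum>j\<in>F. L (rank1 (u i) (u j)) (v j)))"
      unfolding tS by (rule choi_form_finite[OF L True])
    also have "\<dots> = (\<Sum>i<card F. cinner (v (h i)) (\<Sum>j<card F. L (rank1 (u (h i)) (u (h j))) (v (h j))))"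
      by (simp only: sum.reindex_bij_betw[OF h, symmetric])
    also have "\<dots> \<in> \<real>\<^sub>\<ge>\<^sub>0" by (rule fin[where n = "card F" and u = "\<lambda>i. u (h i)" and v = "\<lambda>i. v (h i)"])
    finally show ?thesis .
  next
    case False
    \<comment> \<open>The limit argument asks for every \<open>F\<close>; over an infinite set the
      sum is 0 by convention.\<close>
    have "choi_form L (tc_op 0) (tc_op 0) = 0"
      by (rule bounded_bilinear.zero_left[OF bounded_bilinear_choi_form[OF L]])
    thus ?thesis using False by simp
  qed
  from tendsto_nonneg_Reals[OF lim _ this] show "choi_form L A A \<in> \<real>\<^sub>\<ge>\<^sub>0" by simp
qed

text \<open>The blocks \<open>rank1 (u i) (u j)\<close> form a positive block operator for any
  vectors, and complete positivity at these blocks is nonnegativity of the finite Choi sums.\<close>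

lemma CP_choi_positive:
  assumes \<Phi>: "\<Phi> \<in> CP"
  shows "choi_positive \<Phi>"
proof (rule choi_positiveI[OF CP_bounded[OF \<Phi>]])
  fix n and u v :: "nat \<Rightarrow> 'a"
  have "block_positive n (\<lambda>i j. \<Phi> (rank1 (u i) (u j)))"
    by (rule CP_block_positive[OF \<Phi> _ block_positive_rank1]) simp
  thus "(\<Sum>i<n. cinner (v i) (\<Sum>j<n. \<Phi> (rank1 (u i) (u j)) (v j))) \<in> \<real>\<^sub>\<ge>\<^sub>0"
    unfolding block_positive_def by blast
qed

text \<open>A function affine in a real parameter that stays real and bounded below is constant.
  Real \<open>c\<close> yields \<open>p + q = 0\<close>, imaginary \<open>c\<close> yields
  \<open>q - p = 0\<close>.\<close>

lemma nonneg_affine_imp_zero: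
  assumes "\<And>c. a + cnj c * p + c * q \<in> \<real>\<^sub>\<ge>\<^sub>0"
  shows "p = 0 \<and> q = 0"
proof -
  have key: "z = 0" if z: "\<And>t::real. a + of_real t * z \<in> \<real>\<^sub>\<ge>\<^sub>0" for z
  proof -
    have im: "Im a + t * Im z = 0" and re: "Re a + t * Re z \<ge> 0" for t
      using z[of t] by (auto simp: nonneg_Reals_iff)
    have "Im z = 0" using im[of 0] im[of 1] by simp
    moreover have "Re z = 0"
    proof (rule ccontr)
      assume "Re z \<noteq> 0"
      thus False using re[of "- (Re a + 1) / Re z"] by simp
    qed
    ultimately show ?thesis by (simp add: complex_eq_iff)
  qed
  have "p + q = 0" by (rule key) (use assms[of "of_real _"] in \<open>simp add: algebra_simps\<close>)
  moreover have "\<i> * (q - p) = 0"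
    by (rule key) (use assms[of "\<i> * of_real _"] in \<open>simp add: algebra_simps\<close>)
  ultimately show ?thesis by (auto simp: eq_neg_iff_add_eq_0[symmetric])
qed

text \<open>The degenerate case of Cauchy-Schwarz: when \<open>C\<close> is a null vector, the form
  at \<open>A + c C\<close> loses its quadratic term in \<open>c\<close>, and an affine expression
  can only stay nonnegative if its linear part vanishes.\<close>

lemma choi_positive_orthogonal:
  assumes L: "L \<in> bounded_maps" and pos: "choi_positive L"
    and A: "A \<in> trace_class" and C: "C \<in> trace_class" and z: "choi_form L C C = 0"
  shows "choi_form L A C = 0"
proof -
  have "choi_form L A A + cnj c * choi_form L A C + c * choi_form L C A \<in> \<real>\<^sub>\<ge>\<^sub>0" for c
  proof -
    have cC: "(\<lambda>x. c *\<^sub>C C x) \<in> trace_class" by (rule trace_class_scaleC(1)[OF C])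
    have S: "(\<lambda>x. A x + c *\<^sub>C C x) \<in> trace_class" by (rule trace_class_add(1)[OF A cC])
    have "choi_form L (\<lambda>x. A x + c *\<^sub>C C x) (\<lambda>x. A x + c *\<^sub>C C x)
        = choi_form L A A + cnj c * choi_form L A C + c * choi_form L C A"
      by (simp add: choi_form_add_left[OF L A cC S] choi_form_add_right[OF L A cC A]
          choi_form_add_right[OF L A cC cC] choi_form_scaleC_right[OF L C A A]
          choi_form_scaleC_left[OF L C A A] choi_form_scaleC_left[OF L C A cC]
          choi_form_scaleC_right[OF L C A C] z)
    thus ?thesis using pos S unfolding choi_positive_def by metis
  qed
  thus ?thesis using nonneg_affine_imp_zero by blast
qed

lemma CP_on_choi:
  assumes B: "B \<in> trace_class" and \<Phi>: "\<Phi> \<in> CP_on B"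
  shows "\<Phi> \<in> CP" "choi_form \<Phi> (adj B) (adj B) = 0"
  using \<Phi> by (auto simp: CP_on_def choi_form_def adj_adj[OF trace_class_bounded_clinear[OF B]])

lemma CP_onI:
  assumes "B \<in> trace_class" "\<Phi> \<in> CP" "choi_form \<Phi> (adj B) (adj B) = 0"
  shows "\<Phi> \<in> CP_on B"
  using assms by (auto simp: CP_on_def choi_form_def adj_adj[OF trace_class_bounded_clinear])

text \<open>Schur product theorem: split off a rank one part \<open>w w\<^sup>*\<close> of \<open>M\<close> that clears one row and column.\<close>

lemma Schur_sum_nonneg:
  fixes M G :: "'i \<Rightarrow> 'i \<Rightarrow> complex"
  assumes I: "finite I"
    and M: "\<And>a. (\<Sum>p\<in>I. \<Sum>q\<in>I. cnj (a p) * M p q * a q) \<in> \<real>\<^sub>\<ge>\<^sub>0"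
    and G: "\<And>a. (\<Sum>p\<in>I. \<Sum>q\<in>I. cnj (a p) * G p q * a q) \<in> \<real>\<^sub>\<ge>\<^sub>0"
  shows "(\<Sum>p\<in>I. \<Sum>q\<in>I. M p q * G p q) \<in> \<real>\<^sub>\<ge>\<^sub>0"
  using assms
proof (induction I arbitrary: M rule: finite_induct)
  case empty
  show ?case by simp
next
  case (insert r I)
  have split: "(\<Sum>p\<in>insert r I. \<Sum>q\<in>insert r I. f p q)
      = f r r + (\<Sum>q\<in>I. f r q) + (\<Sum>p\<in>I. f p r) + (\<Sum>p\<in>I. \<Sum>q\<in>I. f p q)" for f :: "'i \<Rightarrow> 'i \<Rightarrow> complex"
    using insert.hyps by (simp add: sum.distrib algebra_simps)
  have GI: "(\<Sum>p\<in>I. \<Sum>q\<in>I. cnj (a p) * G p q * a q) \<in> \<real>\<^sub>\<ge>\<^sub>0" for a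
  proof -
    let ?a = "\<lambda>p. if p = r then 0 else a p"
    have "(\<Sum>p\<in>insert r I. \<Sum>q\<in>insert r I. cnj (?a p) * G p q * ?a q) = (\<Sum>p\<in>I. \<Sum>q\<in>I. cnj (a p) * G p q * a q)"
      unfolding split using insert.hyps by (auto intro!: sum.cong)
    thus ?thesis using insert.prems(2)[of ?a] by simp
  qed
  \<comment> \<open>Test vector with entry \<open>c\<close> at \<open>r\<close> and 1 at
    \<open>s\<close>. These two-dimensional restrictions control row and column \<open>r\<close>,
    including hermiticity there.\<close>
  have two: "cnj c * M r s + c * M s r + cnj c * c * M r r + M s s \<in> \<real>\<^sub>\<ge>\<^sub>0" if s: "s \<in> I" for s c
  proof -
    let ?a = "\<lambda>p. if p = r then c else if p = s then 1 else 0"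
    have "r \<noteq> s" using s insert.hyps by auto
    have a: "(if p = r then c else if p = s then 1 else 0) = (if p = s then 1 else (0::complex))" if "p \<in> I" for p
      using that insert.hyps by auto
    have "(\<Sum>p\<in>insert r I. \<Sum>q\<in>insert r I. cnj (?a p) * M p q * ?a q)
        = cnj c * M r r * c + (\<Sum>q\<in>I. if q = s then cnj c * M r q else 0)
        + (\<Sum>p\<in>I. if p = s then M p r * c else 0) + (\<Sum>p\<in>I. \<Sum>q\<in>I. if p = s then if q = s then M p q else 0 else 0)"
      unfolding split by (intro arg_cong2[where f = "(+)"] sum.cong) (auto simp: a)
    also have "(\<Sum>p\<in>I. \<Sum>q\<in>I. if p = s then if q = s then M p q else 0 else 0) = M s s"
    proof -
      have "(\<Sum>p\<in>I. \<Sum>q\<in>I. if p = s then if q = s then M p q else 0 else 0)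
          = (\<Sum>p\<in>I. if p = s then M s s else 0)"
        using s insert.hyps by (intro sum.cong) auto
      thus ?thesis using s insert.hyps by simp
    qed
    finally show ?thesis using insert.prems(1)[of ?a] s insert.hyps by (simp add: mult_ac add_ac)
  qed
  have single: "M r r \<in> \<real>\<^sub>\<ge>\<^sub>0"
  proof -
    let ?a = "\<lambda>p. if p = r then 1 else 0"
    have a: "(if p = r then 1 else 0) = (0::complex)" if "p \<in> I" for p using that insert.hyps by auto
    have "(\<Sum>p\<in>insert r I. \<Sum>q\<in>insert r I. cnj (?a p) * M p q * ?a q) = M r r"
      unfolding split by (simp add: a)
    thus ?thesis using insert.prems(1)[of ?a] by simp
  qed
  have herm: "M s r = cnj (M r s)" if s: "s \<in> I" for s
  proof -
    have im: "Im (cnj c * M r s + c * M s r + cnj c * c * M r r + M s s) = 0" for c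
      using two[OF s, of c] by (simp add: nonneg_Reals_iff)
    have rr: "Im (M r r) = 0" using single by (simp add: nonneg_Reals_iff)
    show ?thesis using im[of 0] im[of 1] im[of \<i>] rr by (simp add: complex_eq_iff)
  qed
  show ?case
  proof (cases "M r r = 0")
    case True
    \<comment> \<open>A vanishing diagonal entry leaves an expression affine in \<open>c\<close>, so
      the whole row and column vanish.\<close>
    have "M r s = 0 \<and> M s r = 0" if s: "s \<in> I" for s
      using nonneg_affine_imp_zero[of "M s s" "M r s" "M s r"] two[OF s] True by (simp add: add_ac)
    moreover from this have "(\<Sum>p\<in>I. \<Sum>q\<in>I. M p q * G p q) \<in> \<real>\<^sub>\<ge>\<^sub>0"
    proof (intro insert.IH GI)
      fix a :: "'i \<Rightarrow> complex"
      let ?a = "\<lambda>p. if p = r then 0 else a p"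
      have "(\<Sum>p\<in>insert r I. \<Sum>q\<in>insert r I. cnj (?a p) * M p q * ?a q) = (\<Sum>p\<in>I. \<Sum>q\<in>I. cnj (a p) * M p q * a q)"
        unfolding split using insert.hyps by (auto intro!: sum.cong)
      thus "(\<Sum>p\<in>I. \<Sum>q\<in>I. cnj (a p) * M p q * a q) \<in> \<real>\<^sub>\<ge>\<^sub>0" using insert.prems(1)[of ?a] by simp
    qed
    ultimately show ?thesis unfolding split using True by simp
  next
    case False
    define m where "m = Re (M r r)"
    have Mrr: "M r r = of_real m" and m: "m > 0"
      using single False by (auto simp: nonneg_Reals_iff m_def complex_eq_iff)
    \<comment> \<open>Column \<open>r\<close>, scaled so that \<open>w p * cnj (w q)\<close> agrees
      with \<open>M\<close> on row and column \<open>r\<close>; subtracting it clears both.\<close>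
    define w where "w p = M p r / of_real (sqrt m)" for p
    have sq: "complex_of_real (sqrt m) * of_real (sqrt m) = of_real m"
      using m by (simp flip: of_real_mult)
    have wr: "w r = of_real (sqrt m)"
      using m sq by (simp add: w_def Mrr field_simps)
    define M' where "M' p q = M p q - w p * cnj (w q)" for p q
    have wrq: "w r * cnj (w q) = M r q" if "q \<in> I" for q
      using m by (simp add: wr) (simp add: w_def herm[OF that])
    have wpr: "w p * cnj (w r) = M p r" for p
      using m by (simp add: wr) (simp add: w_def)
    have "w r * cnj (w r) = M r r" using sq by (simp add: wr Mrr)
    hence M0: "M' r r = 0" "q \<in> I \<Longrightarrow> M' r q = 0" "M' p r = 0" for p q
      using wrq wpr by (auto simp: M'_def)
    have "(\<Sum>p\<in>I. \<Sum>q\<in>I. M' p q * G p q) \<in> \<real>\<^sub>\<ge>\<^sub>0"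
    proof (intro insert.IH GI)
      fix a :: "'i \<Rightarrow> complex"
      define s where "s = (\<Sum>q\<in>I. cnj (w q) * a q)"
      \<comment> \<open>The entry at \<open>r\<close> makes \<open>?a\<close> orthogonal to
        \<open>w\<close>. There \<open>M\<close> and \<open>M'\<close> have the same quadratic form,
        so positivity is inherited by \<open>M'\<close> on the smaller index set.\<close>
      let ?a = "\<lambda>p. if p = r then - s / w r else a p"
      have cs: "cnj s = (\<Sum>p\<in>I. cnj (a p) * w p)" by (simp add: s_def mult.commute)
      have ww: "(\<Sum>p\<in>insert r I. \<Sum>q\<in>insert r I. cnj (?a p) * (w p * cnj (w q)) * ?a q) = 0"
      proof -
        have "(\<Sum>p\<in>insert r I. \<Sum>q\<in>insert r I. cnj (?a p) * (w p * cnj (w q)) * ?a q)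
            = (\<Sum>p\<in>insert r I. cnj (?a p) * w p) * (\<Sum>q\<in>insert r I. cnj (w q) * ?a q)"
          by (simp only: sum_product mult.assoc)
        also have "(\<Sum>q\<in>insert r I. cnj (w q) * ?a q) = cnj (w r) * (- s / w r) + (\<Sum>q\<in>I. cnj (w q) * a q)"
          using insert.hyps by (auto intro!: sum.cong)
        also have "\<dots> = 0" using m by (simp add: wr s_def)
        finally show ?thesis by simp
      qed
      have M'eq: "cnj x * M p q * y = cnj x * M' p q * y + cnj x * (w p * cnj (w q)) * y" for x y p q
        by (simp add: M'_def algebra_simps)
      have "(\<Sum>p\<in>insert r I. \<Sum>q\<in>insert r I. cnj (?a p) * M p q * ?a q)
          = (\<Sum>p\<in>insert r I. \<Sum>q\<in>insert r I. cnj (?a p) * M' p q * ?a q)"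
        unfolding M'eq sum.distrib ww by simp
      also have "\<dots> = (\<Sum>p\<in>I. \<Sum>q\<in>I. cnj (a p) * M' p q * a q)"
        unfolding split using insert.hyps by (auto simp: M0 intro!: sum.cong)
      finally show "(\<Sum>p\<in>I. \<Sum>q\<in>I. cnj (a p) * M' p q * a q) \<in> \<real>\<^sub>\<ge>\<^sub>0" using insert.prems(1)[of ?a] by simp
    qed
    moreover have "(\<Sum>p\<in>insert r I. \<Sum>q\<in>insert r I. M' p q * G p q) = (\<Sum>p\<in>I. \<Sum>q\<in>I. M' p q * G p q)"
      unfolding split by (simp add: M0)
    moreover have "(\<Sum>p\<in>insert r I. \<Sum>q\<in>insert r I. w p * cnj (w q) * G p q) \<in> \<real>\<^sub>\<ge>\<^sub>0"
      using insert.prems(2)[of "\<lambda>p. cnj (w p)"] by (simp only: complex_cnj_cnj mult.assoc mult.commute[of "G _ _"])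
    moreover have "(\<Sum>p\<in>insert r I. \<Sum>q\<in>insert r I. M p q * G p q)
        = (\<Sum>p\<in>insert r I. \<Sum>q\<in>insert r I. M' p q * G p q)
        + (\<Sum>p\<in>insert r I. \<Sum>q\<in>insert r I. w p * cnj (w q) * G p q)"
      unfolding sum.distrib[symmetric] by (simp add: M'_def algebra_simps)
    ultimately show ?thesis by (simp add: nonneg_Reals_iff)
  qed
qed

section \<open>Finite compressions, and complete positivity from the Choi form\<close>

definition fin_proj :: "'a::chilbert_space set \<Rightarrow> 'a \<Rightarrow> 'a" where
  "fin_proj F x = (\<Sum>e\<in>F. cinner e x *\<^sub>C e)"

lemma fin_proj:
  assumes E: "orthonormal E" and F: "finite F" "F \<subseteq> E"
  shows fin_proj_norm: "norm (fin_proj F x) \<le> norm x"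
    and bounded_clinear_fin_proj: "bounded_clinear (fin_proj F)"
    and adj_fin_proj: "adj (fin_proj F) = fin_proj F"
proof -
  show n: "norm (fin_proj F x) \<le> norm x" for x
    using orthonormal_norm_sum[OF E F, of "\<lambda>e. cinner e x"] Bessel_finite[OF E F, of x]
    by (intro power2_le_imp_le[of "norm (fin_proj F x)"]) (auto simp: fin_proj_def)
  show b: "bounded_clinear (fin_proj F)"
    by (rule bounded_clinearI[of _ 1])
      (use n in \<open>auto simp: fin_proj_def cinner_simps scaleC_add_left sum.distrib scaleC_scaleC scaleC_sum_right\<close>)
  show "adj (fin_proj F) = fin_proj F"
    by (rule adj_eqI[OF _ b])
      (simp add: fin_proj_def cinner_sum_left cinner_sum_right cinner_simps cinner_commute[symmetric] mult.commute)
qed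

lemma fin_proj_tendsto:
  "onb E \<Longrightarrow> ((\<lambda>F. fin_proj F x) \<longlongrightarrow> x) (finite_subsets_at_top E)"
  using onb_expansion[of E x] by (simp add: has_sum_def fin_proj_def[abs_def])

lemma bounded_bilinear_rank1_tc: "bounded_bilinear (\<lambda>u v :: 'a::chilbert_space. Tc (rank1 u v))"
proof
  have T: "Tc A + Tc C = Tc (\<lambda>x. A x + C x)" if "A \<in> trace_class" "C \<in> trace_class" for A C :: "'a \<Rightarrow> 'a"
    using that by (subst tc_op_inject[symmetric]) (simp add: tc_op_simps Tc_inverse trace_class_add)
  have S: "r *\<^sub>R Tc A = Tc (\<lambda>x. r *\<^sub>R A x)" if "A \<in> trace_class" for r and A :: "'a \<Rightarrow> 'a"
    using that trace_class_scaleC(1)[OF that, of "complex_of_real r"]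
    by (subst tc_op_inject[symmetric]) (simp add: tc_op_simps Tc_inverse scaleC_of_real)
  show "Tc (rank1 (a + b) c) = Tc (rank1 a c) + Tc (rank1 b c)"
    "Tc (rank1 c (a + b)) = Tc (rank1 c a) + Tc (rank1 c b)" for a b c :: 'a
    by (auto simp: T) (simp_all add: rank1_def scaleC_add_right scaleC_add_left cinner_simps)
  show "Tc (rank1 (r *\<^sub>R a) b) = r *\<^sub>R Tc (rank1 a b)" "Tc (rank1 a (r *\<^sub>R b)) = r *\<^sub>R Tc (rank1 a b)" for r and a b :: 'a
    by (auto simp: S) (simp_all add: rank1_def scaleC_of_real[symmetric] scaleC_scaleC cinner_simps mult.commute)
  show "\<exists>K. \<forall>a b :: 'a. norm (Tc (rank1 a b)) \<le> norm a * norm b * K"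
    by (intro exI[of _ 1]) (simp add: norm_tc_op Tc_inverse trace_norm_rank1)
qed

text \<open>For finitely many rank one terms the compression converges because \<open>rank1\<close>
  is continuous in both vectors. The tail of the representation is handled uniformly, since
  compression does not increase the trace norm.\<close>

lemma compress_tendsto:
  fixes X :: "'a::chilbert_space \<Rightarrow> 'a"
  assumes E: "onb E" and X: "X \<in> trace_class"
  shows "((\<lambda>F. Tc (fin_proj F \<circ> X \<circ> fin_proj F)) \<longlongrightarrow> Tc X) (finite_subsets_at_top E)"
proof (rule tendstoI)
  fix \<epsilon> :: real assume \<epsilon>: "\<epsilon> > 0"
  note oE = onb_orthonormal[OF E]
  obtain I :: "'a set" and u v where r: "nuclear_rep I u v X" by (rule trace_class_nuclear[OF X])
  \<comment> \<open>Three errors of at most \<open>\<epsilon> / 4\<close> keep the final inequality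
    strict.\<close>
  obtain J where J: "finite J" "J \<subseteq> I" "dist (\<Sum>i\<in>J. Tc (rank1 (u i) (v i))) (Tc X) \<le> \<epsilon> / 4"
    using has_sum_finite_approximation[OF tc_has_sum[OF r], of "\<epsilon> / 4"] \<epsilon> by auto
  let ?S = "\<Sum>i\<in>J. Tc (rank1 (u i) (v i))"
  have "((\<lambda>F. \<Sum>i\<in>J. Tc (rank1 (fin_proj F (u i)) (fin_proj F (v i)))) \<longlongrightarrow> ?S) (finite_subsets_at_top E)"
    by (intro tendsto_sum bounded_bilinear.tendsto[OF bounded_bilinear_rank1_tc] fin_proj_tendsto E)
  hence "\<forall>\<^sub>F F in finite_subsets_at_top E.
      dist (\<Sum>i\<in>J. Tc (rank1 (fin_proj F (u i)) (fin_proj F (v i)))) ?S < \<epsilon> / 4"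
    using \<epsilon> by (intro tendstoD) auto
  moreover have "\<forall>\<^sub>F F in finite_subsets_at_top E. finite F \<and> F \<subseteq> E"
    by (intro eventually_finite_subsets_at_top_weakI) auto
  ultimately show "\<forall>\<^sub>F F in finite_subsets_at_top E. dist (Tc (fin_proj F \<circ> X \<circ> fin_proj F)) (Tc X) < \<epsilon>"
  proof eventually_elim
    case (elim F)
    let ?P = "fin_proj F"
    have F: "finite F" "F \<subseteq> E" using elim by auto
    note bP = bounded_clinear_fin_proj[OF oE F]
    have oP: "onorm ?P \<le> 1" using fin_proj_norm[OF oE F] by (intro onorm_bound) auto
    have PYP: "?P \<circ> Y \<circ> ?P \<in> trace_class" "trace_norm (?P \<circ> Y \<circ> ?P) \<le> trace_norm Y" if Y: "Y \<in> trace_class" for Y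
    proof -
      note PY = trace_class_left[OF Y bP]
      show "?P \<circ> Y \<circ> ?P \<in> trace_class" by (rule trace_class_right[OF PY(1) bP])
      have "trace_norm (?P \<circ> Y \<circ> ?P) \<le> onorm ?P * trace_norm (?P \<circ> Y)"
        by (rule trace_class_right[OF PY(1) bP])
      also have "\<dots> \<le> 1 * trace_norm (?P \<circ> Y)" by (intro mult_right_mono oP trace_norm_nonneg PY)
      also have "\<dots> \<le> onorm ?P * trace_norm Y" using PY(2) by simp
      also have "\<dots> \<le> 1 * trace_norm Y" by (intro mult_right_mono oP trace_norm_nonneg Y)
      finally show "trace_norm (?P \<circ> Y \<circ> ?P) \<le> trace_norm Y" by simp
    qed
    define T where "T Y = Tc (?P \<circ> tc_op Y \<circ> ?P)" for Y
    have Top: "tc_op (T Y) = ?P \<circ> tc_op Y \<circ> ?P" for Y by (simp add: T_def Tc_inverse PYP)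
    have Tdiff: "T (Y - Z) = T Y - T Z" for Y Z
      by (subst tc_op_inject[symmetric]) (auto simp: Top tc_op_simps bounded_clinear_diff[OF bP])
    have Tn: "norm (T Y) \<le> norm Y" for Y by (simp add: norm_tc_op Top PYP)
    have Tadd: "T (Y + Z) = T Y + T Z" for Y Z
      by (subst tc_op_inject[symmetric]) (auto simp: Top tc_op_simps bounded_clinear_add[OF bP])
    have T0: "T 0 = 0"
      by (subst tc_op_inject[symmetric]) (auto simp: Top tc_op_simps bounded_clinear_zero[OF bP])
    have "T (Tc (rank1 a b)) = Tc (rank1 (?P a) (?P b))" for a b
      using cinner_adj_left[OF bP]
      by (subst tc_op_inject[symmetric], simp add: Top Tc_inverse)
        (auto simp: adj_fin_proj[OF oE F] bounded_clinear_scaleC[OF bP] rank1_def)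
    moreover have "T (sum f J) = (\<Sum>i\<in>J. T (f i))" for f
      using J(1) by (induction J rule: finite_induct) (auto simp: T0 Tadd)
    ultimately have TS: "T ?S = (\<Sum>i\<in>J. Tc (rank1 (?P (u i)) (?P (v i))))" by simp
    have "norm (T (Tc X) - Tc X) \<le> norm (T (Tc X - ?S)) + norm (T ?S - ?S) + norm (?S - Tc X)"
    proof -
      have "T (Tc X) - Tc X = (T (Tc X - ?S) + (T ?S - ?S)) + (?S - Tc X)" by (simp add: Tdiff)
      thus ?thesis
        using norm_triangle_ineq[of "T (Tc X - ?S) + (T ?S - ?S)" "?S - Tc X"]
          norm_triangle_ineq[of "T (Tc X - ?S)" "T ?S - ?S"] by simp
    qed
    also have "\<dots> \<le> \<epsilon> / 4 + \<epsilon> / 4 + \<epsilon> / 4"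
      using Tn[of "Tc X - ?S"] J(3) elim by (intro add_mono) (auto simp: TS dist_norm norm_minus_commute)
    also have "\<dots> < \<epsilon>" using \<epsilon> by simp
    finally show ?case by (simp add: T_def Tc_inverse X dist_norm)
  qed
qed

lemma compress_decomposition:
  assumes X: "bounded_clinear X"
  shows "fin_proj F \<circ> X \<circ> fin_proj F = (\<lambda>x. \<Sum>e\<in>F. \<Sum>f\<in>F. cinner e (X f) *\<^sub>C rank1 e f x)"
proof
  fix x
  have sl: "(\<Sum>f\<in>F. g f) *\<^sub>C e = (\<Sum>f\<in>F. g f *\<^sub>C e)" for g and e :: 'a
    by (induction F rule: infinite_finite_induct) (auto simp: scaleC_add_left)
  show "(fin_proj F \<circ> X \<circ> fin_proj F) x = (\<Sum>e\<in>F. \<Sum>f\<in>F. cinner e (X f) *\<^sub>C rank1 e f x)"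
    by (simp add: fin_proj_def bounded_clinear_sum[OF X] bounded_clinear_scaleC[OF X] cinner_sum_right
        cinner_simps sl rank1_def scaleC_scaleC mult.commute)
qed

lemma linear_maps_sum:
  assumes L: "L \<in> linear_maps" and F: "finite F" and X: "\<And>i. i \<in> F \<Longrightarrow> X i \<in> trace_class"
  shows "(\<lambda>x. \<Sum>i\<in>F. X i x) \<in> trace_class \<and> L (\<lambda>x. \<Sum>i\<in>F. X i x) = (\<lambda>x. \<Sum>i\<in>F. L (X i) x)"
  using F X
proof (induction F rule: finite_induct)
  case empty
  have "L (\<lambda>x. 0) = (\<lambda>x. 0)" using linear_maps_scaleC[OF L trace_class_zero, of 0] by simp
  thus ?case by (simp add: trace_class_zero)
next
  case (insert i F)
  thus ?case using linear_maps_add[OF L, of "X i" "\<lambda>x. \<Sum>i\<in>F. X i x"]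
    by (auto intro: trace_class_add)
qed

text \<open>After compression to finitely many basis vectors, the block form of
  \<open>L (X i j)\<close> is the sum of an entrywise product of two matrices indexed by pairs of a
  block number and a basis vector: one from the positive blocks \<open>X\<close>, the other from the
  Choi form of \<open>L\<close>. Both are positive semidefinite, so the Schur product theorem
  applies, and the compression is then removed by a limit.\<close>

lemma choi_positive_CP:
  fixes L :: "('a::chilbert_space \<Rightarrow> 'a) \<Rightarrow> 'a \<Rightarrow> 'a"
  assumes L: "L \<in> bounded_maps" and pos: "choi_positive L"
  shows "L \<in> CP"
  unfolding CP_def
proof (intro CollectI conjI allI impI)
  note lL = bounded_maps_linear[OF L]
  show "L \<in> linear_maps" by (rule lL)
  fix n :: nat and X :: "nat \<Rightarrow> nat \<Rightarrow> 'a \<Rightarrow> 'a"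
  assume "(\<forall>i<n. \<forall>j<n. X i j \<in> trace_class) \<and> block_positive n X"
  hence X: "\<And>i j. i < n \<Longrightarrow> j < n \<Longrightarrow> X i j \<in> trace_class"
    and Xpos: "\<And>x. (\<Sum>i<n. cinner (x i) (\<Sum>j<n. X i j (x j))) \<in> \<real>\<^sub>\<ge>\<^sub>0"
    by (auto simp: block_positive_def)
  obtain E :: "'a set" where E: "onb E" using onb_exists by blast
  note oE = onb_orthonormal[OF E]
  show "block_positive n (\<lambda>i j. L (X i j))"
    unfolding block_positive_def
  proof
    fix y :: "nat \<Rightarrow> 'a"
    define g where "g F = (\<Sum>i<n. \<Sum>j<n. cinner (y i) (L (fin_proj F \<circ> X i j \<circ> fin_proj F) (y j)))" for F
    have "((\<lambda>F. cinner (y i) (L (fin_proj F \<circ> X i j \<circ> fin_proj F) (y j)))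
        \<longlongrightarrow> cinner (y i) (L (X i j) (y j))) (finite_subsets_at_top E)" if ij: "i < n" "j < n" for i j
    proof -
      have "((\<lambda>F. cinner (y i) (tc_op (tc_map L (Tc (fin_proj F \<circ> X i j \<circ> fin_proj F))) (y j)))
          \<longlongrightarrow> cinner (y i) (tc_op (tc_map L (Tc (X i j))) (y j))) (finite_subsets_at_top E)"
        by (intro tendsto_intros bounded_linear.tendsto[OF bounded_linear_tc_op_apply]
            bounded_linear.tendsto[OF bounded_linear_tc_map[OF L]] compress_tendsto E X ij)
      moreover have "\<forall>\<^sub>F F in finite_subsets_at_top E.
          cinner (y i) (tc_op (tc_map L (Tc (fin_proj F \<circ> X i j \<circ> fin_proj F))) (y j))
          = cinner (y i) (L (fin_proj F \<circ> X i j \<circ> fin_proj F) (y j))"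
      proof (rule eventually_finite_subsets_at_top_weakI)
        fix F assume F: "finite F" "F \<subseteq> E"
        have "fin_proj F \<circ> X i j \<circ> fin_proj F \<in> trace_class"
          by (intro trace_class_right trace_class_left X ij bounded_clinear_fin_proj[OF oE F])
        thus "cinner (y i) (tc_op (tc_map L (Tc (fin_proj F \<circ> X i j \<circ> fin_proj F))) (y j))
          = cinner (y i) (L (fin_proj F \<circ> X i j \<circ> fin_proj F) (y j))"
          by (simp add: tc_op_tc_map[OF lL] Tc_inverse)
      qed
      ultimately show ?thesis
        by (simp add: tc_op_tc_map[OF lL] Tc_inverse X ij tendsto_cong)
    qed
    hence "(g \<longlongrightarrow> (\<Sum>i<n. \<Sum>j<n. cinner (y i) (L (X i j) (y j)))) (finite_subsets_at_top E)"
      unfolding g_def by (intro tendsto_sum) auto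
    moreover have "g F \<in> \<real>\<^sub>\<ge>\<^sub>0" if F: "finite F" "F \<subseteq> E" for F
    proof -
      let ?I = "{..<n} \<times> F"
      have c: "(\<Sum>p\<in>?I. h p) = (\<Sum>i<n. \<Sum>e\<in>F. h (i, e))" for h :: "nat \<times> 'a \<Rightarrow> complex"
        by (simp add: sum.cartesian_product case_prod_unfold)
      define M where "M = (\<lambda>(i, e) (j, f). cinner e (X i j f))"
      define G where "G = (\<lambda>(i, e) (j, f). cinner (y i) (L (rank1 e f) (y j)))"
      have "cinner (y i) (L (fin_proj F \<circ> X i j \<circ> fin_proj F) (y j))
          = (\<Sum>e\<in>F. \<Sum>f\<in>F. M (i, e) (j, f) * G (i, e) (j, f))" if ij: "i < n" "j < n" for i j
      proof -
        have tc1: "(\<lambda>x. c *\<^sub>C rank1 e f x) \<in> trace_class" for c and e f :: 'a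
          by (intro trace_class_scaleC) simp
        have "L (fin_proj F \<circ> X i j \<circ> fin_proj F)
            = (\<lambda>x. \<Sum>e\<in>F. \<Sum>f\<in>F. L (\<lambda>x. cinner e (X i j f) *\<^sub>C rank1 e f x) x)"
          unfolding compress_decomposition[OF trace_class_bounded_clinear[OF X[OF ij]]]
          using linear_maps_sum[OF lL F(1)] tc1 by simp
        thus ?thesis
          by (simp add: linear_maps_scaleC[OF lL] cinner_sum_right cinner_simps M_def G_def)
      qed
      hence "g F = (\<Sum>i<n. \<Sum>j<n. \<Sum>e\<in>F. \<Sum>f\<in>F. M (i, e) (j, f) * G (i, e) (j, f))"
        by (simp add: g_def)
      also have "\<dots> = (\<Sum>i<n. \<Sum>e\<in>F. \<Sum>j<n. \<Sum>f\<in>F. M (i, e) (j, f) * G (i, e) (j, f))"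
        by (intro sum.cong refl sum.swap)
      also have "\<dots> = (\<Sum>p\<in>?I. \<Sum>q\<in>?I. M p q * G p q)"
        by (simp only: c)
      also have "\<dots> \<in> \<real>\<^sub>\<ge>\<^sub>0"
      proof (rule Schur_sum_nonneg)
        show "finite ?I" using F by simp
        fix a :: "nat \<times> 'a \<Rightarrow> complex"
        \<comment> \<open>With these vectors the quadratic form of \<open>M\<close> at
          \<open>a\<close> is the block form of \<open>X\<close>.\<close>
        define x where "x j = (\<Sum>f\<in>F. a (j, f) *\<^sub>C f)" for j
        have "(\<Sum>p\<in>?I. \<Sum>q\<in>?I. cnj (a p) * M p q * a q)
            = (\<Sum>i<n. \<Sum>e\<in>F. \<Sum>j<n. \<Sum>f\<in>F. cnj (a (i, e)) * M (i, e) (j, f) * a (j, f))"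
          by (simp only: c)
        also have "\<dots> = (\<Sum>i<n. cinner (x i) (\<Sum>j<n. X i j (x j)))"
        proof (intro sum.cong refl)
          fix i assume "i \<in> {..<n}"
          have "X i j (x j) = (\<Sum>f\<in>F. a (j, f) *\<^sub>C X i j f)" if "j < n" for j
          proof -
            have b: "bounded_clinear (X i j)"
              using X[of i j] \<open>i \<in> {..<n}\<close> that by (intro trace_class_bounded_clinear) simp
            show ?thesis by (simp add: x_def bounded_clinear_sum[OF b] bounded_clinear_scaleC[OF b])
          qed
          hence "(\<Sum>j<n. X i j (x j)) = (\<Sum>j<n. \<Sum>f\<in>F. a (j, f) *\<^sub>C X i j f)" by simp
          thus "(\<Sum>e\<in>F. \<Sum>j<n. \<Sum>f\<in>F. cnj (a (i, e)) * M (i, e) (j, f) * a (j, f))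
              = cinner (x i) (\<Sum>j<n. X i j (x j))"
            unfolding x_def[of i] cinner_sum_left
            by (simp add: cinner_sum_right cinner_simps M_def sum_distrib_left mult_ac)
        qed
        also have "\<dots> \<in> \<real>\<^sub>\<ge>\<^sub>0" by (rule Xpos)
        finally show "(\<Sum>p\<in>?I. \<Sum>q\<in>?I. cnj (a p) * M p q * a q) \<in> \<real>\<^sub>\<ge>\<^sub>0" .
        \<comment> \<open>The coefficients are absorbed into the first vectors, conjugated because
          \<open>G\<close> is to be conjugate linear on the left. The quadratic form of
          \<open>G\<close> becomes the Choi form at a single finite rank operator.\<close>
        let ?u = "\<lambda>p. cnj (a p) *\<^sub>C snd p" and ?v = "\<lambda>p. y (fst p)"
        have "finite ?I" using F by simp
        have A: "(\<lambda>z. \<Sum>p\<in>?I. rank1 (?u p) (?v p) z) \<in> trace_class"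
          using linear_maps_sum[OF lL \<open>finite ?I\<close>, of "\<lambda>p. rank1 (?u p) (?v p)"] by simp
        have Lr: "L (rank1 (c *\<^sub>C e) (d *\<^sub>C f)) z = (c * cnj d) *\<^sub>C L (rank1 e f) z" for c d e f z
        proof -
          have "rank1 (c *\<^sub>C e) (d *\<^sub>C f) = (\<lambda>z. (c * cnj d) *\<^sub>C rank1 e f z)"
            by (auto simp: rank1_def cinner_simps scaleC_scaleC mult_ac)
          thus ?thesis by (simp add: linear_maps_scaleC[OF lL])
        qed
        have "(\<Sum>p\<in>?I. \<Sum>q\<in>?I. cnj (a p) * G p q * a q)
            = (\<Sum>p\<in>?I. cinner (?v p) (\<Sum>q\<in>?I. L (rank1 (?u p) (?u q)) (?v q)))"
          by (simp add: Lr cinner_sum_right cinner_simps G_def case_prod_unfold mult_ac)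
        also have "\<dots> = choi_form L (\<lambda>z. \<Sum>p\<in>?I. rank1 (?u p) (?v p) z) (\<lambda>z. \<Sum>p\<in>?I. rank1 (?u p) (?v p) z)"
          by (rule choi_form_finite[OF L \<open>finite ?I\<close>, symmetric])
        also have "\<dots> \<in> \<real>\<^sub>\<ge>\<^sub>0" using pos A unfolding choi_positive_def by blast
        finally show "(\<Sum>p\<in>?I. \<Sum>q\<in>?I. cnj (a p) * G p q * a q) \<in> \<real>\<^sub>\<ge>\<^sub>0" .
      qed
      finally show ?thesis .
    qed
    hence "\<forall>\<^sub>F F in finite_subsets_at_top E. g F \<in> \<real>\<^sub>\<ge>\<^sub>0"
      by (intro eventually_finite_subsets_at_top_weakI)
    ultimately have "(\<Sum>i<n. \<Sum>j<n. cinner (y i) (L (X i j) (y j))) \<in> \<real>\<^sub>\<ge>\<^sub>0"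
      using Lim_in_closed_set[OF closed_nonneg_Reals_complex] finite_subsets_at_top_neq_bot by blast
    thus "(\<Sum>i<n. cinner (y i) (\<Sum>j<n. L (X i j) (y j))) \<in> \<real>\<^sub>\<ge>\<^sub>0" by (simp add: cinner_sum_right)
  qed
qed

section \<open>Exponentials of bounded maps\<close>

text \<open>The Banach algebra of bounded operators on \<open>\<real> \<times> 'a\<close>; the summand \<open>\<real>\<close> only serves to make the
  identity have norm 1 when \<open>'a\<close> is trivial, so that the library exponential applies.\<close>

typedef (overloaded) 'a endo = "UNIV :: (('a::banach \<times> real) \<Rightarrow>\<^sub>L ('a \<times> real)) set"
  morphisms endo_op Endo ..

setup_lifting type_definition_endo

instantiation endo :: (banach) real_normed_algebra_1
begin

lift_definition zero_endo :: "'a endo" is 0 .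
lift_definition one_endo :: "'a endo" is id_blinfun .
lift_definition plus_endo :: "'a endo \<Rightarrow> 'a endo \<Rightarrow> 'a endo" is "(+)" .
lift_definition minus_endo :: "'a endo \<Rightarrow> 'a endo \<Rightarrow> 'a endo" is "(-)" .
lift_definition uminus_endo :: "'a endo \<Rightarrow> 'a endo" is uminus .
lift_definition times_endo :: "'a endo \<Rightarrow> 'a endo \<Rightarrow> 'a endo" is "(o\<^sub>L)" .
lift_definition scaleR_endo :: "real \<Rightarrow> 'a endo \<Rightarrow> 'a endo" is "scaleR" .
lift_definition norm_endo :: "'a endo \<Rightarrow> real" is norm .
definition dist_endo :: "'a endo \<Rightarrow> 'a endo \<Rightarrow> real" where "dist_endo A B = norm (A - B)"
definition sgn_endo :: "'a endo \<Rightarrow> 'a endo" where "sgn_endo A = inverse (norm A) *\<^sub>R A"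
definition uniformity_endo :: "('a endo \<times> 'a endo) filter" where
  "uniformity_endo = (INF e\<in>{0 <..}. principal {(x, y). dist x y < e})"
definition open_endo :: "'a endo set \<Rightarrow> bool" where
  "open_endo U \<longleftrightarrow> (\<forall>x\<in>U. eventually (\<lambda>(x', y). x' = x \<longrightarrow> y \<in> U) uniformity)"

instance
proof
  note bb = bounded_bilinear_blinfun_compose
  fix A B C :: "'a endo" and r s :: real
  show "A + B + C = A + (B + C)" by transfer (simp add: add.assoc)
  show "A + B = B + A" by transfer (simp add: add.commute)
  show "0 + A = A" by transfer simp
  show "- A + A = 0" by transfer simp
  show "A - B = A + - B" by transfer simp
  show "r *\<^sub>R (A + B) = r *\<^sub>R A + r *\<^sub>R B" by transfer (simp add: scaleR_add_right)
  show "(r + s) *\<^sub>R A = r *\<^sub>R A + s *\<^sub>R A" by transfer (simp add: scaleR_add_left)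
  show "r *\<^sub>R s *\<^sub>R A = (r * s) *\<^sub>R A" by transfer simp
  show "1 *\<^sub>R A = A" by transfer simp
  show "A * B * C = A * (B * C)" by transfer (rule blinfun_compose_assoc)
  show "(A + B) * C = A * C + B * C" by transfer (rule bounded_bilinear.add_left[OF bb])
  show "A * (B + C) = A * B + A * C" by transfer (rule bounded_bilinear.add_right[OF bb])
  show "(r *\<^sub>R A) * B = r *\<^sub>R (A * B)" by transfer (rule bounded_bilinear.scaleR_left[OF bb])
  show "A * (r *\<^sub>R B) = r *\<^sub>R (A * B)" by transfer (rule bounded_bilinear.scaleR_right[OF bb])
  show "1 * A = A" "A * 1 = A" by (transfer, rule blinfun_eqI, simp)+
  have n1: "norm (id_blinfun :: ('a \<times> real) \<Rightarrow>\<^sub>L ('a \<times> real)) = 1"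
  proof (rule antisym)
    show "norm (id_blinfun :: ('a \<times> real) \<Rightarrow>\<^sub>L ('a \<times> real)) \<le> 1" by (rule norm_blinfun_id_le)
    show "1 \<le> norm (id_blinfun :: ('a \<times> real) \<Rightarrow>\<^sub>L ('a \<times> real))"
      using norm_blinfun[of id_blinfun "(0 :: 'a, 1 :: real)"] by simp
  qed
  show "(0 :: 'a endo) \<noteq> 1" by transfer (use n1 in force)
  show "norm (1 :: 'a endo) = 1" by transfer (rule n1)
  show "norm (A * B) \<le> norm A * norm B" by transfer (rule norm_blinfun_compose)
  show "dist A B = norm (A - B)" by (simp add: dist_endo_def)
  show "sgn A = inverse (norm A) *\<^sub>R A" by (simp add: sgn_endo_def)
  show "uniformity = (INF e\<in>{0 <..}. principal {(x, y :: 'a endo). dist x y < e})"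
    by (simp add: uniformity_endo_def)
  show "open U = (\<forall>x\<in>U. eventually (\<lambda>(x', y). x' = x \<longrightarrow> y \<in> U) uniformity)" for U :: "'a endo set"
    by (simp add: open_endo_def)
  show "norm A = 0 \<longleftrightarrow> A = 0" by transfer simp
  show "norm (A + B) \<le> norm A + norm B" by transfer (rule norm_triangle_ineq)
  show "norm (r *\<^sub>R A) = \<bar>r\<bar> * norm A" by transfer simp
qed

end

instance endo :: (banach) banach
proof
  fix X :: "nat \<Rightarrow> 'a endo" assume X: "Cauchy X"
  have n: "norm (endo_op A - endo_op B) = norm (A - B)" for A B :: "'a endo" by transfer simp
  have "Cauchy (\<lambda>n. endo_op (X n))" using X unfolding Cauchy_iff n .
  hence "convergent (\<lambda>n. endo_op (X n))" by (rule Cauchy_convergent)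
  then obtain L where L: "(\<lambda>n. endo_op (X n)) \<longlonglongrightarrow> L" unfolding convergent_def by blast
  have "norm (X n - Endo L) = norm (endo_op (X n) - L)" for n
    using n[of "X n" "Endo L"] by (simp add: Endo_inverse)
  hence "X \<longlonglongrightarrow> Endo L" using L unfolding LIMSEQ_iff by simp
  thus "convergent X" by (rule convergentI)
qed

section \<open>The exponential as a limit of powers\<close>

lemma norm_exp_minus_affine_le:
  fixes z :: "'b::{real_normed_algebra_1,banach}"
  shows "norm (exp z - 1 - z) \<le> (norm z)\<^sup>2 * exp (norm z)"
proof -
  let ?f = "\<lambda>n. inverse (fact (n + 2)) *\<^sub>R z ^ (n + 2)"
  have s: "summable (\<lambda>n. inverse (fact n) *\<^sub>R z ^ n)" by (rule summable_exp_generic)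
  have s2: "summable ?f" using s by (subst summable_iff_shift)
  have "exp z = suminf ?f + (\<Sum>i<2. inverse (fact i) *\<^sub>R z ^ i)"
    unfolding exp_def
    using suminf_split_initial_segment[OF s, of 2] by simp
  hence eq: "exp z - 1 - z = suminf ?f" by (simp add: numeral_2_eq_2)
  have g: "(\<lambda>n. (norm z)\<^sup>2 * (inverse (fact n) *\<^sub>R norm z ^ n)) sums ((norm z)\<^sup>2 * exp (norm z))"
    by (intro sums_mult exp_converges[unfolded divide_real_def, of "norm z", simplified])
      (use exp_converges[of "norm z"] in \<open>simp add: divide_inverse mult.commute\<close>)
  have le: "norm (?f n) \<le> (norm z)\<^sup>2 * (inverse (fact n) *\<^sub>R norm z ^ n)" for n
  proof -
    have "norm (z ^ (n + 2)) \<le> norm z ^ (n + 2)" by (rule norm_power_ineq)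
    moreover have "inverse (fact (n + 2)) \<le> (inverse (fact n) :: real)"
      by (intro le_imp_inverse_le fact_mono) auto
    ultimately have "inverse (fact (n + 2)) * norm (z ^ (n + 2)) \<le> inverse (fact n) * norm z ^ (n + 2)"
      by (intro mult_mono) auto
    thus ?thesis by (simp add: power_add power2_eq_square mult_ac)
  qed
  show ?thesis unfolding eq sums_unique[OF g]
    by (rule norm_suminf_le[OF le sums_summable[OF g]])
qed

text \<open>Exchanging \<open>x\<close> for \<open>y\<close> one factor at a time produces
  \<open>n\<close> terms; since \<open>M \<ge> 1\<close>, each mixed product of powers is bounded by
  \<open>M ^ n\<close>.\<close>

lemma norm_power_diff_le:
  fixes x y :: "'b::real_normed_algebra_1"
  assumes x: "norm x \<le> M" and y: "norm y \<le> M" and M: "M \<ge> 1"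
  shows "norm (x ^ n - y ^ n) \<le> real n * M ^ n * norm (x - y)"
proof (induction n)
  case (Suc n)
  have M0: "M \<ge> 0" using M by simp
  have yn: "norm (y ^ n) \<le> M ^ n"
    using norm_power_ineq[of y n] power_mono[OF y norm_ge_zero, of n] by linarith
  have "x ^ Suc n - y ^ Suc n = x * (x ^ n - y ^ n) + (x - y) * y ^ n"
    by (simp add: algebra_simps)
  hence "norm (x ^ Suc n - y ^ Suc n) \<le> norm x * norm (x ^ n - y ^ n) + norm (x - y) * norm (y ^ n)"
    by (metis norm_triangle_mono norm_mult_ineq)
  also have "\<dots> \<le> M * (real n * M ^ n * norm (x - y)) + norm (x - y) * M ^ n"
    using Suc M0 by (intro add_mono mult_mono x yn) auto
  also have "\<dots> \<le> M * (real n * M ^ n * norm (x - y)) + norm (x - y) * M ^ Suc n"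
    using M by (intro add_left_mono mult_left_mono power_increasing) auto
  also have "\<dots> = real (Suc n) * M ^ Suc n * norm (x - y)" by (simp add: algebra_simps)
  finally show ?case .
qed simp

lemma exp_scaleR_nat:
  fixes x :: "'b::{real_normed_algebra_1,banach}"
  shows "exp (real n *\<^sub>R x) = exp x ^ n"
proof (induction n)
  case (Suc n)
  have "exp (real (Suc n) *\<^sub>R x) = exp (x + real n *\<^sub>R x)" by (simp add: scaleR_add_left)
  also have "\<dots> = exp x * exp (real n *\<^sub>R x)" by (rule exp_add_commuting) simp
  finally show ?case by (simp add: Suc)
qed simp

text \<open>Compare with \<open>exp (a / n)\<close>, whose \<open>n\<close>-th power is exactly
  \<open>exp a\<close>. Both bases are bounded by \<open>exp (c / n)\<close>, so the powers stay
  below \<open>exp c\<close>; they differ by a quantity of order \<open>1 / n^2\<close>, and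
  telescoping costs only a factor \<open>n\<close>. The second-order term \<open>m\<close> is
  allowed because conjugation by a perturbed identity produces one.\<close>

lemma perturbed_power_tendsto_exp:
  fixes a m :: "'b::{real_normed_algebra_1,banach}"
  shows "(\<lambda>n. (1 + (1 / real n) *\<^sub>R a + (1 / real n)\<^sup>2 *\<^sub>R m) ^ n) \<longlonglongrightarrow> exp a"
proof -
  let ?x = "\<lambda>n. 1 + (1 / real n) *\<^sub>R a + (1 / real n)\<^sup>2 *\<^sub>R m"
  define c where "c = norm a + norm m"
  have c0: "c \<ge> 0" "norm a \<le> c" "norm m \<le> c" by (auto simp: c_def)
  define C where "C = exp c * (norm m + c\<^sup>2 * exp c)"
  have "norm (?x n ^ n - exp a) \<le> C * (1 / real n)" if n: "n \<ge> 1" for n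
  proof -
    define h where "h = 1 / real n"
    have h: "h > 0" "h \<le> 1" "real n * h = 1" using n by (auto simp: h_def)
    define y where "y = exp (h *\<^sub>R a)"
    define M where "M = exp (h * c)"
    have yn: "y ^ n = exp a"
    proof -
      have "y ^ n = exp (real n *\<^sub>R (h *\<^sub>R a))" unfolding y_def by (rule exp_scaleR_nat[symmetric])
      thus ?thesis by (simp add: h)
    qed
    have Mn: "M ^ n = exp c"
      unfolding M_def by (subst exp_of_nat_mult[symmetric]) (simp add: h(3) flip: mult.assoc)
    have M1: "M \<ge> 1" using h c0 by (simp add: M_def)
    have xM: "norm (?x n) \<le> M"
    proof -
      have "h\<^sup>2 \<le> h" using h by (simp add: power2_eq_square mult_left_le)
      hence h2: "h\<^sup>2 * norm m \<le> h * norm m" by (intro mult_right_mono) auto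
      have "norm (1 + h *\<^sub>R a + h\<^sup>2 *\<^sub>R m) \<le> 1 + h * norm a + h\<^sup>2 * norm m"
        using norm_triangle_ineq[of "1 + h *\<^sub>R a" "h\<^sup>2 *\<^sub>R m"] norm_triangle_ineq[of 1 "h *\<^sub>R a"] h by simp
      also have "\<dots> \<le> 1 + h * c" using h2 by (simp add: c_def algebra_simps)
      also have "\<dots> \<le> M" unfolding M_def by (rule exp_ge_add_one_self)
      finally show ?thesis by (simp add: h_def)
    qed
    have yM: "norm y \<le> M"
    proof -
      have "norm y \<le> exp (norm (h *\<^sub>R a))" unfolding y_def by (rule norm_exp)
      also have "\<dots> \<le> M" using h c0 by (simp add: M_def mult_left_mono)
      finally show ?thesis .
    qed
    have xy: "norm (?x n - y) \<le> h\<^sup>2 * (norm m + c\<^sup>2 * exp c)"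
    proof -
      have "?x n - y = h\<^sup>2 *\<^sub>R m - (y - 1 - h *\<^sub>R a)" by (simp add: h_def)
      hence "norm (?x n - y) \<le> norm (h\<^sup>2 *\<^sub>R m) + norm (y - 1 - h *\<^sub>R a)"
        by (metis norm_triangle_ineq4)
      also have "\<dots> \<le> h\<^sup>2 * norm m + (norm (h *\<^sub>R a))\<^sup>2 * exp (norm (h *\<^sub>R a))"
        unfolding y_def using norm_exp_minus_affine_le[of "h *\<^sub>R a"] by simp
      also have "\<dots> \<le> h\<^sup>2 * norm m + (h * c)\<^sup>2 * exp c"
      proof (intro add_left_mono mult_mono power_mono)
        show "norm (h *\<^sub>R a) \<le> h * c" using h c0 by (simp add: mult_left_mono)
        have "h * norm a \<le> 1 * c" using h c0 by (intro mult_mono) auto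
        thus "exp (norm (h *\<^sub>R a)) \<le> exp c" using h by simp
      qed auto
      finally show ?thesis by (simp add: power_mult_distrib algebra_simps)
    qed
    have "norm (?x n ^ n - exp a) \<le> real n * M ^ n * norm (?x n - y)"
      unfolding yn[symmetric] by (rule norm_power_diff_le[OF xM yM M1])
    also have "\<dots> \<le> real n * exp c * (h\<^sup>2 * (norm m + c\<^sup>2 * exp c))"
      unfolding Mn by (intro mult_left_mono xy) auto
    also have "\<dots> = (real n * h) * h * C" by (simp add: C_def power2_eq_square)
    finally show ?thesis by (simp only: h(3)) (simp add: h_def)
  qed
  hence ev: "\<forall>\<^sub>F n in sequentially. norm (?x n ^ n - exp a) \<le> C * (1 / real n)"
    unfolding eventually_sequentially by blast
  have "(\<lambda>n. C * (1 / real n)) \<longlonglongrightarrow> C * 0"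
    by (intro tendsto_mult tendsto_const lim_1_over_n)
  hence "(\<lambda>n. C * (1 / real n)) \<longlonglongrightarrow> 0" by simp
  with ev have "(\<lambda>n. ?x n ^ n - exp a) \<longlonglongrightarrow> 0" by (rule Lim_null_comparison)
  thus ?thesis by (rule LIM_zero_cancel)
qed

section \<open>Exponentials of maps on the trace class\<close>

definition endo_of :: "('a::banach \<Rightarrow> 'a) \<Rightarrow> 'a endo" where
  "endo_of f = Endo (Blinfun (\<lambda>p. (f (fst p), 0)))"

text \<open>\<open>endo_of f\<close> acts as \<open>f\<close> on the first summand and as 0 on the
  second. The first summand is therefore invariant, and its action can be read off from powers and
  from the exponential.\<close>

definition endo_apply :: "'a::banach endo \<Rightarrow> 'a \<Rightarrow> 'a" where
  "endo_apply A x = fst (endo_op A (x, 0))"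

lemma endo_of_op:
  fixes f :: "'a::banach \<Rightarrow> 'a"
  assumes f: "bounded_linear f"
  shows "endo_op (endo_of f) p = (f (fst p), 0)"
proof -
  have "bounded_linear (\<lambda>p :: 'a \<times> real. (f (fst p), 0 :: real))"
    by (intro bounded_linear_Pair bounded_linear_compose[OF f] bounded_linear_fst bounded_linear_zero)
  thus ?thesis by (simp add: endo_of_def Endo_inverse bounded_linear_Blinfun_apply)
qed

lemma endo_op_simps:
  "endo_op (A + B) p = endo_op A p + endo_op B p" "endo_op (A - B) p = endo_op A p - endo_op B p"
  "endo_op (r *\<^sub>R A) p = r *\<^sub>R endo_op A p"
  "endo_op 1 p = p" "endo_op (A * B) p = endo_op A (endo_op B p)"
  by (transfer, simp add: blinfun.add_left blinfun.diff_left blinfun.scaleR_left)+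

lemma bounded_linear_endo_apply: "bounded_linear (\<lambda>A. endo_apply A x)"
proof (rule bounded_linear_intro[of _ "norm x"])
  show "endo_apply (A + B) x = endo_apply A x + endo_apply B x" for A B
    by (simp add: endo_apply_def endo_op_simps)
  show "endo_apply (r *\<^sub>R A) x = r *\<^sub>R endo_apply A x" for r A
    by (simp add: endo_apply_def endo_op_simps)
  show "norm (endo_apply A x) \<le> norm A * norm x" for A
  proof -
    have "norm (fst (endo_op A (x, 0))) \<le> norm (endo_op A (x, 0))"
      by (metis norm_fst_le prod.collapse)
    also have "\<dots> \<le> norm (endo_op A) * norm (x, 0 :: real)" by (rule norm_blinfun)
    finally show ?thesis by (simp add: endo_apply_def norm_endo.rep_eq)
  qed
qed

lemma endo_of_power:
  assumes f: "bounded_linear f"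
  shows "endo_op (endo_of f ^ k) (x, 0) = ((f ^^ k) x, 0)"
  by (induction k) (auto simp: endo_op_simps endo_of_op[OF f])

lemma exp_endo_sums:
  assumes f: "bounded_linear f"
  shows "(\<lambda>k. (t ^ k / fact k) *\<^sub>R (f ^^ k) x) sums endo_apply (exp (t *\<^sub>R endo_of f)) x"
proof -
  have "(\<lambda>k. (t *\<^sub>R endo_of f) ^ k /\<^sub>R fact k) sums exp (t *\<^sub>R endo_of f)"
    by (rule exp_converges)
  from bounded_linear.sums[OF bounded_linear_endo_apply this, of x]
  show ?thesis
    by (simp add: endo_apply_def endo_op_simps endo_of_power[OF f] divide_inverse mult.commute scaleR_power)
qed

lemma tc_op_tc_map_power:
  assumes L: "L \<in> linear_maps"
  shows "tc_op ((tc_map L ^^ k) X) = (L ^^ k) (tc_op X)"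
  by (induction k) (auto simp: tc_op_tc_map[OF L])

lemma tc_op_sum: "tc_op (\<Sum>k<n. f k) x = (\<Sum>k<n::nat. tc_op (f k) x)"
  by (induction n) (auto simp: tc_op_simps)

text \<open>The partial sums converge in the Banach space \<open>tc\<close>, and limits in trace
  norm are unique, so the definite description in \<open>exp_map\<close> denotes the exponential of
  the algebra.\<close>

lemma exp_map_eq:
  fixes L :: "('a::chilbert_space \<Rightarrow> 'a) \<Rightarrow> 'a \<Rightarrow> 'a"
  assumes L: "L \<in> bounded_maps" and X: "X \<in> trace_class"
  shows "exp_map t L X = tc_op (endo_apply (exp (t *\<^sub>R endo_of (tc_map L))) (Tc X))"
proof -
  note lL = bounded_maps_linear[OF L]
  let ?E = "endo_apply (exp (t *\<^sub>R endo_of (tc_map L))) (Tc X)"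
  let ?s = "\<lambda>n. \<Sum>k<n. (t ^ k / fact k) *\<^sub>R (tc_map L ^^ k) (Tc X)"
  have lim: "?s \<longlonglongrightarrow> ?E" using exp_endo_sums[OF bounded_linear_tc_map[OF L]] by (simp add: sums_def)
  have eq: "trace_norm (\<lambda>x. Y x - (\<Sum>k<n. (t ^ k / fact k) *\<^sub>R (L ^^ k) X x)) = norm (Tc Y - ?s n)"
    if Y: "Y \<in> trace_class" for Y n
    by (simp add: norm_tc_op tc_op_simps tc_op_sum tc_op_tc_map_power[OF lL] Tc_inverse X Y)
  have "(THE Y. Y \<in> trace_class \<and>
     (\<lambda>n. trace_norm (\<lambda>x. Y x - (\<Sum>k<n. (t ^ k / fact k) *\<^sub>R (L ^^ k) X x))) \<longlonglongrightarrow> 0) = tc_op ?E"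
  proof (rule the_equality)
    have "(\<lambda>n. norm (?E - ?s n)) \<longlonglongrightarrow> norm (?E - ?E)" by (intro tendsto_intros lim)
    thus "tc_op ?E \<in> trace_class \<and>
      (\<lambda>n. trace_norm (\<lambda>x. tc_op ?E x - (\<Sum>k<n. (t ^ k / fact k) *\<^sub>R (L ^^ k) X x))) \<longlonglongrightarrow> 0"
      using eq[OF tc_op_trace_class] by (simp add: tc_op_inverse)
  next
    fix Y assume "Y \<in> trace_class \<and>
      (\<lambda>n. trace_norm (\<lambda>x. Y x - (\<Sum>k<n. (t ^ k / fact k) *\<^sub>R (L ^^ k) X x))) \<longlonglongrightarrow> 0"
    hence Y: "Y \<in> trace_class" and "(\<lambda>n. norm (Tc Y - ?s n)) \<longlonglongrightarrow> 0" by (auto simp: eq)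
    hence "(\<lambda>n. Tc Y - ?s n) \<longlonglongrightarrow> 0" by (simp add: tendsto_norm_zero_iff)
    hence "(\<lambda>n. Tc Y - (Tc Y - ?s n)) \<longlonglongrightarrow> Tc Y - 0" by (intro tendsto_intros)
    hence "Tc Y = ?E" using lim by (simp add: LIMSEQ_unique)
    thus "Y = tc_op ?E" using Tc_inverse[OF Y] by metis
  qed
  thus ?thesis using X by (simp add: exp_map_def)
qed

text \<open>A one-sided derivative is what is needed, because complete positivity of the
  exponentials is given for nonnegative times only. The quadratic remainder of the exponential
  leaves an error of order \<open>t\<close>.\<close>

lemma exp_map_right_derivative:
  fixes L :: "('a::chilbert_space \<Rightarrow> 'a) \<Rightarrow> 'a \<Rightarrow> 'a"
  assumes L: "L \<in> bounded_maps" and X: "X \<in> trace_class"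
  shows "((\<lambda>t. (1 / t) *\<^sub>R (exp_map t L X y - X y)) \<longlongrightarrow> L X y) (at_right 0)"
proof -
  note lL = bounded_maps_linear[OF L] and bL = bounded_linear_tc_map[OF L]
  define a where "a = endo_of (tc_map L)"
  have apply1: "endo_apply 1 Z = Z" "endo_apply a Z = tc_map L Z" for Z
    by (simp_all add: endo_apply_def endo_op_simps a_def endo_of_op[OF bL])
  have "((\<lambda>t. (1 / t) *\<^sub>R (exp (t *\<^sub>R a) - 1)) \<longlongrightarrow> a) (at_right 0)"
  proof (rule LIM_zero_cancel, rule Lim_null_comparison)
    show "\<forall>\<^sub>F t in at_right 0. norm ((1 / t) *\<^sub>R (exp (t *\<^sub>R a) - 1) - a) \<le> t * (norm a)\<^sup>2 * exp (t * norm a)"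
    proof (rule eventually_at_right_less[THEN eventually_mono])
      fix t :: real assume t: "0 < t"
      have "(1 / t) *\<^sub>R (exp (t *\<^sub>R a) - 1) - a = (1 / t) *\<^sub>R (exp (t *\<^sub>R a) - 1 - t *\<^sub>R a)"
        using t by (simp add: scaleR_diff_right)
      hence "norm ((1 / t) *\<^sub>R (exp (t *\<^sub>R a) - 1) - a) = (1 / t) * norm (exp (t *\<^sub>R a) - 1 - t *\<^sub>R a)"
        using t by simp
      also have "\<dots> \<le> (1 / t) * ((norm (t *\<^sub>R a))\<^sup>2 * exp (norm (t *\<^sub>R a)))"
        using t by (intro mult_left_mono norm_exp_minus_affine_le) auto
      also have "\<dots> = t * (norm a)\<^sup>2 * exp (t * norm a)"
        using t by (simp add: power2_eq_square)
      finally show "norm ((1 / t) *\<^sub>R (exp (t *\<^sub>R a) - 1) - a) \<le> t * (norm a)\<^sup>2 * exp (t * norm a)" .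
    qed
    have "((\<lambda>t. t * (norm a)\<^sup>2 * exp (t * norm a)) \<longlongrightarrow> 0 * (norm a)\<^sup>2 * exp (0 * norm a)) (at_right 0)"
      by (intro tendsto_intros)
    thus "((\<lambda>t. t * (norm a)\<^sup>2 * exp (t * norm a)) \<longlongrightarrow> 0) (at_right 0)" by simp
  qed
  hence "((\<lambda>t. tc_op (endo_apply ((1 / t) *\<^sub>R (exp (t *\<^sub>R a) - 1)) (Tc X)) y)
      \<longlongrightarrow> tc_op (endo_apply a (Tc X)) y) (at_right 0)"
    by (intro bounded_linear.tendsto[OF bounded_linear_tc_op_apply]
        bounded_linear.tendsto[OF bounded_linear_endo_apply])
  moreover have "tc_op (endo_apply ((1 / t) *\<^sub>R (exp (t *\<^sub>R a) - 1)) (Tc X)) y = (1 / t) *\<^sub>R (exp_map t L X y - X y)" for t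
  proof -
    have "endo_apply ((1 / t) *\<^sub>R (exp (t *\<^sub>R a) - 1)) (Tc X) = (1 / t) *\<^sub>R (endo_apply (exp (t *\<^sub>R a)) (Tc X) - Tc X)"
      by (simp only: endo_apply_def endo_op_simps fst_scaleR fst_diff fst_conv)
    thus ?thesis by (simp only: tc_op_simps exp_map_eq[OF L X] a_def Tc_inverse X)
  qed
  ultimately show ?thesis by (simp add: apply1 tc_op_tc_map[OF lL] Tc_inverse X)
qed

section \<open>Complete positivity of the exponentials\<close>

definition tc_cp :: "('a::chilbert_space tc \<Rightarrow> 'a tc) \<Rightarrow> bool" where
  "tc_cp f \<longleftrightarrow> (\<forall>n X. block_positive n (\<lambda>i j. tc_op (X i j)) \<longrightarrow> block_positive n (\<lambda>i j. tc_op (f (X i j))))"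

text \<open>On the type \<open>tc\<close> the trace class side conditions disappear, so closure
  under sums, powers and pointwise limits can be shown for plain functions and transferred
  back.\<close>

lemma tc_cp_iff:
  assumes L: "L \<in> linear_maps"
  shows "tc_cp (tc_map L) \<longleftrightarrow> L \<in> CP"
proof
  assume cp: "tc_cp (tc_map L)"
  show "L \<in> CP" unfolding CP_def
  proof (intro CollectI conjI allI impI L)
    fix n :: nat and X :: "nat \<Rightarrow> nat \<Rightarrow> 'a \<Rightarrow> 'a"
    assume X: "(\<forall>i<n. \<forall>j<n. X i j \<in> trace_class) \<and> block_positive n X"
    hence "block_positive n (\<lambda>i j. tc_op (Tc (X i j)))" by (simp add: block_positive_def Tc_inverse)
    hence "block_positive n (\<lambda>i j. tc_op (tc_map L (Tc (X i j))))"
      using cp[unfolded tc_cp_def, rule_format, of n "\<lambda>i j. Tc (X i j)"] by blast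
    thus "block_positive n (\<lambda>i j. L (X i j))" using X by (simp add: block_positive_def tc_op_tc_map[OF L] Tc_inverse)
  qed
next
  assume cp: "L \<in> CP"
  show "tc_cp (tc_map L)" unfolding tc_cp_def tc_op_tc_map[OF L]
    using CP_block_positive[OF cp, where X = "\<lambda>i j. tc_op (_ i j)"] by simp
qed

lemma tc_cp_add:
  assumes "tc_cp f" "tc_cp g" shows "tc_cp (\<lambda>X. f X + g X)"
  unfolding tc_cp_def
proof (intro allI impI)
  fix n and X :: "nat \<Rightarrow> nat \<Rightarrow> 'a tc" assume X: "block_positive n (\<lambda>i j. tc_op (X i j))"
  have "block_positive n (\<lambda>i j. tc_op (f (X i j)))" "block_positive n (\<lambda>i j. tc_op (g (X i j)))"
    using assms X by (simp_all add: tc_cp_def)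
  thus "block_positive n (\<lambda>i j. tc_op (f (X i j) + g (X i j)))"
    by (simp add: block_positive_def tc_op_simps sum.distrib cinner_simps nonneg_Reals_iff)
qed

lemma tc_cp_scaleR:
  assumes "tc_cp f" "r \<ge> 0" shows "tc_cp (\<lambda>X. r *\<^sub>R f X)"
  unfolding tc_cp_def
proof (intro allI impI)
  fix n and X :: "nat \<Rightarrow> nat \<Rightarrow> 'a tc" assume X: "block_positive n (\<lambda>i j. tc_op (X i j))"
  have "block_positive n (\<lambda>i j. tc_op (f (X i j)))" using assms X by (simp add: tc_cp_def)
  thus "block_positive n (\<lambda>i j. tc_op (r *\<^sub>R f (X i j)))"
    using \<open>r \<ge> 0\<close>
    by (simp add: block_positive_def tc_op_simps scaleR_sum_right[symmetric] cinner_simps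
        sum_distrib_left[symmetric] nonneg_Reals_iff)
qed

lemma tc_cp_funpow: "tc_cp f \<Longrightarrow> tc_cp (f ^^ k)"
  by (induction k) (auto simp: tc_cp_def)

lemma tc_cp_tendsto:
  assumes f: "\<And>X. ((\<lambda>n. f n X) \<longlonglongrightarrow> g X)" and cp: "\<And>n. n \<ge> 1 \<Longrightarrow> tc_cp (f n)"
  shows "tc_cp g"
  unfolding tc_cp_def
proof (intro allI impI)
  fix n and X :: "nat \<Rightarrow> nat \<Rightarrow> 'a tc" assume X: "block_positive n (\<lambda>i j. tc_op (X i j))"
  show "block_positive n (\<lambda>i j. tc_op (g (X i j)))"
    unfolding block_positive_def
  proof
    fix x :: "nat \<Rightarrow> 'a"
    have lim: "(\<lambda>m. \<Sum>i<n. cinner (x i) (\<Sum>j<n. tc_op (f (Suc m) (X i j)) (x j)))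
        \<longlonglongrightarrow> (\<Sum>i<n. cinner (x i) (\<Sum>j<n. tc_op (g (X i j)) (x j)))"
      by (intro tendsto_intros bounded_linear.tendsto[OF bounded_linear_tc_op_apply] LIMSEQ_Suc f)
    have "(\<Sum>i<n. cinner (x i) (\<Sum>j<n. tc_op (f (Suc m) (X i j)) (x j))) \<in> \<real>\<^sub>\<ge>\<^sub>0" for m
      using cp[of "Suc m"] X unfolding tc_cp_def block_positive_def by simp
    from tendsto_nonneg_Reals[OF lim _ this]
    show "(\<Sum>i<n. cinner (x i) (\<Sum>j<n. tc_op (g (X i j)) (x j))) \<in> \<real>\<^sub>\<ge>\<^sub>0" by simp
  qed
qed

definition conj_map :: "('a::chilbert_space \<Rightarrow> 'a) \<Rightarrow> 'a tc \<Rightarrow> 'a tc" where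
  "conj_map V X = Tc (V \<circ> tc_op X \<circ> adj V)"

lemma conj_map:
  assumes V: "bounded_clinear V"
  shows tc_op_conj_map: "tc_op (conj_map V X) = V \<circ> tc_op X \<circ> adj V"
    and bounded_linear_conj_map: "bounded_linear (conj_map V)"
    and tc_cp_conj_map: "tc_cp (conj_map V)"
proof -
  note aV = bounded_clinear_adj[OF V]
  have T: "V \<circ> tc_op X \<circ> adj V \<in> trace_class" for X
    by (intro trace_class_right trace_class_left V aV) simp
  show op: "tc_op (conj_map V X) = V \<circ> tc_op X \<circ> adj V" for X by (simp add: conj_map_def Tc_inverse T)
  show "bounded_linear (conj_map V)"
  proof (rule bounded_linear_intro[of _ "onorm V * onorm (adj V)"])
    show "conj_map V (X + Y) = conj_map V X + conj_map V Y" for X Y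
      by (subst tc_op_inject[symmetric]) (auto simp: op tc_op_simps bounded_clinear_add[OF V])
    show "conj_map V (r *\<^sub>R X) = r *\<^sub>R conj_map V X" for r X
      by (subst tc_op_inject[symmetric])
        (auto simp: op tc_op_simps bounded_clinear_scaleC[OF V] simp flip: scaleC_of_real)
    show "norm (conj_map V X) \<le> norm X * (onorm V * onorm (adj V))" for X
    proof -
      have "trace_norm (V \<circ> tc_op X \<circ> adj V) \<le> onorm (adj V) * trace_norm (V \<circ> tc_op X)"
        by (intro trace_class_right trace_class_left V aV) simp
      also have "\<dots> \<le> onorm (adj V) * (onorm V * trace_norm (tc_op X))"
        by (intro mult_left_mono trace_class_left V bounded_clinear_onorm_nonneg aV) simp
      finally show ?thesis by (simp add: norm_tc_op op mult_ac)
    qed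
  qed
  show "tc_cp (conj_map V)" unfolding tc_cp_def
  proof (intro allI impI)
    fix n and X :: "nat \<Rightarrow> nat \<Rightarrow> 'a tc" assume X: "block_positive n (\<lambda>i j. tc_op (X i j))"
    show "block_positive n (\<lambda>i j. tc_op (conj_map V (X i j)))" unfolding block_positive_def
    proof
      fix x :: "nat \<Rightarrow> 'a"
      have "(\<Sum>i<n. cinner (x i) (\<Sum>j<n. tc_op (conj_map V (X i j)) (x j)))
          = (\<Sum>i<n. cinner (adj V (x i)) (\<Sum>j<n. tc_op (X i j) (adj V (x j))))"
        by (simp add: op cinner_adj_left[OF V] bounded_clinear_sum[OF V])
      also have "\<dots> \<in> \<real>\<^sub>\<ge>\<^sub>0" using X unfolding block_positive_def by (rule spec)
      finally show "(\<Sum>i<n. cinner (x i) (\<Sum>j<n. tc_op (conj_map V (X i j)) (x j))) \<in> \<real>\<^sub>\<ge>\<^sub>0" .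
    qed
  qed
qed

lemma bounded_maps_plus:
  assumes L: "L \<in> bounded_maps" and M: "M \<in> bounded_maps"
  shows "(\<lambda>X\<in>trace_class. \<lambda>x. L X x + M X x) \<in> bounded_maps"
proof -
  note lL = bounded_maps_linear[OF L] and lM = bounded_maps_linear[OF M]
  note tc = linear_maps_trace_class[OF lL] linear_maps_trace_class[OF lM]
  obtain K where K: "\<And>X. X \<in> trace_class \<Longrightarrow> trace_norm (L X) \<le> K * trace_norm X"
    by (rule bounded_mapsE[OF L]) blast
  obtain K' where K': "\<And>X. X \<in> trace_class \<Longrightarrow> trace_norm (M X) \<le> K' * trace_norm X"
    by (rule bounded_mapsE[OF M]) blast
  have "(\<lambda>X\<in>trace_class. \<lambda>x. L X x + M X x) \<in> linear_maps"
    unfolding linear_maps_def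
    by (auto simp: trace_class_add trace_class_scaleC tc linear_maps_add[OF lL] linear_maps_add[OF lM]
        linear_maps_scaleC[OF lL] linear_maps_scaleC[OF lM] scaleC_add_right)
  moreover have "trace_norm (\<lambda>x. L X x + M X x) \<le> (K + K') * trace_norm X" if "X \<in> trace_class" for X
    using trace_class_add(2)[OF tc(1)[OF that] tc(2)[OF that]] K[OF that] K'[OF that]
    by (simp add: distrib_right)
  ultimately show ?thesis unfolding bounded_maps_def by (auto intro!: exI[of _ "K + K'"])
qed

lemma exp_map_linear:
  assumes L: "L \<in> bounded_maps"
  shows "exp_map t L \<in> linear_maps"
proof -
  note lL = bounded_maps_linear[OF L] and bL = bounded_linear_tc_map[OF L]
  let ?A = "exp (t *\<^sub>R endo_of (tc_map L))"
  have add: "endo_apply A (X + Y) = endo_apply A X + endo_apply A Y" for A :: "'a tc endo" and X Y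
  proof -
    have "(X + Y, 0 :: real) = (X, 0) + (Y, 0)" by simp
    thus ?thesis unfolding endo_apply_def by (simp only: blinfun.add_right fst_add)
  qed
  have Tadd: "Tc (\<lambda>x. X x + Y x) = Tc X + Tc Y" if "X \<in> trace_class" "Y \<in> trace_class" for X Y :: "'a \<Rightarrow> 'a"
    using that by (subst tc_op_inject[symmetric]) (simp add: tc_op_simps Tc_inverse trace_class_add)
  have power_scale: "(L ^^ k) X \<in> trace_class \<and> (L ^^ k) (\<lambda>x. c *\<^sub>C X x) = (\<lambda>x. c *\<^sub>C (L ^^ k) X x)"
    if "X \<in> trace_class" for c k X
    using that by (induction k) (auto simp: linear_maps_trace_class[OF lL] linear_maps_scaleC[OF lL])
  \<comment> \<open>\<open>tc\<close> carries a real structure only, so complex homogeneity is read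
    off the exponential series evaluated at a vector.\<close>
  have scale: "tc_op (endo_apply ?A (Tc (\<lambda>x. c *\<^sub>C X x))) y = c *\<^sub>C tc_op (endo_apply ?A (Tc X)) y"
    if X: "X \<in> trace_class" for c X y
  proof -
    have s: "(\<lambda>k. (t ^ k / fact k) *\<^sub>R (L ^^ k) Z y) sums tc_op (endo_apply ?A (Tc Z)) y"
      if "Z \<in> trace_class" for Z
    proof -
      have "(\<lambda>k. tc_op ((t ^ k / fact k) *\<^sub>R (tc_map L ^^ k) (Tc Z)) y) sums tc_op (endo_apply ?A (Tc Z)) y"
        by (rule bounded_linear.sums[OF bounded_linear_tc_op_apply exp_endo_sums[OF bL]])
      thus ?thesis using that by (simp add: tc_op_simps tc_op_tc_map_power[OF lL] Tc_inverse)
    qed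
    have "(\<lambda>k. c *\<^sub>C (t ^ k / fact k) *\<^sub>R (L ^^ k) X y) sums (c *\<^sub>C tc_op (endo_apply ?A (Tc X)) y)"
      by (rule bounded_linear.sums[OF bounded_linear_scaleC_right s[OF X]])
    moreover have "c *\<^sub>C (t ^ k / fact k) *\<^sub>R (L ^^ k) X y = (t ^ k / fact k) *\<^sub>R (L ^^ k) (\<lambda>x. c *\<^sub>C X x) y" for k
      using power_scale[OF X] by (simp add: scaleC_scaleC mult.commute flip: scaleC_of_real)
    ultimately show ?thesis
      using sums_unique2[OF s[OF trace_class_scaleC(1)[OF X]]] by simp
  qed
  show ?thesis unfolding linear_maps_def
  proof (intro CollectI conjI ballI allI)
    show "exp_map t L \<in> trace_class \<rightarrow>\<^sub>E trace_class"
      by (rule PiE_I) (simp add: exp_map_eq[OF L], simp add: exp_map_def)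
    fix X :: "'a \<Rightarrow> 'a" assume X: "X \<in> trace_class"
    show "exp_map t L (\<lambda>x. X x + Y x) = (\<lambda>x. exp_map t L X x + exp_map t L Y x)" if Y: "Y \<in> trace_class" for Y
      by (simp add: exp_map_eq[OF L] X Y trace_class_add Tadd add tc_op_simps)
    show "exp_map t L (\<lambda>x. c *\<^sub>C X x) = (\<lambda>x. c *\<^sub>C exp_map t L X x)" for c
      by (auto simp: exp_map_eq[OF L] X trace_class_scaleC scale)
  qed
qed

text \<open>With \<open>V = 1 + (t/n) K\<close>, the map \<open>V X V\<^sup>* + (t/n) \<Phi> X\<close> is completely positive and agrees with
  \<open>1 + (t/n) L\<close> up to \<open>O(n\<^sup>-\<^sup>2)\<close>, so its \<open>n\<close>-th power tends to \<open>exp (t L)\<close>.\<close>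

lemma exp_map_CP:
  fixes K :: "'a::chilbert_space \<Rightarrow> 'a"
  assumes K: "bounded_clinear K" and \<Phi>: "\<Phi> \<in> CP" and t: "t \<ge> 0"
  defines "L \<equiv> (\<lambda>X\<in>trace_class. \<lambda>x. lyapunov_map K X x + \<Phi> X x)"
  shows "exp_map t L \<in> CP"
proof -
  note b\<Phi> = CP_bounded[OF \<Phi>] and bK = lyapunov_map_bounded[OF K]
  have L: "L \<in> bounded_maps" unfolding L_def by (rule bounded_maps_plus[OF bK b\<Phi>])
  note lL = bounded_maps_linear[OF L]
  \<comment> \<open>Expanding the conjugation by \<open>V n\<close> leaves, beyond the identity and
    the first-order term, exactly the conjugation by \<open>K\<close> with factor
    \<open>(t / n)^2\<close>; this is the constant second-order term \<open>?m\<close> of the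
    perturbed power limit.\<close>
  let ?a = "t *\<^sub>R endo_of (tc_map L)" and ?m = "t\<^sup>2 *\<^sub>R endo_of (conj_map K)"
  define V where "V n x = x + complex_of_real (t / real n) *\<^sub>C K x" for n x
  have V: "bounded_clinear (V n)" for n
    unfolding V_def by (intro bounded_clinear_plus bounded_clinear_id bounded_clinear_smult K)
  have aV: "adj (V n) = (\<lambda>x. x + complex_of_real (t / real n) *\<^sub>C adj K x)" for n
    unfolding V_def
    by (simp add: adj_plus[OF bounded_clinear_id bounded_clinear_smult[OF K]] adj_id adj_smult[OF K])
  define \<Psi> where "\<Psi> n X = conj_map (V n) X + (t / real n) *\<^sub>R tc_map \<Phi> X" for n X
  have \<Psi>cp: "tc_cp (\<Psi> n)" for n
    unfolding \<Psi>_def using t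
    by (intro tc_cp_add tc_cp_scaleR tc_cp_conj_map V) (auto simp: tc_cp_iff CP_linear \<Phi>)
  have step: "endo_op (1 + (1 / real n) *\<^sub>R ?a + (1 / real n)\<^sup>2 *\<^sub>R ?m) (X, 0) = (\<Psi> n X, 0)" for n X
  proof -
    let ?r = "t / real n"
    have "X + ?r *\<^sub>R tc_map L X + ?r\<^sup>2 *\<^sub>R conj_map K X = \<Psi> n X"
    proof (subst tc_op_inject[symmetric], rule ext)
      fix x
      let ?X = "tc_op X"
      have bX: "bounded_clinear ?X" by (intro trace_class_bounded_clinear) simp
      show "tc_op (X + ?r *\<^sub>R tc_map L X + ?r\<^sup>2 *\<^sub>R conj_map K X) x = tc_op (\<Psi> n X) x"
        by (simp only: \<Psi>_def tc_op_simps tc_op_conj_map[OF K] tc_op_conj_map[OF V] o_def aV V_def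
            tc_op_tc_map[OF lL] tc_op_tc_map[OF CP_linear[OF \<Phi>]])
          (simp add: L_def lyapunov_map_def bounded_clinear_add[OF bX] bounded_clinear_scaleC[OF bX]
            bounded_clinear_add[OF K] bounded_clinear_scaleC[OF K] scaleC_add_right scaleC_scaleC
            power2_eq_square flip: scaleC_of_real)
    qed
    thus ?thesis
      by (simp add: endo_op_simps endo_of_op[OF bounded_linear_tc_map[OF L]]
          endo_of_op[OF bounded_linear_conj_map[OF K]] power_divide)
  qed
  have pow: "endo_op (A ^ k) (X, 0) = ((f ^^ k) X, 0)"
    if "\<And>X. endo_op A (X, 0) = (f X, 0)" for A k and f :: "'a tc \<Rightarrow> 'a tc" and X
    by (induction k) (simp_all add: endo_op_simps that)
  have "(\<lambda>n. (\<Psi> n ^^ n) X) \<longlonglongrightarrow> endo_apply (exp ?a) X" for X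
    using bounded_linear.tendsto[OF bounded_linear_endo_apply perturbed_power_tendsto_exp[of ?a ?m], of X]
    by (simp only: endo_apply_def pow[OF step] fst_conv)
  hence cp: "tc_cp (endo_apply (exp ?a))"
    by (rule tc_cp_tendsto) (intro tc_cp_funpow \<Psi>cp)
  have le: "exp_map t L \<in> linear_maps" by (rule exp_map_linear[OF L])
  have "tc_map (exp_map t L) X = endo_apply (exp ?a) X" for X
    by (subst tc_op_inject[symmetric]) (simp add: tc_op_tc_map[OF le] exp_map_eq[OF L] tc_op_inverse)
  hence "tc_map (exp_map t L) = endo_apply (exp ?a)" by auto
  with cp show ?thesis using tc_cp_iff[OF le] by simp
qed

section \<open>The parametrization of the generators\<close>

lemma LCP_bounded: "L \<in> LCP \<Longrightarrow> L \<in> bounded_maps"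
  and LCP_exp: "L \<in> LCP \<Longrightarrow> t \<ge> 0 \<Longrightarrow> exp_map t L \<in> CP"
  by (auto simp: LCP_def)

section \<open>Hermitian and conditionally positive forms\<close>

lemma choi_positive_hermitian:
  assumes L: "L \<in> bounded_maps" and pos: "choi_positive L"
    and A: "A \<in> trace_class" and C: "C \<in> trace_class"
  shows "choi_form L C A = cnj (choi_form L A C)"
proof -
  have "Im (cnj c * choi_form L A C + c * choi_form L C A) = 0" for c
  proof -
    have cC: "(\<lambda>x. c *\<^sub>C C x) \<in> trace_class" by (rule trace_class_scaleC(1)[OF C])
    have S: "(\<lambda>x. A x + c *\<^sub>C C x) \<in> trace_class" by (rule trace_class_add(1)[OF A cC])
    have "choi_form L (\<lambda>x. A x + c *\<^sub>C C x) (\<lambda>x. A x + c *\<^sub>C C x)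
        = choi_form L A A + cnj c * choi_form L A C + c * choi_form L C A + (c * cnj c) * choi_form L C C"
      by (simp add: choi_form_add_left[OF L A cC S] choi_form_add_right[OF L A cC A]
          choi_form_add_right[OF L A cC cC] choi_form_scaleC_right[OF L C A A]
          choi_form_scaleC_left[OF L C A A] choi_form_scaleC_left[OF L C A cC]
          choi_form_scaleC_right[OF L C A C])
    moreover have "Im (choi_form L D D) = 0" if "D \<in> trace_class" for D
      using pos that unfolding choi_positive_def nonneg_Reals_iff by blast
    ultimately have "Im (choi_form L A A + cnj c * choi_form L A C + c * choi_form L C A
        + (c * cnj c) * choi_form L C C) = 0" and "Im (choi_form L A A) = 0" "Im (choi_form L C C) = 0"
      using A C S by metis+
    thus ?thesis by (simp add: complex_mult_cnj)
  qed
  \<comment> \<open>The values 1 and \<open>\<i>\<close> of \<open>c\<close> yield the imaginary and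
    the real part of the claim.\<close>
  from this[of 1] this[of \<i>] show ?thesis by (simp add: complex_eq_iff)
qed

text \<open>A generator need not be positive, but its difference quotients are built from a
  completely positive map and the identity, both of which have hermitian forms; the symmetry
  survives the limit.\<close>

lemma LCP_rank1_hermitian:
  assumes L: "L \<in> LCP"
  shows "cinner y (L (rank1 x x') y') = cnj (cinner y' (L (rank1 x' x) y))"
proof (rule tendsto_unique)
  let ?d = "\<lambda>t x x' y. (1 / t) *\<^sub>R (exp_map t L (rank1 x x') y - rank1 x x' y)"
  have lim: "((\<lambda>t. ?d t x x' y) \<longlongrightarrow> L (rank1 x x') y) (at_right 0)" for x x' y
    by (rule exp_map_right_derivative[OF LCP_bounded[OF L]]) simp
  show l1: "((\<lambda>t. cinner y (?d t x x' y')) \<longlongrightarrow> cinner y (L (rank1 x x') y')) (at_right 0)"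
    by (intro tendsto_intros lim)
  have l2: "((\<lambda>t. cnj (cinner y' (?d t x' x y))) \<longlongrightarrow> cnj (cinner y' (L (rank1 x' x) y))) (at_right 0)"
    by (intro tendsto_intros lim)
  have "cinner y (?d t x x' y') = cnj (cinner y' (?d t x' x y))" if t: "t > 0" for t
  proof -
    have E: "exp_map t L \<in> CP" using LCP_exp[OF L] t by simp
    have "cinner y (exp_map t L (rank1 x x') y') = cnj (cinner y' (exp_map t L (rank1 x' x) y))"
      using choi_positive_hermitian[OF CP_bounded[OF E] CP_choi_positive[OF E], of "rank1 x' y'" "rank1 x y"]
      by (simp add: choi_form_rank1[OF CP_bounded[OF E]])
    moreover have "cinner y (rank1 x x' y') = cnj (cinner y' (rank1 x' x y))"
      by (simp add: rank1_def cinner_simps cinner_commute[symmetric] mult.commute)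
    ultimately show ?thesis by (simp add: cinner_simps)
  qed
  hence "\<forall>\<^sub>F t in at_right 0. cnj (cinner y' (?d t x' x y)) = cinner y (?d t x x' y')"
    by (intro eventually_at_right_less[THEN eventually_mono]) auto
  with l2 show "((\<lambda>t. cinner y (?d t x x' y')) \<longlongrightarrow> cnj (cinner y' (L (rank1 x' x) y))) (at_right 0)"
    by (rule Lim_transform_eventually)
qed simp

lemma LCP_choi_hermitian:
  fixes A C :: "'a::chilbert_space \<Rightarrow> 'a"
  assumes L: "L \<in> LCP" and A: "A \<in> trace_class" and C: "C \<in> trace_class"
  shows "choi_form L C A = cnj (choi_form L A C)"
proof -
  note bL = LCP_bounded[OF L]
  obtain I :: "'a set" and u v where r: "nuclear_rep I u v A" by (rule trace_class_nuclear[OF A])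
  obtain J :: "'a set" and u' v' where r': "nuclear_rep J u' v' C" by (rule trace_class_nuclear[OF C])
  have 1: "((\<lambda>(j, i). cinner (v' j) (L (rank1 (u' j) (u i)) (v i))) has_sum choi_form L C A) (J \<times> I)"
    by (rule choi_form_has_sums(2)[OF bL r' r])
  have "((\<lambda>(i, j). cinner (v i) (L (rank1 (u i) (u' j)) (v' j))) has_sum choi_form L A C) (I \<times> J)"
    by (rule choi_form_has_sums(2)[OF bL r r'])
  hence "((\<lambda>p. cnj (case p of (j, i) \<Rightarrow> cinner (v i) (L (rank1 (u i) (u' j)) (v' j)))) has_sum cnj (choi_form L A C)) (J \<times> I)"
    unfolding has_sum_cnj_iff by (subst (asm) has_sum_swap) (simp add: case_prod_unfold)
  with 1 show ?thesis
  proof (rule has_sum_eqI)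
    fix p :: "'a \<times> 'a"
    show "(case p of (j, i) \<Rightarrow> cinner (v' j) (L (rank1 (u' j) (u i)) (v i)))
        = cnj (case p of (j, i) \<Rightarrow> cinner (v i) (L (rank1 (u i) (u' j)) (v' j)))"
      by (cases p) (simp only: prod.case, rule LCP_rank1_hermitian[OF L])
  qed
qed

text \<open>Conditional complete positivity: the first-order term of \<open>exp (t L)\<close> is nonnegative where the
  zeroth-order term \<open>|tr A|\<^sup>2\<close> vanishes.\<close>

lemma LCP_conditionally_positive_finite:
  fixes u v :: "nat \<Rightarrow> 'a::chilbert_space"
  assumes L: "L \<in> LCP" and tr: "(\<Sum>i<n. cinner (v i) (u i)) = 0"
  shows "(\<Sum>i<n. cinner (v i) (\<Sum>j<n. L (rank1 (u i) (u j)) (v j))) \<in> \<real>\<^sub>\<ge>\<^sub>0"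
proof (rule Lim_in_closed_set)
  let ?d = "\<lambda>t i j. (1 / t) *\<^sub>R (exp_map t L (rank1 (u i) (u j)) (v j) - rank1 (u i) (u j) (v j))"
  show "closed (\<real>\<^sub>\<ge>\<^sub>0 :: complex set)" by (rule closed_nonneg_Reals_complex)
  show "((\<lambda>t. \<Sum>i<n. cinner (v i) (\<Sum>j<n. ?d t i j)) \<longlongrightarrow>
      (\<Sum>i<n. cinner (v i) (\<Sum>j<n. L (rank1 (u i) (u j)) (v j)))) (at_right 0)"
    by (intro tendsto_intros exp_map_right_derivative[OF LCP_bounded[OF L]]) simp
  have "(\<Sum>i<n. cinner (v i) (\<Sum>j<n. ?d t i j)) \<in> \<real>\<^sub>\<ge>\<^sub>0" if t: "t > 0" for t
  proof -
    \<comment> \<open>The zeroth-order term is the product of the trace and its conjugate, so the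
      quotient reduces to \<open>1 / t\<close> times the form of the exponential alone.\<close>
    have "(\<Sum>i<n. cinner (v i) (\<Sum>j<n. rank1 (u i) (u j) (v j)))
        = (\<Sum>i<n. cinner (v i) (u i)) * (\<Sum>j<n. cinner (u j) (v j))"
      unfolding sum_product by (simp add: rank1_def cinner_sum_right cinner_simps mult.commute)
    also have "\<dots> = 0" by (simp add: tr)
    finally have z: "(\<Sum>i<n. cinner (v i) (\<Sum>j<n. rank1 (u i) (u j) (v j))) = 0" .
    have "(\<Sum>i<n. cinner (v i) (\<Sum>j<n. ?d t i j)) = complex_of_real (1 / t) *
        ((\<Sum>i<n. cinner (v i) (\<Sum>j<n. exp_map t L (rank1 (u i) (u j)) (v j)))
          - (\<Sum>i<n. cinner (v i) (\<Sum>j<n. rank1 (u i) (u j) (v j))))"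
      by (simp only: scaleR_sum_right[symmetric] cinner_simps sum_subtractf sum_distrib_left[symmetric])
    moreover have "(\<Sum>i<n. cinner (v i) (\<Sum>j<n. exp_map t L (rank1 (u i) (u j)) (v j))) \<in> \<real>\<^sub>\<ge>\<^sub>0"
    proof -
      have "exp_map t L \<in> CP" using LCP_exp[OF L] t by simp
      hence "block_positive n (\<lambda>i j. exp_map t L (rank1 (u i) (u j)))"
        by (rule CP_block_positive[OF _ _ block_positive_rank1]) simp
      thus ?thesis unfolding block_positive_def by blast
    qed
    ultimately show ?thesis unfolding z using t by (simp add: nonneg_Reals_iff)
  qed
  thus "\<forall>\<^sub>F t in at_right 0. (\<Sum>i<n. cinner (v i) (\<Sum>j<n. ?d t i j)) \<in> \<real>\<^sub>\<ge>\<^sub>0"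
    by (intro eventually_at_right_less[THEN eventually_mono]) auto
qed simp

text \<open>Finite partial sums of \<open>A\<close> need not have trace zero. Subtracting their
  trace \<open>s F\<close> times the projection onto a fixed unit vector repairs this, and since
  \<open>s F\<close> tends to the trace of \<open>A\<close>, which is 0, the correction disappears
  in trace norm.\<close>

lemma LCP_conditionally_positive:
  fixes A :: "'a::chilbert_space \<Rightarrow> 'a"
  assumes L: "L \<in> LCP" and A: "A \<in> trace_class" and tr: "op_trace A = 0" and \<psi>: "norm (\<psi>::'a) = 1"
  shows "choi_form L A A \<in> \<real>\<^sub>\<ge>\<^sub>0"
proof -
  note bL = LCP_bounded[OF L]
  obtain E :: "'a set" and u v where r: "nuclear_rep E u v A" by (rule trace_class_nuclear[OF A])
  define s where "s F = (\<Sum>i\<in>F. cinner (v i) (u i))" for F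
  let ?S = "\<lambda>F. Tc (rank1 (- s F *\<^sub>C \<psi>) \<psi>) + (\<Sum>i\<in>F. Tc (rank1 (u i) (v i)))"
  have "(s \<longlongrightarrow> 0) (finite_subsets_at_top E)"
    using trace_nuclear_has_sum[OF r] unfolding s_def[abs_def] has_sum_def tr .
  hence "((\<lambda>F. Tc (rank1 (- s F *\<^sub>C \<psi>) \<psi>)) \<longlongrightarrow> Tc (rank1 (- 0 *\<^sub>C \<psi>) \<psi>)) (finite_subsets_at_top E)"
    by (intro bounded_bilinear.tendsto[OF bounded_bilinear_rank1_tc] tendsto_intros)
  moreover have "Tc (rank1 (- 0 *\<^sub>C \<psi>) \<psi>) = 0"
    using bounded_bilinear.zero_left[OF bounded_bilinear_rank1_tc, of \<psi>] by simp
  moreover have "((\<lambda>F. \<Sum>i\<in>F. Tc (rank1 (u i) (v i))) \<longlongrightarrow> Tc A) (finite_subsets_at_top E)"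
    using tc_has_sum[OF r] by (simp add: has_sum_def)
  ultimately have "(?S \<longlongrightarrow> 0 + Tc A) (finite_subsets_at_top E)"
    by (intro tendsto_add) auto
  hence lim: "((\<lambda>F. choi_form L (tc_op (?S F)) (tc_op (?S F))) \<longlongrightarrow> choi_form L (tc_op (Tc A)) (tc_op (Tc A)))
      (finite_subsets_at_top E)"
    by (intro bounded_bilinear.tendsto[OF bounded_bilinear_choi_form[OF bL]]) auto
  have "choi_form L (tc_op (?S F)) (tc_op (?S F)) \<in> \<real>\<^sub>\<ge>\<^sub>0" if F: "finite F" for F
  proof -
    obtain h where h: "bij_betw h {..<card F} F"
      using ex_bij_betw_nat_finite[OF F] by (auto simp: atLeast0LessThan)
    let ?n = "card F"
    \<comment> \<open>The trace correction is stored at the extra index \<open>card F\<close>, after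
      the enumerated terms.\<close>
    define u' where "u' k = (if k = ?n then - s F *\<^sub>C \<psi> else u (h k))" for k
    define v' where "v' k = (if k = ?n then \<psi> else v (h k))" for k
    have "tc_op (\<Sum>i\<in>F. Tc (rank1 (u i) (v i))) = (\<lambda>x. \<Sum>i\<in>F. rank1 (u i) (v i) x)"
      using F by (induction F rule: finite_induct) (auto simp: tc_op_simps Tc_inverse)
    also have "\<dots> = (\<lambda>x. \<Sum>k<?n. rank1 (u (h k)) (v (h k)) x)"
      by (simp only: sum.reindex_bij_betw[OF h, symmetric])
    finally have tS: "tc_op (?S F) = (\<lambda>x. \<Sum>k<Suc ?n. rank1 (u' k) (v' k) x)"
      by (simp add: tc_op_simps Tc_inverse u'_def v'_def add.commute)
    have "(\<Sum>k<Suc ?n. cinner (v' k) (u' k)) = (\<Sum>k<?n. cinner (v (h k)) (u (h k))) - s F"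
      by (simp add: u'_def v'_def cinner_simps cinner_self \<psi>)
    also have "\<dots> = 0" unfolding s_def by (simp only: sum.reindex_bij_betw[OF h, symmetric]) simp
    finally have "(\<Sum>i<Suc ?n. cinner (v' i) (\<Sum>j<Suc ?n. L (rank1 (u' i) (u' j)) (v' j))) \<in> \<real>\<^sub>\<ge>\<^sub>0"
      by (rule LCP_conditionally_positive_finite[OF L])
    thus ?thesis unfolding tS by (simp only: choi_form_finite[OF bL finite_lessThan])
  qed
  hence "\<forall>\<^sub>F F in finite_subsets_at_top E. choi_form L (tc_op (?S F)) (tc_op (?S F)) \<in> \<real>\<^sub>\<ge>\<^sub>0"
    by (intro eventually_finite_subsets_at_top_weakI) auto
  from Lim_in_closed_set[OF closed_nonneg_Reals_complex this _ lim]
  show ?thesis by (simp add: Tc_inverse A)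
qed

text \<open>Bounded operators are the dual of the trace class. Riesz produces \<open>K\<close> from
  the values of the functional on rank one operators, and convergence of nuclear representations in
  trace norm extends the identity to all of the trace class.\<close>

lemma choi_form_representation:
  fixes L :: "('a::chilbert_space \<Rightarrow> 'a) \<Rightarrow> 'a \<Rightarrow> 'a"
  assumes L: "L \<in> bounded_maps" and C: "C \<in> trace_class"
  obtains K where "bounded_clinear K" "\<And>A. A \<in> trace_class \<Longrightarrow> op_trace (K \<circ> A) = choi_form L A C"
proof -
  obtain M where M: "M \<ge> 0" "\<And>X. X \<in> trace_class \<Longrightarrow> trace_norm (L X) \<le> M * trace_norm X"
    using bounded_mapsE[OF L] by blast
  define N where "N = M * trace_norm C"
  have N0: "N \<ge> 0" using M(1) trace_norm_nonneg[OF C] by (simp add: N_def)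
  define q where "q x y = choi_form L (rank1 x y) C" for x y
  have R: "rank1 x y \<in> trace_class" for x y :: 'a by simp
  note lin = choi_form_add_left[OF L R R C] choi_form_scaleC_left[OF L R R C]
  have q: "q (x + x') y = q x y + q x' y" "q x (y + y') = q x y + q x y'"
    "q (c *\<^sub>C x) y = c * q x y" "q x (c *\<^sub>C y) = cnj c * q x y" for x x' y y' c
    unfolding q_def lin[symmetric] by (rule arg_cong[where f = "\<lambda>A. choi_form L A C"],
      auto simp: rank1_def scaleC_add_right scaleC_add_left cinner_simps scaleC_scaleC mult.commute)+
  have qn: "cmod (q x y) \<le> N * norm x * norm y" for x y
  proof -
    have "cmod (q x y) \<le> M * trace_norm (rank1 x y) * trace_norm C"
      unfolding q_def by (rule choi_form_bound[OF L R C M])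
    also have "\<dots> = N * trace_norm (rank1 x y)" by (simp add: N_def mult_ac)
    also have "\<dots> \<le> N * (norm x * norm y)" by (intro mult_left_mono trace_norm_rank1 N0)
    finally show ?thesis by (simp add: mult.assoc)
  qed
  have "\<exists>z. \<forall>y. cinner y z = q x y" for x
  proof -
    have "bounded_linear (\<lambda>y. cnj (q x y))"
    proof (rule bounded_linear_intro[of _ "N * norm x"])
      show "cnj (q x (r *\<^sub>R y)) = r *\<^sub>R cnj (q x y)" for r y
        by (simp add: q scaleR_conv_of_real flip: scaleC_of_real)
      show "norm (cnj (q x y)) \<le> norm y * (N * norm x)" for y
        using qn[of x y] by (simp add: mult_ac)
    qed (simp add: q)
    then obtain z where z: "\<And>y. cnj (q x y) = cinner z y"
      by (rule Riesz_representation) (auto simp: q)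
    have "cinner y z = q x y" for y using z[of y] cinner_commute[of y z] by (metis complex_cnj_cnj)
    thus ?thesis by blast
  qed
  then obtain K where K: "\<And>x y. cinner y (K x) = q x y" by metis
  have bK: "bounded_clinear K"
  proof (rule bounded_clinearI[of _ N])
    show "K (x + y) = K x + K y" for x y by (rule cinner_eqI) (simp add: K q cinner_simps)
    show "K (c *\<^sub>C x) = c *\<^sub>C K x" for c x by (rule cinner_eqI) (simp add: K q cinner_simps)
    show "norm (K x) \<le> N * norm x" for x
    proof -
      have "(norm (K x))\<^sup>2 = cmod (q x (K x))" by (simp add: K[symmetric] cinner_self norm_power)
      also have "\<dots> \<le> N * norm x * norm (K x)" by (rule qn)
      finally show ?thesis using N0 by (cases "K x = 0") (auto simp: power2_eq_square)
    qed
  qed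
  have "op_trace (K \<circ> A) = choi_form L A C" if A: "A \<in> trace_class" for A
  proof -
    obtain E :: "'a set" and u v where r: "nuclear_rep E u v A" by (rule trace_class_nuclear[OF A])
    have 1: "((\<lambda>i. cinner (v i) (K (u i))) has_sum op_trace (K \<circ> A)) E"
      by (rule trace_nuclear_has_sum[OF nuclear_rep_left[OF r bK]])
    have 2: "((\<lambda>i. choi_form L (tc_op (Tc (rank1 (u i) (v i)))) (tc_op (Tc C))) has_sum
        choi_form L (tc_op (Tc A)) (tc_op (Tc C))) E"
      by (rule has_sum_bounded_linear[OF bounded_bilinear.bounded_linear_left[OF bounded_bilinear_choi_form[OF L]]
            tc_has_sum[OF r]])
    have "op_trace (K \<circ> A) = choi_form L (tc_op (Tc A)) (tc_op (Tc C))"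
      by (rule has_sum_eqI[OF 1 2]) (simp add: K q_def Tc_inverse C)
    thus ?thesis by (simp add: Tc_inverse A C)
  qed
  with bK show ?thesis by (rule that)
qed

section \<open>Splitting a generator\<close>

lemma Xi_map_eq: "Xi_map (K, \<Phi>) = (\<lambda>X\<in>trace_class. \<lambda>x. lyapunov_map K X x + \<Phi> X x)"
  by (auto simp: Xi_map_def lyapunov_map_def)

lemma LCP_decomposition:
  fixes L :: "('a::chilbert_space \<Rightarrow> 'a) \<Rightarrow> 'a \<Rightarrow> 'a"
  assumes L: "L \<in> LCP" and \<beta>: "\<beta> \<in> trace_class" and t0: "Re (op_trace \<beta>) \<noteq> 0"
  obtains K \<Phi> where "bounded_clinear K" "Im (op_trace (K \<circ> \<beta>)) = 0" "\<Phi> \<in> CP"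
    "choi_form \<Phi> \<beta> \<beta> = 0" "Xi_map (K, \<Phi>) = L"
proof -
  note bL = LCP_bounded[OF L] and b\<beta> = trace_class_bounded_clinear[OF \<beta>]
  define \<tau> where "\<tau> = op_trace \<beta>"
  have \<tau>: "Re \<tau> \<noteq> 0" "\<tau> \<noteq> 0" using t0 by (auto simp: \<tau>_def)
  define Q where "Q = choi_form L"
  note herm = LCP_choi_hermitian[OF L, folded Q_def]
  \<comment> \<open>The space is nontrivial because \<open>\<beta>\<close> has nonzero trace; the
    vector serves the trace correction in conditional positivity.\<close>
  obtain \<psi> :: 'a where \<psi>: "norm \<psi> = 1"
  proof -
    have "\<beta> \<noteq> (\<lambda>x. 0)"
    proof
      assume "\<beta> = (\<lambda>x. 0)"
      hence "op_trace \<beta> = 0" using norm_op_trace_le[OF \<beta>] by (simp add: trace_norm_zero)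
      thus False using t0 by simp
    qed
    then obtain x where "\<beta> x \<noteq> 0" by auto
    hence "norm ((1 / norm (\<beta> x)) *\<^sub>R \<beta> x) = 1" by simp
    thus ?thesis by (rule that)
  qed
  obtain K0 where K0: "bounded_clinear K0" "\<And>A. A \<in> trace_class \<Longrightarrow> op_trace (K0 \<circ> A) = Q A \<beta>"
    unfolding Q_def using choi_form_representation[OF bL \<beta>] by blast
  define q where "q = Re (Q \<beta> \<beta>)"
  have Q\<beta>: "Q \<beta> \<beta> = of_real q" using herm[OF \<beta> \<beta>] by (simp add: q_def complex_eq_iff)
  \<comment> \<open>In the expansion of the corrected form the square of the modulus of the trace of
    \<open>A\<close> has coefficient \<open>q / (cmod \<tau>)^2\<close>. Each of the two conjugate
    summands of the Lyapunov form absorbs half of it.\<close>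
  define c where "c = q / (2 * (cmod \<tau>)\<^sup>2)"
  \<comment> \<open>An imaginary multiple of the identity does not change
    \<open>lyapunov_map K\<close>, but shifts the imaginary part of the trace of
    \<open>K \<circ> \<beta>\<close> by \<open>s * Re \<tau>\<close>; this value cancels it.\<close>
  define s where "s = - Im (Q \<beta> \<beta> / cnj \<tau> - of_real c * \<tau>) / Re \<tau>"
  define K where "K x = (1 / cnj \<tau>) *\<^sub>C K0 x + (- of_real c + \<i> * of_real s) *\<^sub>C x" for x
  have bK: "bounded_clinear K"
    unfolding K_def by (intro bounded_clinear_plus bounded_clinear_smult K0 bounded_clinear_id)
  have trK: "op_trace (K \<circ> A) = Q A \<beta> / cnj \<tau> + (- of_real c + \<i> * of_real s) * op_trace A"
    if A: "A \<in> trace_class" for A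
  proof -
    have KA: "K0 \<circ> A \<in> trace_class" by (rule trace_class_left(1)[OF A K0(1)])
    have "K \<circ> A = (\<lambda>x. (1 / cnj \<tau>) *\<^sub>C (K0 \<circ> A) x + (- of_real c + \<i> * of_real s) *\<^sub>C A x)"
      by (auto simp: K_def)
    hence "op_trace (K \<circ> A) = op_trace (\<lambda>x. (1 / cnj \<tau>) *\<^sub>C (K0 \<circ> A) x)
        + op_trace (\<lambda>x. (- of_real c + \<i> * of_real s) *\<^sub>C A x)"
      by (simp only: op_trace_add[OF trace_class_scaleC(1)[OF KA] trace_class_scaleC(1)[OF A]])
    thus ?thesis by (simp only: op_trace_scaleC[OF KA] op_trace_scaleC[OF A] K0(2)[OF A]) simp
  qed
  have ImK: "Im (op_trace (K \<circ> \<beta>)) = 0"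
  proof -
    have "op_trace (K \<circ> \<beta>) = (Q \<beta> \<beta> / cnj \<tau> - of_real c * \<tau>) + (\<i> * of_real s) * \<tau>"
      unfolding trK[OF \<beta>] \<tau>_def[symmetric] by (simp add: algebra_simps)
    hence "Im (op_trace (K \<circ> \<beta>)) = Im (Q \<beta> \<beta> / cnj \<tau> - of_real c * \<tau>) + s * Re \<tau>"
      by simp
    thus ?thesis unfolding s_def using \<tau>(1) by simp
  qed
  \<comment> \<open>With the sign reversed, the Lyapunov part of \<open>K\<close> is subtracted from
    \<open>L\<close> by adding two bounded maps.\<close>
  define K' where "K' x = (- 1) *\<^sub>C K x" for x
  have bK': "bounded_clinear K'" unfolding K'_def by (intro bounded_clinear_smult bK)
  note cK' = lyapunov_map_bounded[OF bK']
  define \<Phi> where "\<Phi> = (\<lambda>X\<in>trace_class. \<lambda>x. L X x + lyapunov_map K' X x)"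
  have b\<Phi>: "\<Phi> \<in> bounded_maps" unfolding \<Phi>_def by (rule bounded_maps_plus[OF bL cK'])
  have trK': "op_trace (K' \<circ> A) = - op_trace (K \<circ> A)" if A: "A \<in> trace_class" for A
    using op_trace_scaleC[OF trace_class_left(1)[OF A bK], of "- 1"] by (simp add: K'_def o_def)
  have choi\<Phi>: "choi_form \<Phi> A A = Q (\<lambda>x. A x + (- (op_trace A / \<tau>)) *\<^sub>C \<beta> x) (\<lambda>x. A x + (- (op_trace A / \<tau>)) *\<^sub>C \<beta> x)"
    if A: "A \<in> trace_class" for A
  proof -
    define a where "a = op_trace A"
    define l where "l = - (a / \<tau>)"
    have l\<beta>: "(\<lambda>x. l *\<^sub>C \<beta> x) \<in> trace_class" by (rule trace_class_scaleC(1)[OF \<beta>])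
    have S: "(\<lambda>x. A x + l *\<^sub>C \<beta> x) \<in> trace_class" by (rule trace_class_add(1)[OF A l\<beta>])
    have "Q (\<lambda>x. A x + l *\<^sub>C \<beta> x) (\<lambda>x. A x + l *\<^sub>C \<beta> x)
        = Q A A + cnj l * Q A \<beta> + l * Q \<beta> A + (l * cnj l) * Q \<beta> \<beta>"
      unfolding Q_def
      by (simp add: choi_form_add_left[OF bL A l\<beta> S] choi_form_add_right[OF bL A l\<beta> A]
          choi_form_add_right[OF bL A l\<beta> l\<beta>] choi_form_scaleC_right[OF bL \<beta> A A]
          choi_form_scaleC_left[OF bL \<beta> A A] choi_form_scaleC_left[OF bL \<beta> A l\<beta>]
          choi_form_scaleC_right[OF bL \<beta> A \<beta>])
    also have "\<dots> = Q A A - op_trace (K \<circ> A) * cnj a - a * cnj (op_trace (K \<circ> A))"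
    proof -
      have \<tau>\<tau>: "\<tau> * cnj \<tau> = of_real ((cmod \<tau>)\<^sup>2)" by (simp only: complex_norm_square)
      have "(l * cnj l) * Q \<beta> \<beta> = (a * cnj a) * of_real q / (\<tau> * cnj \<tau>)" by (simp add: l_def Q\<beta>)
      also have "\<dots> = 2 * of_real c * (a * cnj a)"
        unfolding \<tau>\<tau> c_def using \<tau>(2) by (simp add: field_simps)
      finally have 1: "(l * cnj l) * Q \<beta> \<beta> = 2 * of_real c * (a * cnj a)" .
      \<comment> \<open>When the conjugate is added, the contributions of \<open>s\<close> cancel
        and those of \<open>c\<close> double, which accounts for the term with
        \<open>Q \<beta> \<beta>\<close>.\<close>
      have 2: "op_trace (K \<circ> A) * cnj a = - (cnj l * Q A \<beta>) + (- of_real c + \<i> * of_real s) * (a * cnj a)"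
        unfolding trK[OF A] a_def[symmetric] by (simp add: l_def algebra_simps)
      have "a * cnj (op_trace (K \<circ> A)) = cnj (op_trace (K \<circ> A) * cnj a)" by simp
      also have "\<dots> = - (l * Q \<beta> A) + (- of_real c - \<i> * of_real s) * (a * cnj a)"
        unfolding 2 herm[OF A \<beta>] by (simp add: mult.commute)
      finally have 3: "a * cnj (op_trace (K \<circ> A)) = - (l * Q \<beta> A) + (- of_real c - \<i> * of_real s) * (a * cnj a)" .
      show ?thesis unfolding 1 2 3 by (simp add: algebra_simps)
    qed
    also have "\<dots> = Q A A + (op_trace (K' \<circ> A) * cnj a + a * cnj (op_trace (K' \<circ> A)))"
      by (simp add: trK'[OF A])
    also have "\<dots> = choi_form L A A + choi_form (lyapunov_map K') A A"
      by (simp add: Q_def choi_form_lyapunov_map[OF bK' A A] a_def)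
    also have "\<dots> = choi_form \<Phi> A A"
      by (rule choi_form_plus[OF bL cK' b\<Phi> _ A A, symmetric]) (simp add: \<Phi>_def)
    finally show ?thesis by (simp add: l_def a_def)
  qed
  have "choi_positive \<Phi>" unfolding choi_positive_def
  proof
    fix A :: "'a \<Rightarrow> 'a" assume A: "A \<in> trace_class"
    let ?l = "- (op_trace A / \<tau>)"
    have l\<beta>: "(\<lambda>x. ?l *\<^sub>C \<beta> x) \<in> trace_class" by (rule trace_class_scaleC(1)[OF \<beta>])
    have "op_trace (\<lambda>x. A x + ?l *\<^sub>C \<beta> x) = op_trace A + ?l * \<tau>"
      by (subst op_trace_add[OF A l\<beta>]) (simp only: op_trace_scaleC[OF \<beta>] \<tau>_def)
    also have "\<dots> = 0" using \<tau>(2) by simp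
    finally show "choi_form \<Phi> A A \<in> \<real>\<^sub>\<ge>\<^sub>0"
      unfolding choi\<Phi>[OF A] Q_def
      by (rule LCP_conditionally_positive[OF L trace_class_add(1)[OF A l\<beta>] _ \<psi>])
  qed
  hence \<Phi>CP: "\<Phi> \<in> CP" by (rule choi_positive_CP[OF b\<Phi>])
  have "choi_form \<Phi> \<beta> \<beta> = Q (\<lambda>x. 0) (\<lambda>x. 0)"
    using choi\<Phi>[OF \<beta>] \<tau>(2) by (simp add: \<tau>_def[symmetric] scaleC_minus_left)
  also have "\<dots> = 0"
    using bounded_bilinear.zero_left[OF bounded_bilinear_choi_form[OF bL], of 0] by (simp add: Q_def tc_op_simps)
  finally have z: "choi_form \<Phi> \<beta> \<beta> = 0" .
  have "Xi_map (K, \<Phi>) = L"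
  proof
    fix X :: "'a \<Rightarrow> 'a"
    show "Xi_map (K, \<Phi>) X = L X"
    proof (cases "X \<in> trace_class")
      case True
      \<comment> \<open>The Lyapunov parts of \<open>K\<close> and \<open>K'\<close> cancel,
        including the summands with the adjoints on the right.\<close>
      have "adj K' = (\<lambda>x. (- 1) *\<^sub>C adj K x)" unfolding K'_def using adj_smult[OF bK, of "- 1"] by simp
      thus ?thesis using True bounded_clinear_scaleC[OF trace_class_bounded_clinear[OF True], of "- 1"]
        by (auto simp: Xi_map_eq \<Phi>_def lyapunov_map_def K'_def scaleC_minus_left)
    next
      case False
      thus ?thesis using linear_maps_undefined[OF bounded_maps_linear[OF bL] False] by (simp add: Xi_map_eq)
    qed
  qed
  with bK ImK \<Phi>CP z show ?thesis by (rule that)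
qed

theorem theorem5p1:
  fixes B :: "'a::chilbert_space \<Rightarrow> 'a"
  assumes separable: "separable_space (euclidean :: 'a topology)"
    and B: "B \<in> trace_class"
    and Re_trace: "Re (op_trace B) \<noteq> 0"
  shows "bij_betw Xi_map
           ({K. bounded_clinear K \<and> Im (op_trace (adj B \<circ> K)) = 0} \<times> CP_on B) LCP"
proof -
  define \<beta> where "\<beta> = adj B"
  have \<beta>: "\<beta> \<in> trace_class" unfolding \<beta>_def by (rule trace_class_adj(1)[OF B])
  have \<tau>: "Re (op_trace \<beta>) \<noteq> 0" using Re_trace by (simp add: \<beta>_def trace_class_adj(3)[OF B])
  \<comment> \<open>The normalisation has \<open>adj B\<close> on the left, whereas the Lyapunov
    form produces traces with \<open>K\<close> on the left.\<close>
  have flip: "op_trace (\<beta> \<circ> K) = op_trace (K \<circ> \<beta>)" if "bounded_clinear K" for K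
    by (rule trace_class_right(3)[OF \<beta> that])
  have into: "Xi_map (K, \<Phi>) \<in> LCP" if K: "bounded_clinear K" and \<Phi>: "\<Phi> \<in> CP" for K \<Phi>
    unfolding LCP_def Xi_map_eq
    using bounded_maps_plus[OF lyapunov_map_bounded[OF K] CP_bounded[OF \<Phi>]] exp_map_CP[OF K \<Phi>] by blast
  have onto: "\<exists>K \<Phi>. bounded_clinear K \<and> Im (op_trace (\<beta> \<circ> K)) = 0 \<and> \<Phi> \<in> CP_on B \<and> Xi_map (K, \<Phi>) = L"
    if L: "L \<in> LCP" for L
    using LCP_decomposition[OF L \<beta> \<tau>] CP_onI[OF B] flip unfolding \<beta>_def by metis
  have choi_Xi: "choi_form (Xi_map (K, \<Phi>)) A \<beta>
      = op_trace (K \<circ> A) * cnj (op_trace \<beta>) + op_trace A * cnj (op_trace (K \<circ> \<beta>))"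
    if K: "bounded_clinear K" and \<Phi>: "\<Phi> \<in> CP_on B" and A: "A \<in> trace_class" for K \<Phi> A
  proof -
    note \<Phi>' = CP_on_choi[OF B \<Phi>, folded \<beta>_def]
    note b\<Phi> = CP_bounded[OF \<Phi>'(1)] and bK = lyapunov_map_bounded[OF K]
    have "choi_form (Xi_map (K, \<Phi>)) A \<beta> = choi_form (lyapunov_map K) A \<beta> + choi_form \<Phi> A \<beta>"
      unfolding Xi_map_eq by (rule choi_form_plus[OF bK b\<Phi> bounded_maps_plus[OF bK b\<Phi>] _ A \<beta>]) simp
    also have "choi_form \<Phi> A \<beta> = 0"
      by (rule choi_positive_orthogonal[OF b\<Phi> CP_choi_positive[OF \<Phi>'(1)] A \<beta> \<Phi>'(2)])
    finally show ?thesis by (simp add: choi_form_lyapunov_map[OF K A \<beta>])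
  qed
  have inj: "K = K' \<and> \<Phi> = \<Phi>'"
    if K: "bounded_clinear K" "Im (op_trace (\<beta> \<circ> K)) = 0" and K': "bounded_clinear K'" "Im (op_trace (\<beta> \<circ> K')) = 0"
      and \<Phi>: "\<Phi> \<in> CP_on B" and \<Phi>': "\<Phi>' \<in> CP_on B" and eq: "Xi_map (K, \<Phi>) = Xi_map (K', \<Phi>')" for K K' \<Phi> \<Phi>'
  proof -
    let ?\<tau> = "op_trace \<beta>"
    have e: "op_trace (K \<circ> A) * cnj ?\<tau> + op_trace A * cnj (op_trace (K \<circ> \<beta>))
        = op_trace (K' \<circ> A) * cnj ?\<tau> + op_trace A * cnj (op_trace (K' \<circ> \<beta>))" if "A \<in> trace_class" for A
      using choi_Xi[OF K(1) \<Phi> that] choi_Xi[OF K'(1) \<Phi>' that] eq by simp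
    \<comment> \<open>With both traces real, each side of the identity at \<open>\<beta>\<close> is
      \<open>2 * Re ?\<tau>\<close> times the corresponding trace. The two traces therefore agree,
      the second summands cancel for every \<open>A\<close>, and \<open>cnj ?\<tau>\<close> can be
      divided out.\<close>
    have im: "Im (op_trace (K \<circ> \<beta>)) = 0" "Im (op_trace (K' \<circ> \<beta>)) = 0"
      using K K' flip by auto
    have "Re (op_trace (K \<circ> \<beta>)) = Re (op_trace (K' \<circ> \<beta>))"
      using arg_cong[OF e[OF \<beta>], of Re] im \<tau> by simp
    hence k\<beta>: "op_trace (K \<circ> \<beta>) = op_trace (K' \<circ> \<beta>)" using im by (simp add: complex_eq_iff)
    have "?\<tau> \<noteq> 0" using \<tau> by auto
    hence tr: "op_trace (K \<circ> A) = op_trace (K' \<circ> A)" if "A \<in> trace_class" for A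
      using e[OF that] by (simp add: k\<beta>)
    have "op_trace (K \<circ> rank1 x y) = cinner y (K x)" if "bounded_clinear K" for K :: "'a \<Rightarrow> 'a" and x y
      using bounded_clinear_scaleC[OF that] rank1_trace[of y "K x"] by (simp add: rank1_def o_def)
    hence "cinner y (K x) = cinner y (K' x)" for x y
      using tr[of "rank1 x y"] K(1) K'(1) by simp
    hence KK: "K = K'" by (intro ext cinner_eqI)
    have "\<Phi> X = \<Phi>' X" for X
    proof (cases "X \<in> trace_class")
      case True
      thus ?thesis using fun_cong[OF eq, of X] KK by (auto simp: Xi_map_eq fun_eq_iff)
    next
      case False
      thus ?thesis
        using linear_maps_undefined[OF CP_linear[OF CP_on_choi(1)[OF B \<Phi>]] False]
          linear_maps_undefined[OF CP_linear[OF CP_on_choi(1)[OF B \<Phi>']] False] by simp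
    qed
    thus ?thesis using KK by auto
  qed
  show ?thesis
  proof (rule bij_betw_imageI)
    show "inj_on Xi_map ({K. bounded_clinear K \<and> Im (op_trace (adj B \<circ> K)) = 0} \<times> CP_on B)"
      by (rule inj_onI) (use inj in \<open>auto simp: \<beta>_def\<close>)
    show "Xi_map ` ({K. bounded_clinear K \<and> Im (op_trace (adj B \<circ> K)) = 0} \<times> CP_on B) = LCP"
    proof (intro equalityI subsetI)
      fix L assume "L \<in> Xi_map ` ({K. bounded_clinear K \<and> Im (op_trace (adj B \<circ> K)) = 0} \<times> CP_on B)"
      thus "L \<in> LCP" using into by (auto simp: CP_on_def)
    next
      fix L assume "L \<in> (LCP :: (('a \<Rightarrow> 'a) \<Rightarrow> 'a \<Rightarrow> 'a) set)"
      from onto[OF this] show "L \<in> Xi_map ` ({K. bounded_clinear K \<and> Im (op_trace (adj B \<circ> K)) = 0} \<times> CP_on B)"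
        unfolding \<beta>_def by (force simp: image_iff)
    qed
  qed
qed

end
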